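(* Assume that the linear evolution process $\{L(t,\tau)\colon t\ge\tau\}$ generated by $u_t=A(t)u$ on the Banach space $X$ has exponential splitting with bound $M\ge 1$, exponents $\gamma>\rho$ and projections $\{Q(\tau)\colon\tau\in\mathbb R\}$. Let $\Gamma$ be an admissible norm on $\mathbb R^2$, and let $f\colon\mathbb R\times X\to X$ be continuous, with $f(t,0)=0$ for all $t$, satisfying the Lipschitz conditions (with respect to the norms $|\cdot|_{N(t)}$, $|\cdot|_{S(t)}$, $\|\cdot\|_t$) with constants $L_1,L_2>0$. Assume that the perturbed problem $u_t=A(t)u+f(t,u)$ generates an evolution process $\{T(t,\tau)\colon t\ge\tau\}$ in $X$ satisfying the variation of constants formula $$T(t,\tau)\eta=L(t,\tau)\eta+\int_\tau^tL(t,s)f(s,T(s,\tau)\eta)\,ds,\qquad t\ge\tau,\ \eta\in X.$$ Assume that the gap condition $\Gamma\left(\frac{L_1}{\sigma-\rho},\frac{L_2}{\gamma-\sigma}\right)<1$ holds for some $\sigma\in(\rho,\gamma)$. Then there exists an invariant manifold $\{\mathcal M(t)\colon t\in\mathbb R\}$ for $\{T(t,\tau)\colon t\ge\tau\}$, given by $$\mathcal M(t)=\Big\{\eta\in X\colon \text{there is a global solution } z\colon\mathbb R\to X \text{ with } z(t)=\eta \text{ and } \sup_{r\le t}e^{\sigma r}\|z(r)\|_r<\infty\Big\},$$ with the following properties. (I) $\mathcal M(t)=\{Q(t)\eta+\Sigma(t,Q(t)\eta)\colon\eta\in X\}=P_\Sigma(t)X$, where $P_\Sigma(t)\eta:=Q(t)\eta+\Sigma(t,\eta)$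 and $\Sigma\colon\mathbb R\times X\to X$ is the function defined in the context. It satisfies $\Sigma(\tau,\eta)=\Sigma(\tau,Q(\tau)\eta)=(I-Q(\tau))\Sigma(\tau,\eta)$ and $\Sigma(\tau,0)=0$ for $\tau\in\mathbb R$, $\eta\in X$, and $$|\Sigma(\tau,\eta)-\Sigma(\tau,\tilde\eta)|_{S(\tau)}\le\kappa_\Sigma|Q(\tau)(\eta-\tilde\eta)|_{N(\tau)},\qquad \eta,\tilde\eta\in X,\ \tau\in\mathbb R,$$ with a constant $0<\kappa_\Sigma<\kappa=\frac{L_2}{L_1}\frac{\sigma-\rho}{\gamma-\sigma}$ satisfying $$\gamma-\rho=L_1\Gamma(1,\kappa_\Sigma)+L_2\Gamma\left(\tfrac1{\kappa_\Sigma},1\right),$$ so that the value of $\kappa_\Sigma$ depends only on $\gamma,\rho,L_1,L_2$ and $\Gamma$. (II) For every $\tau\in\mathbb R$ and $\eta\in\mathcal M(\tau)$, $$\|z(t)\|_t\le\frac{\Gamma(1,\kappa_\Sigma)}{\Gamma(1,0)}e^{-(\rho+L_1\Gamma(1,\kappa_\Sigma))(t-\tau)}\|\eta\|_\tau\quad\text{for } t\le\tau,$$ where $z\colon\mathbb R\to X$ is the unique global solution with $z(\tau)=\eta$ and $z(t)\in\mathcal M(t)$ for all $t\in\mathbb R$. (III) For all $t\ge\tau$ and $\eta\in X$, $$|T(t,\tau)\eta-P_\Sigma(t)T(t,\tau)\eta|_{S(t)}\le|\eta-P_\Sigma(\tau)\eta|_{S(\tau)}\,e^{-\omega(t-\tau)},\qquad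 \omega=\gamma-\frac{(\gamma-\rho)L_2\Gamma(0,1)}{\gamma-\rho-L_1\Gamma(1,\kappa_\Sigma)}\in(\rho,\gamma).$$ (IV) For each bounded $G\subset X$ there is $C_G>0$ such that $\operatorname{dist}(T(t,\tau)G,\mathcal M(t))\le C_Ge^{-\omega(t-\tau)}$ for all $t\ge\tau$, where $\operatorname{dist}(A,B)=\sup_{a\in A}\inf_{b\in B}\|a-b\|$. If additionally $\omega>0$, then $\{\mathcal M(t)\colon t\in\mathbb R\}$ is forward and pullback exponentially attracting, i.e. it is an inertial manifold for $\{T(t,\tau)\colon t\ge\tau\}$.
   Context: Setting. $(X,\|\cdot\|)$ is a Banach space, $\mathcal L(X)$ the bounded linear operators on $X$, $J=\{(t,\tau)\in\mathbb R^2\colon t\ge\tau\}$. A linear evolution process is a family $\{L(t,\tau)\colon(t,\tau)\in J\}\subset\mathcal L(X)$ with $L(t,\tau)=L(t,s)L(s,\tau)$ for $t\ge s\ge\tau$, $L(t,t)=I$, and $J\ni(t,\tau)\mapsto L(t,\tau)\eta\in X$ continuous for each $\eta\in X$. The (possibly unbounded) linear operators $A(t)$, $t\in\mathbb R$, generate such a process: $t\mapsto L(t,\tau)\eta$ is the mild solution of $u_t=A(t)u$, $u(\tau)=\eta$. Exponential splitting with bound $M\ge1$, exponents $\gamma>\rho$ and projections $Q(t)\in\mathcal L(X)$: (i) $Q(t)L(t,\tau)=L(t,\tau)Q(\tau)$ for $t\ge\tau$; (ii) $L(t,\tau)|_{Q(\tau)X}\colon Q(\tau)X\to Q(t)X$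 is an isomorphism for $t\ge\tau$, with inverse denoted $L(\tau,t)\colon Q(t)X\to Q(\tau)X$; (iii) $e^{\gamma(t-\tau)}\|L(t,\tau)(I-Q(\tau))\|\le M$ for $t\ge\tau$ and $e^{\rho(t-\tau)}\|L(t,\tau)Q(\tau)\|\le M$ for $t\le\tau$. Norms. $N(\tau)=Q(\tau)X$, $S(\tau)=(I-Q(\tau))X$; $|x|_{N(\tau)}=\sup_{t\le\tau}e^{\rho(t-\tau)}\|L(t,\tau)x\|$ for $x\in N(\tau)$; $|x|_{S(\tau)}=\sup_{t\ge\tau}e^{\gamma(t-\tau)}\|L(t,\tau)x\|$ for $x\in S(\tau)$. A norm $\Gamma\colon\mathbb R^2\to[0,\infty)$ is admissible if for all $a,b\ge0$ the functions $\Gamma(a,\cdot)$ and $\Gamma(\cdot,b)$ are non-decreasing on $[0,\infty)$. For such $\Gamma$, $\|x\|_\tau=\Gamma(|Q(\tau)x|_{N(\tau)},|(I-Q(\tau))x|_{S(\tau)})$, an equivalent norm on $X$. Lipschitz conditions: for all $t\in\mathbb R$, $u,v\in X$, $|Q(t)(f(t,u)-f(t,v))|_{N(t)}\le L_1\|u-v\|_t$ and $|(I-Q(t))(f(t,u)-f(t,v))|_{S(t)}\le L_2\|u-v\|_t$. Nonlinear process: maps $T(t,\tau)\colon X\to X$, $t\ge\tau$, with $T(t,t)=I$, $T(t,s)T(s,\tau)=T(t,\tau)$ for $t\ge s\ge\tau$, and $t\mapsto T(t,\tau)\eta$ continuous on $[\tau,\infty)$. A solution on an interval $\mathcal T\subset\mathbb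 R$ is $z\colon\mathcal T\to X$ with $T(t,s)z(s)=z(t)$ for $t\ge s$ in $\mathcal T$; it is global if $\mathcal T=\mathbb R$. A family $\{\mathcal M(t)\colon t\in\mathbb R\}$ of subsets of $X$ is an invariant manifold for $\{T(t,\tau)\}$ if (i) $T(t,\tau)\mathcal M(\tau)=\mathcal M(t)$ for all $t\ge\tau$; (ii) it is forward and pullback exponentially dominated: there is $\omega\in\mathbb R$ such that for each bounded $U\subset X$ there are $t_*\ge0$, $K>0$ with $\operatorname{dist}(T(t,\tau)U,\mathcal M(t))\le Ke^{-\omega(t-\tau)}$ whenever $t-\tau\ge t_*$; (iii) each $\mathcal M(t)$ is a Lipschitz graph. If in addition $\omega>0$, it is exponentially attracting and is called an inertial manifold. Definition of $\Sigma$. For $\tau\in\mathbb R$ let $E_{\sigma,\tau}=\{z\in C((-\infty,\tau];X)\colon\|z\|_{E_{\sigma,\tau}}=\sup_{t\le\tau}e^{\sigma(t-\tau)}\|z(t)\|_t<\infty\}$. For $\eta\in X$ let $z_{\tau,\eta}\in E_{\sigma,\tau}$ be the unique function in $E_{\sigma,\tau}$ with $$z_{\tau,\eta}(t)=L(t,\tau)Q(\tau)\eta-\int_t^\tau L(t,s)Q(s)f(s,z_{\tau,\eta}(s))\,ds+\int_{-\infty}^tL(t,s)(I-Q(s))f(s,z_{\tau,\eta}(s))\,ds,\quad t\le\tau$$ (it exists and is unique under the gap condition). Then $\Sigma(\tau,\eta)=(I-Q(\tau))z_{\tau,\eta}(\tau)=\int_{-\infty}^\tau L(\tau,s)(I-Q(s))f(s,z_{\tau,\eta}(s))\,ds$.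 *)

theory Defs
  imports "HOL-Analysis.Analysis"
begin

section \<open>Linear evolution processes with exponential splitting\<close>

text \<open>Only the values \<open>L t \<tau>\<close> with \<open>\<tau> \<le> t\<close> are meaningful.\<close>

definition linear_process :: "(real \<Rightarrow> real \<Rightarrow> 'a::banach \<Rightarrow>\<^sub>L 'a) \<Rightarrow> bool" where
  "linear_process L \<longleftrightarrow>
     (\<forall>t s \<tau>. \<tau> \<le> s \<longrightarrow> s \<le> t \<longrightarrow> L t \<tau> = L t s o\<^sub>L L s \<tau>) \<and>
     (\<forall>t. L t t = id_blinfun) \<and>
     (\<forall>\<eta>. continuous_on {(t, \<tau>). \<tau> \<le> t} (\<lambda>(t, \<tau>). blinfun_apply (L t \<tau>) \<eta>))"

text \<open>The two-sided family: for \<open>t < \<tau>\<close> this is the inverse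
  \<open>Q(\<tau>)X \<rightarrow> Q(t)X\<close> of the restriction of \<open>L \<tau> t\<close> to \<open>Q(t)X\<close>, which is meaningful
  on \<open>Q(\<tau>)X\<close> only.\<close>

definition Lext ::
    "(real \<Rightarrow> real \<Rightarrow> 'a::banach \<Rightarrow>\<^sub>L 'a) \<Rightarrow> (real \<Rightarrow> 'a \<Rightarrow>\<^sub>L 'a) \<Rightarrow> real \<Rightarrow> real \<Rightarrow> 'a \<Rightarrow> 'a" where
  "Lext L Q t \<tau> =
     (if \<tau> \<le> t then blinfun_apply (L t \<tau>)
      else inv_into (range (blinfun_apply (Q t))) (blinfun_apply (L \<tau> t)))"

definition exponential_splitting ::
    "(real \<Rightarrow> real \<Rightarrow> 'a::banach \<Rightarrow>\<^sub>L 'a) \<Rightarrow> (real \<Rightarrow> 'a \<Rightarrow>\<^sub>L 'a) \<Rightarrow> real \<Rightarrow> real \<Rightarrow> real \<Rightarrow> bool" where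
  "exponential_splitting L Q M \<gamma> \<rho> \<longleftrightarrow>
     1 \<le> M \<and> \<rho> < \<gamma> \<and>
     (\<forall>t. Q t o\<^sub>L Q t = Q t) \<and>
     (\<forall>t \<tau>. \<tau> \<le> t \<longrightarrow> Q t o\<^sub>L L t \<tau> = L t \<tau> o\<^sub>L Q \<tau>) \<and>
     (\<forall>t \<tau>. \<tau> \<le> t \<longrightarrow>
        homeomorphism (range (blinfun_apply (Q \<tau>))) (range (blinfun_apply (Q t)))
          (blinfun_apply (L t \<tau>))
          (inv_into (range (blinfun_apply (Q \<tau>))) (blinfun_apply (L t \<tau>)))) \<and>
     (\<forall>t \<tau>. \<tau> \<le> t \<longrightarrow> exp (\<gamma> * (t - \<tau>)) * norm (L t \<tau> o\<^sub>L (id_blinfun - Q \<tau>)) \<le> M) \<and>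
     (\<forall>t \<tau>. t \<le> \<tau> \<longrightarrow> exp (\<rho> * (t - \<tau>)) * onorm (\<lambda>x. Lext L Q t \<tau> (Q \<tau> x)) \<le> M)"


section \<open>Norms\<close>

text \<open>Under an exponential splitting both suprema are finite (at most \<open>M * norm x\<close>) for \<open>x\<close> in
  \<open>Q(\<tau>)X\<close> and in \<open>(I - Q(\<tau>))X\<close> respectively; the two norms are meant on these subspaces only.\<close>

definition N_norm ::
    "(real \<Rightarrow> real \<Rightarrow> 'a::banach \<Rightarrow>\<^sub>L 'a) \<Rightarrow> (real \<Rightarrow> 'a \<Rightarrow>\<^sub>L 'a) \<Rightarrow> real \<Rightarrow> real \<Rightarrow> 'a \<Rightarrow> real" where
  "N_norm L Q \<rho> \<tau> x = (SUP t\<in>{..\<tau>}. exp (\<rho> * (t - \<tau>)) * norm (Lext L Q t \<tau> x))"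

definition S_norm :: "(real \<Rightarrow> real \<Rightarrow> 'a::banach \<Rightarrow>\<^sub>L 'a) \<Rightarrow> real \<Rightarrow> real \<Rightarrow> 'a \<Rightarrow> real" where
  "S_norm L \<gamma> \<tau> x = (SUP t\<in>{\<tau>..}. exp (\<gamma> * (t - \<tau>)) * norm (L t \<tau> x))"

definition is_norm :: "('v::real_vector \<Rightarrow> real) \<Rightarrow> bool" where
  "is_norm n \<longleftrightarrow>
     (\<forall>x. 0 \<le> n x) \<and> (\<forall>x. n x = 0 \<longleftrightarrow> x = 0) \<and>
     (\<forall>c x. n (c *\<^sub>R x) = \<bar>c\<bar> * n x) \<and> (\<forall>x y. n (x + y) \<le> n x + n y)"

definition admissible_norm :: "(real \<times> real \<Rightarrow> real) \<Rightarrow> bool" where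
  "admissible_norm \<Gamma> \<longleftrightarrow>
     is_norm \<Gamma> \<and>
     (\<forall>a\<ge>0. mono_on {0..} (\<lambda>b. \<Gamma> (a, b))) \<and> (\<forall>b\<ge>0. mono_on {0..} (\<lambda>a. \<Gamma> (a, b)))"

definition Gamma_norm ::
    "(real \<times> real \<Rightarrow> real) \<Rightarrow> (real \<Rightarrow> real \<Rightarrow> 'a::banach \<Rightarrow>\<^sub>L 'a) \<Rightarrow> (real \<Rightarrow> 'a \<Rightarrow>\<^sub>L 'a) \<Rightarrow>
     real \<Rightarrow> real \<Rightarrow> real \<Rightarrow> 'a \<Rightarrow> real" where
  "Gamma_norm \<Gamma> L Q \<gamma> \<rho> \<tau> x = \<Gamma> (N_norm L Q \<rho> \<tau> (Q \<tau> x), S_norm L \<gamma> \<tau> (x - Q \<tau> x))"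


section \<open>Nonlinear processes and invariant manifolds\<close>

definition evolution_process :: "(real \<Rightarrow> real \<Rightarrow> 'a::banach \<Rightarrow> 'a) \<Rightarrow> bool" where
  "evolution_process T \<longleftrightarrow>
     (\<forall>t x. T t t x = x) \<and>
     (\<forall>t s \<tau> x. \<tau> \<le> s \<longrightarrow> s \<le> t \<longrightarrow> T t s (T s \<tau> x) = T t \<tau> x) \<and>
     (\<forall>\<tau> \<eta>. continuous_on {\<tau>..} (\<lambda>t. T t \<tau> \<eta>))"

definition solution_on :: "(real \<Rightarrow> real \<Rightarrow> 'a::banach \<Rightarrow> 'a) \<Rightarrow> real set \<Rightarrow> (real \<Rightarrow> 'a) \<Rightarrow> bool" where
  "solution_on T I z \<longleftrightarrow> (\<forall>s\<in>I. \<forall>t\<in>I. s \<le> t \<longrightarrow> T t s (z s) = z t)"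

definition global_solution :: "(real \<Rightarrow> real \<Rightarrow> 'a::banach \<Rightarrow> 'a) \<Rightarrow> (real \<Rightarrow> 'a) \<Rightarrow> bool" where
  "global_solution T z \<longleftrightarrow> solution_on T UNIV z"

text \<open>The values are extended nonnegative reals, so that an unbounded \<open>A\<close> or an empty \<open>B\<close> gives no
  arbitrary value.\<close>

definition semidist :: "'a::real_normed_vector set \<Rightarrow> 'a set \<Rightarrow> ennreal" where
  "semidist A B = (SUP a\<in>A. INF b\<in>B. ennreal (norm (a - b)))"

definition exp_dominated ::
    "(real \<Rightarrow> real \<Rightarrow> 'a::banach \<Rightarrow> 'a) \<Rightarrow> (real \<Rightarrow> 'a set) \<Rightarrow> real \<Rightarrow> bool" where
  "exp_dominated T \<M> \<omega> \<longleftrightarrow>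
     (\<forall>U. bounded U \<longrightarrow>
        (\<exists>t0\<ge>0. \<exists>K>0. \<forall>t \<tau>. t0 \<le> t - \<tau> \<longrightarrow>
           semidist (T t \<tau> ` U) (\<M> t) \<le> ennreal (K * exp (- \<omega> * (t - \<tau>)))))"

text \<open>Graphs are taken with respect to the decomposition of the space given by a
  projection \<open>P\<close>.\<close>

definition lipschitz_graph :: "('a::banach \<Rightarrow>\<^sub>L 'a) \<Rightarrow> 'a set \<Rightarrow> bool" where
  "lipschitz_graph P A \<longleftrightarrow>
     (\<exists>g C. g ` range (blinfun_apply P) \<subseteq> range (blinfun_apply (id_blinfun - P)) \<and>
            C-lipschitz_on (range (blinfun_apply P)) g \<and>
            A = (\<lambda>x. x + g x) ` range (blinfun_apply P))"

definition invariant_manifold ::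
    "(real \<Rightarrow> 'a::banach \<Rightarrow>\<^sub>L 'a) \<Rightarrow> (real \<Rightarrow> real \<Rightarrow> 'a \<Rightarrow> 'a) \<Rightarrow> (real \<Rightarrow> 'a set) \<Rightarrow> bool" where
  "invariant_manifold Q T \<M> \<longleftrightarrow>
     (\<forall>t \<tau>. \<tau> \<le> t \<longrightarrow> T t \<tau> ` \<M> \<tau> = \<M> t) \<and>
     (\<exists>\<omega>. exp_dominated T \<M> \<omega>) \<and>
     (\<forall>t. lipschitz_graph (Q t) (\<M> t))"

definition inertial_manifold ::
    "(real \<Rightarrow> 'a::banach \<Rightarrow>\<^sub>L 'a) \<Rightarrow> (real \<Rightarrow> real \<Rightarrow> 'a \<Rightarrow> 'a) \<Rightarrow> (real \<Rightarrow> 'a set) \<Rightarrow> bool" where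
  "inertial_manifold Q T \<M> \<longleftrightarrow>
     invariant_manifold Q T \<M> \<and> (\<exists>\<omega>>0. exp_dominated T \<M> \<omega>)"


section \<open>The function whose graph is the manifold\<close>

text \<open>Functions on \<open>{..\<tau>}\<close> are represented by extensional functions, so that uniqueness
  in this space is literal equality.\<close>

definition E_space ::
    "(real \<times> real \<Rightarrow> real) \<Rightarrow> (real \<Rightarrow> real \<Rightarrow> 'a::banach \<Rightarrow>\<^sub>L 'a) \<Rightarrow> (real \<Rightarrow> 'a \<Rightarrow>\<^sub>L 'a) \<Rightarrow>
     real \<Rightarrow> real \<Rightarrow> real \<Rightarrow> real \<Rightarrow> (real \<Rightarrow> 'a) set" where
  "E_space \<Gamma> L Q \<gamma> \<rho> \<sigma> \<tau> =
     {z \<in> extensional {..\<tau>}. continuous_on {..\<tau>} z \<and>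
        bdd_above ((\<lambda>t. exp (\<sigma> * (t - \<tau>)) * Gamma_norm \<Gamma> L Q \<gamma> \<rho> t (z t)) ` {..\<tau>})}"

text \<open>The integrals are Henstock-Kurzweil integrals, as Bochner integration in the library
  needs a second countable target space. For continuous \<open>f\<close> with the Lipschitz conditions and
  \<open>f t 0 = 0\<close>, \<open>z\<close> in the above space and \<open>\<rho> < \<sigma> < \<gamma>\<close>, the integrands are continuous and the
  one on \<open>{..t}\<close> decays exponentially, so both integrals exist.\<close>

definition is_z ::
    "(real \<times> real \<Rightarrow> real) \<Rightarrow> (real \<Rightarrow> real \<Rightarrow> 'a::banach \<Rightarrow>\<^sub>L 'a) \<Rightarrow> (real \<Rightarrow> 'a \<Rightarrow>\<^sub>L 'a) \<Rightarrow>
     real \<Rightarrow> real \<Rightarrow> real \<Rightarrow> (real \<Rightarrow> 'a \<Rightarrow> 'a) \<Rightarrow> real \<Rightarrow> 'a \<Rightarrow> (real \<Rightarrow> 'a) \<Rightarrow> bool" where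
  "is_z \<Gamma> L Q \<gamma> \<rho> \<sigma> f \<tau> \<eta> z \<longleftrightarrow>
     z \<in> E_space \<Gamma> L Q \<gamma> \<rho> \<sigma> \<tau> \<and>
     (\<forall>t\<le>\<tau>. z t =
        Lext L Q t \<tau> (Q \<tau> \<eta>)
        - integral {t..\<tau>} (\<lambda>s. Lext L Q t s (Q s (f s (z s))))
        + integral {..t} (\<lambda>s. L t s (f s (z s) - Q s (f s (z s)))))"

definition z_fun ::
    "(real \<times> real \<Rightarrow> real) \<Rightarrow> (real \<Rightarrow> real \<Rightarrow> 'a::banach \<Rightarrow>\<^sub>L 'a) \<Rightarrow> (real \<Rightarrow> 'a \<Rightarrow>\<^sub>L 'a) \<Rightarrow>
     real \<Rightarrow> real \<Rightarrow> real \<Rightarrow> (real \<Rightarrow> 'a \<Rightarrow> 'a) \<Rightarrow> real \<Rightarrow> 'a \<Rightarrow> real \<Rightarrow> 'a" where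
  "z_fun \<Gamma> L Q \<gamma> \<rho> \<sigma> f \<tau> \<eta> = (THE z. is_z \<Gamma> L Q \<gamma> \<rho> \<sigma> f \<tau> \<eta> z)"

definition Sigma_fun ::
    "(real \<times> real \<Rightarrow> real) \<Rightarrow> (real \<Rightarrow> real \<Rightarrow> 'a::banach \<Rightarrow>\<^sub>L 'a) \<Rightarrow> (real \<Rightarrow> 'a \<Rightarrow>\<^sub>L 'a) \<Rightarrow>
     real \<Rightarrow> real \<Rightarrow> real \<Rightarrow> (real \<Rightarrow> 'a \<Rightarrow> 'a) \<Rightarrow> real \<Rightarrow> 'a \<Rightarrow> 'a" where
  "Sigma_fun \<Gamma> L Q \<gamma> \<rho> \<sigma> f \<tau> \<eta> =
     (id_blinfun - Q \<tau>) (z_fun \<Gamma> L Q \<gamma> \<rho> \<sigma> f \<tau> \<eta> \<tau>)"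

end

(* For the exponential splitting the two parts of L are U t s = L(t,s) Q(s), which is defined for all
   t and s, and V t s = L(t,s) (I - Q(s)) for t >= s. The manifold at time tau consists of the final
   values of the solutions of the Lyapunov-Perron equation on (-oo, tau]; this equation is a
   contraction, with constant the left side of the gap condition, in the norm with weight sigma.

   Write k for the slope kappa_Sigma and mu = rho + L1 Gamma(1, k). The equation for k says exactly
   that e^(-mu (t - tau)) and k e^(-mu (t - tau)) solve the pair of scalar integral equations
   that bound the two components of a difference of two solutions. Comparison with this pair gives
   the Lipschitz constant k and the backward growth rate mu at once. The number k exists and does not
   depend on sigma because its equation is convex in k and its two sides differ strictly at kappa.

   For the attraction, compare a solution on [tau, tau + h] with the solution on the manifold having
   the same Q-component at time tau + h. This shows that the distance to the manifold is multiplied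
   by at most 1 - omega h + o(h), uniformly in tau; iterate n times with h = (t - tau) / n. *)
theory Submission
  imports Defs
begin

subsection \<open>Integrals of Banach-valued functions\<close>

text \<open>The seminorms \<open>nU\<close> and \<open>nV\<close> are built so that the splitting
  estimates hold with constant 1 (\<open>nU_U\<close>, \<open>nV_V\<close>). Hence M enters neither
  k nor \<mu> nor \<omega>; it appears where the original norm comes in. Two rates occur side by
  side on the half-line: \<sigma>, at which the equation contracts with constant q, and the smaller
  \<mu>, which bounds the backward growth of a difference of solutions. Using \<sigma> alone would
  give a Lipschitz constant depending on \<sigma> and q, so the error at rate \<sigma> is carried as
  a separate term and iterated away. The attraction estimate has no constant in front of the
  exponential, whereas a comparison over one long interval would lose a factor. That comparison is
  two-sided: the stable component of the difference is controlled from the left endpoint, the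
  Q-component from the right one. On an interval of length h the coupling of the two is O(h), and
  the losses vanish as h tends to 0.\<close>

lemma norm_integral_le_primitive:
  fixes h :: "real \<Rightarrow> 'b::banach"
  assumes "a \<le> b" and h: "continuous_on {a..b} h"
    and \<phi>: "\<And>s. s \<in> {a..b} \<Longrightarrow> norm (h s) \<le> \<phi> s"
    and \<Psi>: "\<And>s. s \<in> {a..b} \<Longrightarrow> (\<Psi> has_real_derivative \<phi> s) (at s)"
  shows "norm (integral {a..b} h) \<le> \<Psi> b - \<Psi> a"
proof -
  have "(\<phi> has_integral (\<Psi> b - \<Psi> a)) {a..b}"
    using \<Psi> assms(1) by (intro fundamental_theorem_of_calculus)
      (auto simp: has_real_derivative_iff_has_vector_derivative[symmetric] intro: has_field_derivative_at_within)
  then show ?thesis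
    using integral_norm_bound_integral[OF integrable_continuous_real[OF h], of \<phi>] \<phi>
    by (metis has_integral_integrable integral_unique)
qed

lemma integral_split_real:
  fixes h :: "real \<Rightarrow> 'b::banach"
  assumes "continuous_on {a..b} h" "a \<le> c" "c \<le> b"
  shows "integral {a..b} h = integral {a..c} h + integral {c..b} h"
  using Henstock_Kurzweil_Integration.integral_combine[OF assms(2,3) integrable_continuous_real[OF assms(1)]] by simp

lemma bounded_linear_integral_Icc:
  fixes h :: "real \<Rightarrow> 'b::banach" and A :: "'b \<Rightarrow> 'c::banach"
  assumes "bounded_linear A" "continuous_on {a..b} h"
  shows "A (integral {a..b} h) = integral {a..b} (\<lambda>s. A (h s))"
  using integral_linear[OF integrable_continuous_real[OF assms(2)] assms(1)]
  by (simp add: o_def)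

section \<open>Improper integrals over a left half-line\<close>

lemma has_integral_atMostI:
  fixes h :: "real \<Rightarrow> 'b::banach"
  assumes h: "continuous_on {..b} h"
    and lim: "((\<lambda>a. integral {a..b} h) \<longlongrightarrow> I) at_bot"
  shows "(h has_integral I) {..b}"
proof (subst has_integral', intro allI impI)
  fix e :: real assume "e > 0"
  then obtain N where N: "\<And>a. a \<le> N \<Longrightarrow> dist (integral {a..b} h) I < e"
    using tendstoD[OF lim \<open>e > 0\<close>] by (auto simp: eventually_at_bot_linorder)
  show "\<exists>B>0. \<forall>a c. ball 0 B \<subseteq> cbox a c \<longrightarrow>
        (\<exists>z. ((\<lambda>x. if x \<in> {..b} then h x else 0) has_integral z) (cbox a c) \<and> norm (z - I) < e)"
  \<comment> \<open>A ball of this radius contains both N and b, so an interval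
    \<open>{a..c}\<close> around it satisfies a \<le> N and b \<le> c. The extended integrand
    vanishes above b, so only the integral over \<open>{a..b}\<close> is left.\<close>
  proof (intro exI[of _ "\<bar>N\<bar> + \<bar>b\<bar> + 1"] conjI allI impI)
    fix a c assume "ball (0::real) (\<bar>N\<bar> + \<bar>b\<bar> + 1) \<subseteq> cbox a c"
    moreover have "b \<in> ball 0 (\<bar>N\<bar> + \<bar>b\<bar> + 1)" "N \<in> ball 0 (\<bar>N\<bar> + \<bar>b\<bar> + 1)" by auto
    ultimately have "b \<in> cbox a c" "N \<in> cbox a c" by blast+
    then have ac: "a \<le> N" "a \<le> b" "b \<le> c" by auto
    have "(h has_integral integral {a..b} h) {a..b}"
      using continuous_on_subset[OF h, of "{a..b}"]
      by (intro integrable_integral integrable_continuous_real) auto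
    then have "((\<lambda>x. if x \<in> {a..b} then h x else 0) has_integral integral {a..b} h) {a..c}"
      using ac has_integral_restrict_closed_subinterval[of h _ a b a c] by simp
    then have "((\<lambda>x. if x \<in> {..b} then h x else 0) has_integral integral {a..b} h) {a..c}"
      by (rule has_integral_eq[rotated]) auto
    then show "\<exists>z. ((\<lambda>x. if x \<in> {..b} then h x else 0) has_integral z) (cbox a c) \<and> norm (z - I) < e"
      using N[OF ac(1)] by (auto simp: dist_norm)
  qed auto
qed

text \<open>The integral over \<open>{x..y}\<close> is at most C / c * exp (c y) in norm. So the
  integrals from b - n to b form a Cauchy sequence, and the same tail estimate turns its limit into
  the limit at -infinity.\<close>

lemma integral_atMost_limit:
  fixes h :: "real \<Rightarrow> 'b::banach"
  assumes h: "continuous_on {..b} h"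
    and bd: "\<And>s. s \<le> b \<Longrightarrow> norm (h s) \<le> C * exp (c * s)" and c: "c > 0"
  shows "((\<lambda>a. integral {a..b} h) \<longlongrightarrow> integral {..b} h) at_bot"
    and "h integrable_on {..b}"
proof -
  have hc: "continuous_on {x..y} h" if "y \<le> b" for x y
    using h by (rule continuous_on_subset) (use that in auto)
  have C: "C \<ge> 0"
    using order_trans[OF norm_ge_zero bd[of b]] by (simp add: zero_le_mult_iff)
  have diff: "norm (integral {x..b} h - integral {y..b} h) \<le> C / c * exp (c * y)" if "x \<le> y" "y \<le> b" for x y
  proof -
    have "integral {x..b} h - integral {y..b} h = integral {x..y} h"
      using integral_split_real[OF hc[of b] that] by simp
    also have "norm \<dots> \<le> C / c * exp (c * y) - C / c * exp (c * x)"
      using that c by (intro norm_integral_le_primitive[OF _ hc, where \<phi> = "\<lambda>s. C * exp (c * s)"] bd)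
        (auto intro!: derivative_eq_intros)
    also have "\<dots> \<le> C / c * exp (c * y)" using C c by simp
    finally show ?thesis .
  qed
  define X where "X n = integral {b - real n..b} h" for n
  have expl: "((\<lambda>y. C / c * exp (c * y)) \<longlongrightarrow> 0) at_bot"
    using c by (intro tendsto_mult_right_zero filterlim_compose[OF exp_at_bot]
        filterlim_tendsto_pos_mult_at_bot[OF tendsto_const]) (auto simp: filterlim_ident)
  have real_lim: "filterlim (\<lambda>n. b - real n) at_bot sequentially"
    unfolding filterlim_at_bot
  proof
    fix Z show "\<forall>\<^sub>F n in sequentially. b - real n \<le> Z"
      using eventually_ge_at_top[of "nat \<lceil>b - Z\<rceil>"] by eventually_elim linarith
  qed
  have "Cauchy X"
  proof (rule CauchyI)
    fix e :: real assume "e > 0"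
    then have "\<forall>\<^sub>F n in sequentially. C / c * exp (c * (b - real n)) < e"
      using filterlim_compose[OF expl real_lim] by (auto dest: order_tendstoD(2))
    then obtain n0 where n0: "\<And>n. n \<ge> n0 \<Longrightarrow> C / c * exp (c * (b - real n)) < e"
      by (auto simp: eventually_sequentially)
    have "norm (X m - X n) < e" if "m \<ge> n" "n \<ge> n0" for m n
      using diff[of "b - real m" "b - real n"] n0[of n] that unfolding X_def by simp
    then show "\<exists>M. \<forall>m\<ge>M. \<forall>n\<ge>M. norm (X m - X n) < e"
      by (metis norm_minus_commute nle_le)
  qed
  then obtain I where I: "X \<longlonglongrightarrow> I" by (auto simp: Cauchy_convergent_iff convergent_def)
  have bnd: "norm (integral {y..b} h - I) \<le> C / c * exp (c * y)" if "y \<le> b" for y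
  proof (rule Lim_norm_ubound[of sequentially "\<lambda>n. integral {y..b} h - X n"])
    have "\<forall>\<^sub>F n in sequentially. b - real n \<le> y"
      using real_lim by (auto simp: filterlim_at_bot)
    then show "\<forall>\<^sub>F n in sequentially. norm (integral {y..b} h - X n) \<le> C / c * exp (c * y)"
      by eventually_elim (metis X_def diff norm_minus_commute that)
  qed (auto intro!: tendsto_intros I)
  have lim: "((\<lambda>a. integral {a..b} h) \<longlongrightarrow> I) at_bot"
    by (rule LIM_zero_cancel, rule tendsto_0_le[OF expl, where K = 1])
      (use bnd C c in \<open>auto simp: eventually_at_bot_linorder abs_mult intro!: exI[of _ b]\<close>)
  from has_integral_atMostI[OF h this] have "(h has_integral I) {..b}" .
  with lim show "((\<lambda>a. integral {a..b} h) \<longlongrightarrow> integral {..b} h) at_bot" "h integrable_on {..b}"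
    by (auto simp: integral_unique)
qed

text \<open>Nonnegativity of \<Psi> takes the place of its limit at -infinity, since \<Psi> b -
  \<Psi> a \<le> \<Psi> b for every a. The exponential bound secures convergence.\<close>

lemma norm_integral_atMost_le_primitive:
  fixes h :: "real \<Rightarrow> 'b::banach"
  assumes h: "continuous_on {..b} h"
    and bd: "\<And>s. s \<le> b \<Longrightarrow> norm (h s) \<le> C * exp (c * s)" and c: "c > 0"
    and \<phi>: "\<And>s. s \<le> b \<Longrightarrow> norm (h s) \<le> \<phi> s"
    and \<Psi>: "\<And>s. s \<le> b \<Longrightarrow> (\<Psi> has_real_derivative \<phi> s) (at s)"
    and pos: "\<And>s. s \<le> b \<Longrightarrow> 0 \<le> \<Psi> s"
  shows "norm (integral {..b} h) \<le> \<Psi> b"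
proof (rule Lim_norm_ubound[OF _ integral_atMost_limit(1)[OF h bd c]])
  have "norm (integral {a..b} h) \<le> \<Psi> b" if "a \<le> b" for a
    using norm_integral_le_primitive[OF that, of h \<phi> \<Psi>] continuous_on_subset[OF h, of "{a..b}"]
      \<phi> \<Psi> pos[OF that] by fastforce
  then show "\<forall>\<^sub>F a in at_bot. norm (integral {a..b} h) \<le> \<Psi> b"
    by (auto simp: eventually_at_bot_linorder)
qed auto

lemma integral_atMost_split:
  fixes h :: "real \<Rightarrow> 'b::banach"
  assumes h: "continuous_on {..b} h"
    and bd: "\<And>s. s \<le> b \<Longrightarrow> norm (h s) \<le> C * exp (c * s)" and c: "c > 0" and "a \<le> b"
  shows "integral {..b} h = integral {..a} h + integral {a..b} h"
proof -
  have "((\<lambda>x. integral {x..a} h + integral {a..b} h) \<longlongrightarrow> integral {..a} h + integral {a..b} h) at_bot"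
    by (intro tendsto_add tendsto_const integral_atMost_limit[of _ _ C c])
      (use assms in \<open>auto intro: continuous_on_subset\<close>)
  moreover have "\<forall>\<^sub>F x in at_bot. integral {x..a} h + integral {a..b} h = integral {x..b} h"
    unfolding eventually_at_bot_linorder
    by (intro exI[of _ a] allI impI integral_split_real[symmetric] continuous_on_subset[OF h])
      (use assms in auto)
  ultimately have "((\<lambda>x. integral {x..b} h) \<longlongrightarrow> integral {..a} h + integral {a..b} h) at_bot"
    using tendsto_cong by fastforce
  then show ?thesis
    using tendsto_unique[OF _ integral_atMost_limit(1)[OF h bd c]] by fastforce
qed

lemma integral_atMost_bounded_linear:
  fixes h :: "real \<Rightarrow> 'b::banach" and A :: "'b \<Rightarrow> 'c::banach"
  assumes "bounded_linear A" "h integrable_on {..b}"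
  shows "A (integral {..b} h) = integral {..b} (\<lambda>s. A (h s))"
  using integral_linear[OF assms(2,1)] by (simp add: o_def)

text \<open>Write A q (h q) = A q (h q - h p) + A q (h p): the uniform bound controls the first
  term, strong continuity the second. This is why local bounds on the kernels precede their joint
  continuity.\<close>

lemma continuous_on_bounded_operators:
  fixes A :: "'t::metric_space \<Rightarrow> 'b::real_normed_vector \<Rightarrow> 'c::real_normed_vector"
  assumes lin: "\<And>p x y. p \<in> S \<Longrightarrow> A p (x - y) = A p x - A p y"
    and bd: "\<And>p x. p \<in> S \<Longrightarrow> norm (A p x) \<le> B * norm x"
    and A: "\<And>x. continuous_on S (\<lambda>p. A p x)" and h: "continuous_on S h"
  shows "continuous_on S (\<lambda>p. A p (h p))"
  unfolding continuous_on_def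
proof
  fix p assume p: "p \<in> S"
  have "((\<lambda>q. A q (h q - h p)) \<longlongrightarrow> 0) (at p within S)"
  proof (rule tendsto_0_le[where K = B])
    show "((\<lambda>q. h q - h p) \<longlongrightarrow> 0) (at p within S)"
      using h p by (intro LIM_zero) (auto simp: continuous_on_def)
    show "\<forall>\<^sub>F q in at p within S. norm (A q (h q - h p)) \<le> norm (h q - h p) * B"
      by (auto simp: eventually_at_filter mult.commute intro!: always_eventually bd)
  qed
  moreover have "((\<lambda>q. A q (h p)) \<longlongrightarrow> A p (h p)) (at p within S)"
    using A p by (auto simp: continuous_on_def)
  ultimately have "((\<lambda>q. A q (h q - h p) + A q (h p)) \<longlongrightarrow> 0 + A p (h p)) (at p within S)"
    by (rule tendsto_add)
  then show "((\<lambda>q. A q (h q)) \<longlongrightarrow> A p (h p)) (at p within S)"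
    by (rule Lim_transform_eventually[THEN tendsto_eq_rhs])
      (use lin in \<open>auto simp: eventually_at_filter\<close>)
qed

text \<open>Extending the kernel by its diagonal values above the diagonal gives a kernel \<open>K'\<close> on the square,
  and the integral up to \<open>t\<close> is the difference of an integral of \<open>K'\<close> over a fixed interval and an
  integral of the diagonal.\<close>

lemma continuous_on_Volterra_integral:
  fixes K :: "real \<Rightarrow> real \<Rightarrow> 'b::banach"
  assumes K: "continuous_on {(t, s). a \<le> s \<and> s \<le> t \<and> t \<le> b} (\<lambda>(t, s). K t s)"
  shows "continuous_on {a..b} (\<lambda>t. integral {a..t} (K t))"
proof -
  define K' where "K' t s = K (max t s) s" for t s
  have K'c: "continuous_on ({a..b} \<times> cbox a b) (\<lambda>(t, s). K' t s)"
  proof -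
    have "continuous_on ({a..b} \<times> {a..b}) (\<lambda>p. (max (fst p) (snd p), snd p))"
      by (intro continuous_intros)
    then have "continuous_on ({a..b} \<times> {a..b}) (\<lambda>p. case (max (fst p) (snd p), snd p) of (t, s) \<Rightarrow> K t s)"
      by (rule continuous_on_compose2[OF K]) auto
    then show ?thesis by (simp add: K'_def case_prod_unfold)
  qed
  have sec: "continuous_on {a..b} (K' t)" if "t \<in> {a..b}" for t
    using continuous_on_compose2[OF K'c, of "{a..b}" "\<lambda>s. (t, s)"] that
    by (force intro: continuous_intros)
  have diag: "continuous_on {a..b} (\<lambda>s. K s s)"
    using continuous_on_compose2[OF K'c, of "{a..b}" "\<lambda>s. (s, s)"]
    by (force intro: continuous_intros simp: K'_def)
  have eq: "integral {a..t} (K t) = integral {a..b} (K' t) - (integral {a..b} (\<lambda>s. K s s) - integral {a..t} (\<lambda>s. K s s))"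
    if t: "t \<in> {a..b}" for t
  proof -
    have "integral {a..t} (K t) = integral {a..t} (K' t)" "integral {t..b} (\<lambda>s. K s s) = integral {t..b} (K' t)"
      by (auto intro!: integral_cong simp: K'_def)
    then show ?thesis
      using integral_split_real[OF sec[OF t], of t] integral_split_real[OF diag, of t] t by simp
  qed
  have "continuous_on {a..b} (\<lambda>t. integral {a..b} (K' t) - (integral {a..b} (\<lambda>s. K s s) - integral {a..t} (\<lambda>s. K s s)))"
    using integral_continuous_on_param[OF K'c] diag
    by (intro continuous_intros indefinite_integral_continuous_1 integrable_continuous_real) auto
  then show ?thesis
    by (rule continuous_on_eq) (rule eq[symmetric])
qed

text \<open>The tails of the telescoping series are geometric. The explicit rate matters: applied
  for each t separately, it still yields convergence that is uniform on compact intervals.\<close>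

lemma geometric_limit:
  fixes z :: "nat \<Rightarrow> 'b::banach"
  assumes q: "0 \<le> q" "q < 1" and z: "\<And>n. norm (z (Suc n) - z n) \<le> C * q ^ n"
  obtains l where "\<And>n. norm (l - z n) \<le> C / (1 - q) * q ^ n"
proof -
  have s: "summable (\<lambda>n. z (Suc (n + m)) - z (n + m))" and sb: "norm (\<Sum>n. z (Suc (n + m)) - z (n + m)) \<le> C / (1 - q) * q ^ m" for m
  proof -
    have g: "(\<lambda>n. C * q ^ m * q ^ n) sums (C * q ^ m * (1 / (1 - q)))"
      using q by (intro sums_mult geometric_sums) auto
    have b: "norm (z (Suc (n + m)) - z (n + m)) \<le> C * q ^ m * q ^ n" for n
      using z[of "n + m"] by (simp add: power_add mult_ac)
    show "summable (\<lambda>n. z (Suc (n + m)) - z (n + m))"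
      by (rule summable_comparison_test'[OF sums_summable[OF g]]) (use b in auto)
    show "norm (\<Sum>n. z (Suc (n + m)) - z (n + m)) \<le> C / (1 - q) * q ^ m"
      using norm_suminf_le[OF b sums_summable[OF g]] sums_unique[OF g] by simp
  qed
  have c: "convergent z"
    using s[of 0] by (simp add: summable_iff_convergent sum_lessThan_telescope convergent_diff_const_right_iff)
  then obtain l where l: "z \<longlonglongrightarrow> l" by (auto simp: convergent_def)
  have "(\<Sum>n. z (Suc (n + m)) - z (n + m)) = l - z m" for m
    using telescope_sums[of "\<lambda>n. z (n + m)" l] l
    by (simp add: LIMSEQ_ignore_initial_segment sums_iff)
  then show thesis using that sb by metis
qed

subsection \<open>Admissible norms and the constant of the manifold\<close>

locale admissible =
  fixes \<Gamma> :: "real \<times> real \<Rightarrow> real"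
  assumes adm: "admissible_norm \<Gamma>"
begin

lemma Gamma_nonneg: "0 \<le> \<Gamma> p"
  and Gamma_eq_0: "\<Gamma> p = 0 \<longleftrightarrow> p = 0"
  and Gamma_scale: "\<Gamma> (c *\<^sub>R p) = \<bar>c\<bar> * \<Gamma> p"
  and Gamma_add: "\<Gamma> (p + q) \<le> \<Gamma> p + \<Gamma> q"
proof -
  have "is_norm \<Gamma>" using adm by (simp add: admissible_norm_def)
  then show "0 \<le> \<Gamma> p" "\<Gamma> p = 0 \<longleftrightarrow> p = 0" "\<Gamma> (c *\<^sub>R p) = \<bar>c\<bar> * \<Gamma> p" "\<Gamma> (p + q) \<le> \<Gamma> p + \<Gamma> q"
    unfolding is_norm_def by metis+
qed

lemma Gamma_mult: "0 \<le> c \<Longrightarrow> \<Gamma> (c * a, c * b) = c * \<Gamma> (a, b)"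
  using Gamma_scale[of c "(a, b)"] by simp

lemma Gamma_mono:
  assumes "0 \<le> a" "a \<le> a'" "0 \<le> b" "b \<le> b'"
  shows "\<Gamma> (a, b) \<le> \<Gamma> (a', b')"
proof -
  have "mono_on {0..} (\<lambda>b. \<Gamma> (a, b))" "mono_on {0..} (\<lambda>a. \<Gamma> (a, b'))"
    using adm assms unfolding admissible_norm_def by auto
  then have "\<Gamma> (a, b) \<le> \<Gamma> (a, b')" "\<Gamma> (a, b') \<le> \<Gamma> (a', b')"
    using assms by (auto elim!: mono_onD)
  then show ?thesis by simp
qed

lemma Gamma_pos: "a \<noteq> 0 \<or> b \<noteq> 0 \<Longrightarrow> 0 < \<Gamma> (a, b)"
  using Gamma_nonneg[of "(a, b)"] Gamma_eq_0[of "(a, b)"] by (auto simp: zero_prod_def order.strict_iff_order)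

lemma Gamma_add_pair: "\<Gamma> (a + a', b + b') \<le> \<Gamma> (a, b) + \<Gamma> (a', b')"
  using Gamma_add[of "(a, b)" "(a', b')"] by simp

lemma Gamma_fst: "0 \<le> a \<Longrightarrow> \<Gamma> (a, 0) = a * \<Gamma> (1, 0)"
  and Gamma_snd: "0 \<le> b \<Longrightarrow> \<Gamma> (0, b) = b * \<Gamma> (0, 1)"
  using Gamma_mult[of a 1 0] Gamma_mult[of b 0 1] by simp_all

lemma Gamma_le_axes: "0 \<le> a \<Longrightarrow> 0 \<le> b \<Longrightarrow> \<Gamma> (a, b) \<le> a * \<Gamma> (1, 0) + b * \<Gamma> (0, 1)"
  using Gamma_add_pair[of a 0 0 b] Gamma_fst[of a] Gamma_snd[of b] by simp

lemma le_Gamma_fst: "0 \<le> a \<Longrightarrow> 0 \<le> b \<Longrightarrow> a * \<Gamma> (1, 0) \<le> \<Gamma> (a, b)"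
  and le_Gamma_snd: "0 \<le> a \<Longrightarrow> 0 \<le> b \<Longrightarrow> b * \<Gamma> (0, 1) \<le> \<Gamma> (a, b)"
  using Gamma_mono[of a a 0 b] Gamma_mono[of 0 a b b] Gamma_fst[of a] Gamma_snd[of b] by simp_all

lemma Gamma_convex:
  assumes "0 \<le> u" "u \<le> 1"
  shows "\<Gamma> ((1 - u) * a + u * a', (1 - u) * b + u * b') \<le> (1 - u) * \<Gamma> (a, b) + u * \<Gamma> (a', b')"
  using Gamma_add_pair[of "(1 - u) * a" "u * a'" "(1 - u) * b" "u * b'"] assms
  by (simp add: Gamma_mult)

section \<open>The equation for the slope\<close>

lemma continuous_on_Gamma_snd: "continuous_on S (\<lambda>k. \<Gamma> (1, k))"
proof -
  have 1: "\<Gamma> (1, x) - \<Gamma> (1, y) \<le> \<Gamma> (0, 1) * \<bar>x - y\<bar>" for x y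
    using Gamma_add_pair[of 1 0 y "x - y"] Gamma_scale[of "x - y" "(0, 1)"] by (simp add: mult.commute)
  have "(\<Gamma> (0, 1))-lipschitz_on S (\<lambda>k. \<Gamma> (1, k))"
  proof (rule lipschitz_onI)
    show "dist (\<Gamma> (1, x)) (\<Gamma> (1, y)) \<le> \<Gamma> (0, 1) * dist x y" for x y
      using 1[of x y] 1[of y x] by (auto simp: dist_real_def abs_le_iff abs_minus_commute)
  qed (rule Gamma_nonneg)
  then show ?thesis by (rule lipschitz_on_continuous_on)
qed

text \<open>A convex function that falls strictly from k2 to k3 also falls strictly from k1 to k2.
  With k3 the upper bound for the slope and k2 a root, this excludes a second root k1 to the left of
  k2.\<close>

lemma slope_equation_convex:
  assumes "0 \<le> L1" "0 \<le> L2" "0 < k1" "k1 < k2" "k2 < k3"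
    and "H = (\<lambda>k. L1 * \<Gamma> (1, k) + L2 * \<Gamma> (1 / k, 1))" and "H k3 < H k2"
  shows "H k2 < H k1"
proof -
  define u where "u = (k2 - k1) / (k3 - k1)"
  have u: "0 < u" "u < 1" and k2: "k2 = (1 - u) * k1 + u * k3"
  proof -
    have "u * (k3 - k1) = k2 - k1" using assms by (simp add: u_def)
    then show "k2 = (1 - u) * k1 + u * k3" by (simp add: algebra_simps)
  qed (use assms in \<open>auto simp: u_def\<close>)
  \<comment> \<open>Convexity of the second term: 1 / k is convex, and \<Gamma> is convex and
    non-decreasing in its first argument.\<close>
  have "1 / k2 \<le> (1 - u) * (1 / k1) + u * (1 / k3)"
    using convex_onD[OF convex_on_inverse[of "{0<..}"], of u k1 k3] u assms
    by (simp add: k2[symmetric] inverse_eq_divide)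
  then have "\<Gamma> (1 / k2, 1) \<le> \<Gamma> ((1 - u) * (1 / k1) + u * (1 / k3), (1 - u) * 1 + u * 1)"
    using assms by (intro Gamma_mono) auto
  also have "\<dots> \<le> (1 - u) * \<Gamma> (1 / k1, 1) + u * \<Gamma> (1 / k3, 1)"
    using u by (intro Gamma_convex) auto
  finally have 1: "L2 * \<Gamma> (1 / k2, 1) \<le> L2 * ((1 - u) * \<Gamma> (1 / k1, 1) + u * \<Gamma> (1 / k3, 1))"
    using assms by (intro mult_left_mono) auto
  have "\<Gamma> (1, k2) \<le> (1 - u) * \<Gamma> (1, k1) + u * \<Gamma> (1, k3)"
    using Gamma_convex[of u 1 1 k1 k3] u by (simp add: k2)
  then have "L1 * \<Gamma> (1, k2) \<le> L1 * ((1 - u) * \<Gamma> (1, k1) + u * \<Gamma> (1, k3))"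
    using assms by (intro mult_left_mono) auto
  with 1 have "H k2 \<le> (1 - u) * H k1 + u * H k3"
    by (simp add: assms(6) algebra_simps)
  also have "\<dots> < (1 - u) * H k1 + u * H k2" using u assms by simp
  finally have "(1 - u) * H k2 < (1 - u) * H k1" by (simp add: algebra_simps)
  then show ?thesis using u by simp
qed

text \<open>By the choice of \<kappa> the pair in the gap condition is a multiple of (1, \<kappa>)
  and also of (1 / \<kappa>, 1). Homogeneity therefore turns the one condition into one inequality
  against s - \<rho> and one against \<gamma> - s, and s cancels in their sum.\<close>

lemma gap_at_slope:
  assumes "0 < L1" "0 < L2" "s \<in> {\<rho><..<\<gamma>}" and gap: "\<Gamma> (L1 / (s - \<rho>), L2 / (\<gamma> - s)) < 1"
    and \<kappa>: "\<kappa> = L2 / L1 * ((s - \<rho>) / (\<gamma> - s))"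
  shows "0 < \<kappa>" and "L1 * \<Gamma> (1, \<kappa>) < s - \<rho>"
    and "L1 * \<Gamma> (1, \<kappa>) + L2 * \<Gamma> (1 / \<kappa>, 1) < \<gamma> - \<rho>"
proof -
  show pos: "0 < \<kappa>" using assms by simp
  have "\<Gamma> (L1 / (s - \<rho>), L2 / (\<gamma> - s)) = L1 / (s - \<rho>) * \<Gamma> (1, \<kappa>)"
  proof -
    have "L1 / (s - \<rho>) * \<kappa> = L2 / (\<gamma> - s)" using assms by (simp add: \<kappa>)
    then show ?thesis using Gamma_mult[of "L1 / (s - \<rho>)" 1 \<kappa>] assms by simp
  qed
  then have "L1 / (s - \<rho>) * \<Gamma> (1, \<kappa>) < 1" using gap by simp
  then show 1: "L1 * \<Gamma> (1, \<kappa>) < s - \<rho>" using assms(3) by (simp add: pos_divide_less_eq)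
  have "\<Gamma> (L1 / (s - \<rho>), L2 / (\<gamma> - s)) = L2 / (\<gamma> - s) * \<Gamma> (1 / \<kappa>, 1)"
  proof -
    have "L2 / (\<gamma> - s) * (1 / \<kappa>) = L1 / (s - \<rho>)" using assms by (simp add: \<kappa>)
    then show ?thesis using Gamma_mult[of "L2 / (\<gamma> - s)" "1 / \<kappa>" 1] assms by simp
  qed
  then have "L2 / (\<gamma> - s) * \<Gamma> (1 / \<kappa>, 1) < 1" using gap by simp
  then have "L2 * \<Gamma> (1 / \<kappa>, 1) < \<gamma> - s" using assms(3) by (simp add: pos_divide_less_eq)
  with 1 show "L1 * \<Gamma> (1, \<kappa>) + L2 * \<Gamma> (1 / \<kappa>, 1) < \<gamma> - \<rho>" by simp
qed

text \<open>Intermediate value theorem: near 0 the term with 1 / k exceeds \<gamma> - \<rho>, while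
  at \<kappa> the gap condition puts the right side strictly below it. Strictness keeps the root
  away from \<kappa>.\<close>

lemma slope_exists:
  assumes L: "0 < L1" "0 < L2" and s: "s \<in> {\<rho><..<\<gamma>}"
    and gap: "\<Gamma> (L1 / (s - \<rho>), L2 / (\<gamma> - s)) < 1"
  obtains k where "0 < k" "k < L2 / L1 * ((s - \<rho>) / (\<gamma> - s))"
    "\<gamma> - \<rho> = L1 * \<Gamma> (1, k) + L2 * \<Gamma> (1 / k, 1)"
proof -
  define \<kappa> where "\<kappa> = L2 / L1 * ((s - \<rho>) / (\<gamma> - s))"
  note at_\<kappa> = gap_at_slope[OF assms \<kappa>_def]
  \<comment> \<open>By homogeneity \<Gamma> (1 / k, 1) is \<Gamma> (1, k) / k; in this form
    continuity of the single section \<open>\<lambda>k. \<Gamma> (1, k)\<close> suffices.\<close>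
  define H where "H k = L1 * \<Gamma> (1, k) + L2 * (\<Gamma> (1, k) / k)" for k
  have H: "H k = L1 * \<Gamma> (1, k) + L2 * \<Gamma> (1 / k, 1)" if "k > 0" for k
    using Gamma_mult[of "1 / k" 1 k] that by (simp add: H_def)
  \<comment> \<open>The second entry solves L2 \<Gamma> (1, 0) / k = \<gamma> - \<rho>, and \<Gamma>
    (1, 0) is a lower bound for \<Gamma> (1, k). The first entry keeps the point below
    \<kappa>.\<close>
  define k0 where "k0 = min (\<kappa> / 2) (L2 * \<Gamma> (1, 0) / (\<gamma> - \<rho>))"
  have k0: "0 < k0" "k0 < \<kappa>" using at_\<kappa>(1) L s Gamma_pos[of 1 0] by (auto simp: k0_def)
  have "k0 \<le> L2 * \<Gamma> (1, 0) / (\<gamma> - \<rho>)" by (simp add: k0_def)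
  then have "k0 * (\<gamma> - \<rho>) \<le> L2 * \<Gamma> (1, 0)"
    using s by (simp add: pos_le_divide_eq)
  also have "\<dots> \<le> L2 * \<Gamma> (1, k0)" using L k0 by (intro mult_left_mono Gamma_mono) auto
  finally have "\<gamma> - \<rho> \<le> L2 * (\<Gamma> (1, k0) / k0)" using k0 by (simp add: field_simps)
  also have "\<dots> \<le> H k0" using L k0 by (simp add: H_def Gamma_nonneg)
  finally have "\<gamma> - \<rho> \<le> H k0" .
  moreover have "H \<kappa> \<le> \<gamma> - \<rho>" using H[OF at_\<kappa>(1)] at_\<kappa>(3) by simp
  moreover have "continuous_on {k0..\<kappa>} H"
    unfolding H_def using k0 by (intro continuous_intros continuous_on_Gamma_snd) auto
  ultimately obtain k where k: "k0 \<le> k" "k \<le> \<kappa>" "H k = \<gamma> - \<rho>"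
    using IVT2'[of H \<kappa> "\<gamma> - \<rho>" k0] k0 by auto
  with H[OF at_\<kappa>(1)] at_\<kappa>(3) have "k \<noteq> \<kappa>" by auto
  then show thesis using k k0 H[of k] that[of k] unfolding \<kappa>_def by linarith
qed

text \<open>The two roots may belong to different exponents s and s'. Convexity is applied with the
  upper bound that belongs to the larger root.\<close>

lemma slope_unique:
  assumes L: "0 < L1" "0 < L2"
    and s: "s \<in> {\<rho><..<\<gamma>}" "\<Gamma> (L1 / (s - \<rho>), L2 / (\<gamma> - s)) < 1"
    and s': "s' \<in> {\<rho><..<\<gamma>}" "\<Gamma> (L1 / (s' - \<rho>), L2 / (\<gamma> - s')) < 1"
    and k: "0 < k" "k < L2 / L1 * ((s - \<rho>) / (\<gamma> - s))" "\<gamma> - \<rho> = L1 * \<Gamma> (1, k) + L2 * \<Gamma> (1 / k, 1)"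
    and k': "0 < k'" "k' < L2 / L1 * ((s' - \<rho>) / (\<gamma> - s'))" "\<gamma> - \<rho> = L1 * \<Gamma> (1, k') + L2 * \<Gamma> (1 / k', 1)"
  shows "k = k'"
proof (rule ccontr)
  assume "k \<noteq> k'"
  then consider "k < k'" | "k' < k" by linarith
  then show False
    using slope_equation_convex[OF _ _ k(1) _ k'(2) refl, of L1 L2] gap_at_slope(3)[OF L s' refl]
      slope_equation_convex[OF _ _ k'(1) _ k(2) refl, of L1 L2] gap_at_slope(3)[OF L s refl]
      k(3) k'(3) L by cases auto
qed

text \<open>Otherwise \<Gamma> (1 / k, 1) \<le> \<Gamma> (0, 1) \<le> \<Gamma> (1 / \<kappa>, 1),
  and the right side of the slope equation at k would not exceed its value at \<kappa>, which is
  below \<gamma> - \<rho>. This strictness is exactly \<rho> < \<omega>.\<close>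

lemma Gamma_slope_strict:
  assumes L: "0 < L1" "0 < L2" and s: "s \<in> {\<rho><..<\<gamma>}"
    and gap: "\<Gamma> (L1 / (s - \<rho>), L2 / (\<gamma> - s)) < 1"
    and k: "0 < k" "k < L2 / L1 * ((s - \<rho>) / (\<gamma> - s))" "\<gamma> - \<rho> = L1 * \<Gamma> (1, k) + L2 * \<Gamma> (1 / k, 1)"
  shows "\<Gamma> (0, k) < \<Gamma> (1, k)"
proof (rule ccontr)
  define \<kappa> where "\<kappa> = L2 / L1 * ((s - \<rho>) / (\<gamma> - s))"
  note at_\<kappa> = gap_at_slope[OF L s gap \<kappa>_def]
  assume "\<not> \<Gamma> (0, k) < \<Gamma> (1, k)"
  then have "\<Gamma> (1, k) \<le> k * \<Gamma> (0, 1)" using Gamma_snd[of k] k by simp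
  then have "\<Gamma> (1 / k, 1) \<le> \<Gamma> (0, 1)"
    using Gamma_mult[of "1 / k" 1 k] k(1) by (simp add: pos_divide_le_eq mult.commute)
  also have "\<dots> \<le> \<Gamma> (1 / \<kappa>, 1)" using at_\<kappa> by (intro Gamma_mono) auto
  finally have "L2 * \<Gamma> (1 / k, 1) \<le> L2 * \<Gamma> (1 / \<kappa>, 1)" using L by simp
  moreover have "L1 * \<Gamma> (1, k) \<le> L1 * \<Gamma> (1, \<kappa>)"
    using L k by (intro mult_left_mono Gamma_mono) (auto simp: \<kappa>_def)
  ultimately show False using at_\<kappa>(3) k(3) by simp
qed

end

subsection \<open>The two parts of a process with exponential splitting\<close>

text \<open>Needed for the backward operators: the splitting bounds their \<open>onorm\<close>,
  which controls values once the operator is known to be bounded. That comes from continuity of the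
  inverse in the homeomorphism.\<close>

lemma bounded_linear_if_continuous_0:
  fixes F :: "'b::real_normed_vector \<Rightarrow> 'c::real_normed_vector"
  assumes F: "linear F" and cont: "continuous (at 0) F"
  shows "bounded_linear F"
proof -
  have F0: "F 0 = 0" by (rule linear_0[OF F])
  obtain d where d: "d > 0" "\<And>x. norm x < d \<Longrightarrow> norm (F x) < 1"
    using cont unfolding continuous_at_eps_delta by (auto simp: F0 dest!: spec[of _ 1])
  have "norm (F x) \<le> norm x * (2 / d)" for x :: 'b
  proof (cases "x = 0")
    case False
    define c where "c = d / (2 * norm x)"
    have c: "c > 0" using False d by (simp add: c_def)
    have "norm (c *\<^sub>R x) < d" using False d by (simp add: c_def)
    from d(2)[OF this] have "c * norm (F x) < 1" using c by (simp add: linear_scale[OF F])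
    then show ?thesis using c d False by (simp add: c_def field_simps)
  qed (simp add: F0)
  then show ?thesis
    using F unfolding bounded_linear_def bounded_linear_axioms_def by blast
qed

lemma continuous_on_UNIV_if_atLeast:
  fixes F :: "real \<Rightarrow> 'b::topological_space"
  assumes "\<And>a. continuous_on {a..} F"
  shows "continuous_on UNIV F"
  unfolding continuous_on_eq_continuous_at[OF open_UNIV]
  using continuous_on_interior[OF assms] by (metis interior_real_atLeast greaterThan_iff UNIV_I lt_ex)

lemma continuous_on_UNIV_if_atMost:
  fixes F :: "real \<Rightarrow> 'b::topological_space"
  assumes "\<And>b. continuous_on {..b} F"
  shows "continuous_on UNIV F"
  unfolding continuous_on_eq_continuous_at[OF open_UNIV]
  using continuous_on_interior[OF assms] by (metis interior_real_atMost lessThan_iff UNIV_I gt_ex)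

lemma continuous_on_atMost_if_Icc:
  fixes F :: "real \<Rightarrow> 'b::topological_space"
  assumes "\<And>a. continuous_on {a..b} F"
  shows "continuous_on {..b} F"
  unfolding continuous_on_def
proof
  fix x assume x: "x \<in> {..b}"
  have "(F \<longlongrightarrow> F x) (at x within {x - 1..b})"
    using assms[of "x - 1"] x by (auto simp: continuous_on_def)
  moreover have "at x within {x - 1..b} = at x within {..b}"
    by (rule at_within_nhd[of _ "{x - 1<..}"]) auto
  ultimately show "(F \<longlongrightarrow> F x) (at x within {..b})" by simp
qed

locale exp_split =
  fixes L :: "real \<Rightarrow> real \<Rightarrow> 'a::banach \<Rightarrow>\<^sub>L 'a" and Q :: "real \<Rightarrow> 'a \<Rightarrow>\<^sub>L 'a" and M \<gamma> \<rho> :: real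
  assumes lin: "linear_process L" and split: "exponential_splitting L Q M \<gamma> \<rho>"
begin

text \<open>Applying \<open>Q s\<close> first keeps \<open>inv_into\<close> on the image that it
  inverts, so this is an operator on the whole space.\<close>

definition U :: "real \<Rightarrow> real \<Rightarrow> 'a \<Rightarrow> 'a" where "U t s x = Lext L Q t s (Q s x)"
definition V :: "real \<Rightarrow> real \<Rightarrow> 'a \<Rightarrow> 'a" where "V t s x = L t s (x - Q s x)"
text \<open>Composed with the projections, the norms of the two subspaces become seminorms on the
  whole space, each vanishing on the other subspace. Membership conditions disappear from the
  estimates.\<close>

definition nU :: "real \<Rightarrow> 'a \<Rightarrow> real" where "nU t x = N_norm L Q \<rho> t (Q t x)"
definition nV :: "real \<Rightarrow> 'a \<Rightarrow> real" where "nV t x = S_norm L \<gamma> t (x - Q t x)"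

lemma M_ge_1: "1 \<le> M" and rho_less_gamma: "\<rho> < \<gamma>"
  using split unfolding exponential_splitting_def by blast+

lemma L_comp: "\<tau> \<le> s \<Longrightarrow> s \<le> t \<Longrightarrow> L t s (L s \<tau> x) = L t \<tau> x"
  using lin unfolding linear_process_def by (metis blinfun_compose.rep_eq comp_apply)

lemma L_refl: "L t t x = x"
  using lin unfolding linear_process_def by simp

lemma L_continuous: "continuous_on {(t, \<tau>). \<tau> \<le> t} (\<lambda>(t, \<tau>). L t \<tau> x)"
  using lin unfolding linear_process_def by blast

lemma Q_idem: "Q t (Q t x) = Q t x"
proof -
  have "Q t o\<^sub>L Q t = Q t" using split unfolding exponential_splitting_def by blast
  then show ?thesis by (metis blinfun_compose.rep_eq comp_apply)
qed

lemma Q_L: assumes "\<tau> \<le> t" shows "Q t (L t \<tau> x) = L t \<tau> (Q \<tau> x)"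
proof -
  have "Q t o\<^sub>L L t \<tau> = L t \<tau> o\<^sub>L Q \<tau>" using split assms unfolding exponential_splitting_def by blast
  then show ?thesis by (metis blinfun_compose.rep_eq comp_apply)
qed

lemma range_Q: "x \<in> range (blinfun_apply (Q t)) \<longleftrightarrow> Q t x = x"
proof
  show "Q t x = x \<Longrightarrow> x \<in> range (blinfun_apply (Q t))" by (erule range_eqI[OF sym])
qed (auto simp: Q_idem)

lemma L_homeomorphism:
  assumes "\<tau> \<le> t"
  shows "homeomorphism (range (blinfun_apply (Q \<tau>))) (range (blinfun_apply (Q t)))
          (blinfun_apply (L t \<tau>)) (inv_into (range (blinfun_apply (Q \<tau>))) (blinfun_apply (L t \<tau>)))"
  using split assms unfolding exponential_splitting_def by blast

lemma U_forward: "s \<le> t \<Longrightarrow> U t s x = L t s (Q s x)"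
  by (simp add: U_def Lext_def)

lemma L_U_backward:
  assumes "t \<le> s"
  shows "L s t (U t s x) = Q s x" and "Q t (U t s x) = U t s x"
proof -
  note hom = L_homeomorphism[OF assms]
  have "L s t (U t s x) = Q s x \<and> U t s x \<in> range (blinfun_apply (Q t))"
  proof (cases "t = s")
    case False
    then have U: "U t s x = inv_into (range (blinfun_apply (Q t))) (blinfun_apply (L s t)) (Q s x)"
      using assms by (simp add: U_def Lext_def)
    have "Q s x \<in> range (blinfun_apply (Q s))" by simp
    then show ?thesis
      unfolding U using homeomorphism_apply2[OF hom] homeomorphism_image2[OF hom] by blast
  qed (auto simp: U_forward L_refl)
  then show "L s t (U t s x) = Q s x" "Q t (U t s x) = U t s x" by (auto simp: range_Q)
qed

text \<open>The characterization of the backward operators by which \<open>inv_into\<close> is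
  eliminated: a vector in the range of \<open>Q t\<close> is determined by its forward
  image.\<close>

lemma U_backward_eqI:
  assumes "t \<le> s" "Q t y = y" "L s t y = Q s x"
  shows "U t s x = y"
proof -
  note hom = L_homeomorphism[OF assms(1)]
  have "y \<in> range (blinfun_apply (Q t))" "U t s x \<in> range (blinfun_apply (Q t))"
    using assms L_U_backward by (auto simp: range_Q)
  moreover have "L s t y = L s t (U t s x)" using L_U_backward(1)[OF assms(1)] assms by simp
  ultimately show ?thesis using homeomorphism_apply1[OF hom] by metis
qed

lemma Q_U: "Q t (U t s x) = U t s x"
  by (cases "t \<le> s") (auto simp: L_U_backward U_forward Q_L Q_idem)

lemma U_Q: "U t s (Q s x) = U t s x"
  by (simp add: U_def Q_idem)

lemma U_refl: "U t t x = Q t x"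
  by (simp add: U_forward L_refl)

text \<open>Every value of U is a forward evolution from some earlier time a. Identities for
  arbitrary orders of the times thus reduce to the forward cocycle law.\<close>

lemma U_eq_L_U:
  assumes "a \<le> t" "a \<le> r"
  shows "U t r x = L t a (U a r x)"
proof (cases "r \<le> t")
  case True
  have "L t a (U a r x) = L t r (L r a (U a r x))" using True assms by (simp add: L_comp)
  then show ?thesis using True assms by (simp add: U_forward L_U_backward)
next
  case False
  show ?thesis
    by (rule U_backward_eqI) (use False assms in \<open>auto simp: L_comp L_U_backward Q_L\<close>)
qed

lemma U_comp: "U t s (U s r x) = U t r x"
proof -
  \<comment> \<open>From a common past time both sides are forward evolutions, so it is enough to
    compare their values at a.\<close>
  define a where "a = min t (min s r)"
  have a: "a \<le> t" "a \<le> s" "a \<le> r" by (auto simp: a_def)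
  have "U a s (U s r x) = U a r x"
    by (rule U_backward_eqI) (use a in \<open>simp_all add: Q_U U_eq_L_U[OF a(2,3), symmetric]\<close>)
  then show ?thesis using U_eq_L_U[of a t s "U s r x"] U_eq_L_U[of a t r x] a by simp
qed

lemma L_eq_U_plus_V: "s \<le> t \<Longrightarrow> L t s x = U t s x + V t s x"
  by (simp add: U_forward V_def blinfun.diff_right)

lemma V_comp: "s \<le> r \<Longrightarrow> r \<le> t \<Longrightarrow> V t r (V r s x) = V t s x"
  by (simp add: V_def blinfun.diff_right Q_L Q_idem L_comp)

lemma Q_V: "s \<le> t \<Longrightarrow> Q t (V t s x) = 0"
  by (simp add: V_def blinfun.diff_right Q_L Q_idem)

lemma V_refl: "V t t x = x - Q t x"
  by (simp add: V_def L_refl)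

lemma L_U: "s \<le> t \<Longrightarrow> L t s (U s r x) = U t r x"
  using U_comp[of t s r x] by (simp add: U_forward Q_U)

lemma U_L: "r \<le> s \<Longrightarrow> U t s (L s r x) = U t r x"
  by (metis Q_L U_Q U_comp U_forward)

lemma V_L: "r \<le> s \<Longrightarrow> s \<le> t \<Longrightarrow> V t s (L s r x) = V t r x"
  by (simp add: V_def blinfun.diff_right Q_L L_comp)

lemma bounded_linear_V: "bounded_linear (V t s)"
  unfolding V_def
  by (intro bounded_linear_compose[OF blinfun.bounded_linear_right] bounded_linear_sub
      bounded_linear_ident blinfun.bounded_linear_right)

lemma bounded_linear_U: "bounded_linear (U t s)"
proof (cases "s \<le> t")
  case True
  have "U t s = (\<lambda>x. L t s (Q s x))" using True by (simp add: fun_eq_iff U_forward)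
  then show ?thesis
    by (simp add: bounded_linear_compose[OF blinfun.bounded_linear_right] blinfun.bounded_linear_right)
next
  case False
  then have ts: "t \<le> s" by simp
  show ?thesis
  proof (rule bounded_linear_if_continuous_0)
    show "linear (U t s)"
    proof (rule linearI)
      show "U t s (x + y) = U t s x + U t s y" for x y
        by (rule U_backward_eqI[OF ts]) (simp_all add: Q_U blinfun.add_right L_U_backward[OF ts])
      show "U t s (c *\<^sub>R x) = c *\<^sub>R U t s x" for c x
        by (rule U_backward_eqI[OF ts]) (simp_all add: Q_U blinfun.scaleR_right L_U_backward[OF ts])
    qed
    have "continuous_on UNIV (\<lambda>x. inv_into (range (blinfun_apply (Q t))) (blinfun_apply (L s t)) (Q s x))"
      by (rule continuous_on_compose2[OF homeomorphism_cont2[OF L_homeomorphism[OF ts]]])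
        (auto intro!: continuous_intros)
    moreover have "(\<lambda>x. inv_into (range (blinfun_apply (Q t))) (blinfun_apply (L s t)) (Q s x)) = U t s"
      using False by (simp add: fun_eq_iff U_def Lext_def)
    ultimately show "continuous (at 0) (U t s)"
      by (simp add: continuous_on_eq_continuous_at)
  qed
qed

lemmas U_add = linear_simps(1)[OF bounded_linear_U]
  and U_diff = linear_simps(2)[OF bounded_linear_U]
  and U_0 = linear_simps(3)[OF bounded_linear_U]
  and V_add = linear_simps(1)[OF bounded_linear_V]
  and V_diff = linear_simps(2)[OF bounded_linear_V]
  and V_0 = linear_simps(3)[OF bounded_linear_V]

section \<open>Bounds and joint continuity of the kernels\<close>

lemma U_bound:
  assumes "t \<le> s"
  shows "exp (\<rho> * (t - s)) * norm (U t s x) \<le> M * norm x"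
proof -
  have "exp (\<rho> * (t - s)) * onorm (\<lambda>x. Lext L Q t s (Q s x)) \<le> M"
    using split assms unfolding exponential_splitting_def by blast
  then have 1: "exp (\<rho> * (t - s)) * onorm (U t s) \<le> M"
    by (simp add: U_def[abs_def])
  have "exp (\<rho> * (t - s)) * norm (U t s x) \<le> exp (\<rho> * (t - s)) * (onorm (U t s) * norm x)"
    by (intro mult_left_mono onorm bounded_linear_U) auto
  also have "\<dots> \<le> M * norm x"
    using mult_right_mono[OF 1 norm_ge_zero[of x]] by (simp add: mult.assoc)
  finally show ?thesis .
qed

lemma V_bound:
  assumes "s \<le> t"
  shows "exp (\<gamma> * (t - s)) * norm (V t s x) \<le> M * norm x"
proof -
  have 1: "exp (\<gamma> * (t - s)) * norm (L t s o\<^sub>L (id_blinfun - Q s)) \<le> M"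
    using split assms unfolding exponential_splitting_def by blast
  have V: "V t s x = (L t s o\<^sub>L (id_blinfun - Q s)) x"
    by (simp add: V_def blinfun.diff_left)
  have "exp (\<gamma> * (t - s)) * norm (V t s x)
      \<le> exp (\<gamma> * (t - s)) * (norm (L t s o\<^sub>L (id_blinfun - Q s)) * norm x)"
    unfolding V by (intro mult_left_mono norm_blinfun) auto
  also have "\<dots> \<le> M * norm x"
    using mult_right_mono[OF 1 norm_ge_zero[of x]] by (simp add: mult.assoc)
  finally show ?thesis .
qed

text \<open>The splitting bounds U backward in time, not forward. A general U t s is factored as U t
  b, U b a, U a s: the outer two run backward, and the middle one is a single fixed bounded
  operator.\<close>

lemma U_locally_bounded:
  obtains B where "0 \<le> B" "\<And>t s x. t \<in> {a..b} \<Longrightarrow> s \<in> {a..b} \<Longrightarrow> norm (U t s x) \<le> B * norm x"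
proof -
  define E where "E = exp (\<bar>\<rho>\<bar> * \<bar>b - a\<bar>) * M"
  have E: "0 \<le> E" using M_ge_1 by (simp add: E_def)
  have 1: "norm (U t s x) \<le> E * norm x" if "t \<le> s" "t \<in> {a..b}" "s \<in> {a..b}" for t s x
  proof -
    have "- (\<rho> * (t - s)) \<le> \<bar>\<rho>\<bar> * \<bar>b - a\<bar>"
    proof -
      have "- (\<rho> * (t - s)) \<le> \<bar>\<rho>\<bar> * \<bar>t - s\<bar>" by (metis abs_ge_minus_self abs_mult)
      also have "\<dots> \<le> \<bar>\<rho>\<bar> * \<bar>b - a\<bar>" using that by (intro mult_left_mono) auto
      finally show ?thesis .
    qed
    then have e: "exp (- (\<rho> * (t - s))) \<le> exp (\<bar>\<rho>\<bar> * \<bar>b - a\<bar>)" by simp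
    have "norm (U t s x) = exp (- (\<rho> * (t - s))) * (exp (\<rho> * (t - s)) * norm (U t s x))"
      by (simp add: exp_minus)
    also have "\<dots> \<le> exp (\<bar>\<rho>\<bar> * \<bar>b - a\<bar>) * (M * norm x)"
      using M_ge_1 by (intro mult_mono[OF e U_bound[OF that(1)]]) auto
    finally show ?thesis by (simp add: E_def)
  qed
  obtain K where K: "0 \<le> K" "\<And>x. norm (U b a x) \<le> norm x * K"
    using bounded_linear.nonneg_bounded[OF bounded_linear_U] by blast
  have "norm (U t s x) \<le> E * K * E * norm x" if "t \<in> {a..b}" "s \<in> {a..b}" for t s x
  proof -
    have ab: "a \<in> {a..b}" "b \<in> {a..b}" using that by auto
    have "norm (U t s x) = norm (U t b (U b a (U a s x)))" by (simp add: U_comp)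
    also have "\<dots> \<le> E * norm (U b a (U a s x))" using that ab by (intro 1) auto
    also have "\<dots> \<le> E * (norm (U a s x) * K)" using K E by (intro mult_left_mono) auto
    also have "\<dots> \<le> E * ((E * norm x) * K)"
      using that ab K E by (intro mult_left_mono mult_right_mono 1) auto
    finally show ?thesis by (simp add: mult_ac)
  qed
  moreover have "0 \<le> E * K * E" using E K by simp
  ultimately show thesis using that by blast
qed

lemma V_locally_bounded:
  obtains B where "0 \<le> B" "\<And>t s x. a \<le> s \<Longrightarrow> s \<le> t \<Longrightarrow> t \<le> b \<Longrightarrow> norm (V t s x) \<le> B * norm x"
proof -
  define E where "E = exp (\<bar>\<gamma>\<bar> * \<bar>b - a\<bar>) * M"
  have "norm (V t s x) \<le> E * norm x" if "a \<le> s" "s \<le> t" "t \<le> b" for t s x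
  proof -
    have "- (\<gamma> * (t - s)) \<le> \<bar>\<gamma>\<bar> * \<bar>b - a\<bar>"
    proof -
      have "- (\<gamma> * (t - s)) \<le> \<bar>\<gamma>\<bar> * \<bar>t - s\<bar>" by (metis abs_ge_minus_self abs_mult)
      also have "\<dots> \<le> \<bar>\<gamma>\<bar> * \<bar>b - a\<bar>" using that by (intro mult_left_mono) auto
      finally show ?thesis .
    qed
    then have e: "exp (- (\<gamma> * (t - s))) \<le> exp (\<bar>\<gamma>\<bar> * \<bar>b - a\<bar>)" by simp
    have "norm (V t s x) = exp (- (\<gamma> * (t - s))) * (exp (\<gamma> * (t - s)) * norm (V t s x))"
      by (simp add: exp_minus)
    also have "\<dots> \<le> exp (\<bar>\<gamma>\<bar> * \<bar>b - a\<bar>) * (M * norm x)"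
      using M_ge_1 by (intro mult_mono[OF e V_bound[OF that(2)]]) auto
    finally show ?thesis by (simp add: E_def)
  qed
  moreover have "0 \<le> E" using M_ge_1 by (simp add: E_def)
  ultimately show thesis using that by blast
qed

lemma continuous_L_fst: "continuous_on {a..} (\<lambda>t. L t a x)"
  using continuous_on_compose2[OF L_continuous, of "{a..}" "\<lambda>t. (t, a)"]
  by (force intro: continuous_intros)

lemma continuous_L_snd: "continuous_on {..b} (\<lambda>s. L b s x)"
  using continuous_on_compose2[OF L_continuous, of "{..b}" "\<lambda>s. (b, s)"]
  by (force intro: continuous_intros)

lemma continuous_U_fst: "continuous_on S (\<lambda>t. U t r x)"
proof -
  have "continuous_on {a..} (\<lambda>t. U t r x)" for a
  proof -
    have "continuous_on {a..} (\<lambda>t. L t (min a r) (U (min a r) r x))"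
      by (rule continuous_on_subset[OF continuous_L_fst]) auto
    then show ?thesis
      by (rule continuous_on_eq) (auto intro!: U_eq_L_U[symmetric])
  qed
  from continuous_on_UNIV_if_atLeast[OF this] show ?thesis by (rule continuous_on_subset) simp
qed

lemma continuous_U_snd: "continuous_on S (\<lambda>s. U t s x)"
proof -
  have "continuous_on {..b} (\<lambda>s. U t s x)" for b
  proof -
    have "continuous_on {..b} (\<lambda>s. U t b (L b s x))"
      by (rule bounded_linear.continuous_on[OF bounded_linear_U continuous_L_snd])
    then show ?thesis by (rule continuous_on_eq) (simp add: U_L)
  qed
  from continuous_on_UNIV_if_atMost[OF this] show ?thesis by (rule continuous_on_subset) simp
qed

text \<open>In the factorization U t s = U t b (U b s) each factor depends on one variable only;
  strong continuity in each and the local bound give joint continuity.\<close>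

lemma continuous_U:
  assumes g: "continuous_on {a..b} g"
  shows "continuous_on ({a..b} \<times> {a..b}) (\<lambda>(t, s). U t s (g s))"
proof -
  obtain B where B: "\<And>t s x. t \<in> {a..b} \<Longrightarrow> s \<in> {a..b} \<Longrightarrow> norm (U t s x) \<le> B * norm x"
    using U_locally_bounded by metis
  have "continuous_on ({a..b} \<times> {a..b}) (\<lambda>p. U (fst p) (snd p) x)" for x
  proof -
    have "continuous_on ({a..b} \<times> {a..b}) (\<lambda>p. U (fst p) b (U b (snd p) x))"
    proof (rule continuous_on_bounded_operators[where B = B and A = "\<lambda>p. U (fst p) b" and h = "\<lambda>p. U b (snd p) x"])
      show "norm (U (fst p) b x) \<le> B * norm x" if "p \<in> {a..b} \<times> {a..b}" for p x
        using that by (intro B) auto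
      show "continuous_on ({a..b} \<times> {a..b}) (\<lambda>p. U (fst p) b x)" for x
        by (rule continuous_on_compose2[OF continuous_U_fst[of UNIV]]) (auto intro: continuous_intros)
      show "continuous_on ({a..b} \<times> {a..b}) (\<lambda>p. U b (snd p) x)"
        by (rule continuous_on_compose2[OF continuous_U_snd[of UNIV]]) (auto intro: continuous_intros)
    qed (simp add: U_diff)
    then show ?thesis by (simp add: U_comp)
  qed
  moreover have "continuous_on ({a..b} \<times> {a..b}) (\<lambda>p. g (snd p))"
    by (rule continuous_on_compose2[OF g]) (auto intro: continuous_intros)
  ultimately have "continuous_on ({a..b} \<times> {a..b}) (\<lambda>p. U (fst p) (snd p) (g (snd p)))"
    by (intro continuous_on_bounded_operators[where B = B and A = "\<lambda>p. U (fst p) (snd p)" and h = "\<lambda>p. g (snd p)"])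
      (auto simp: U_diff intro: B)
  then show ?thesis by (simp add: case_prod_unfold)
qed

lemma continuous_V:
  assumes g: "continuous_on {a..b} g"
  shows "continuous_on {(t, s). a \<le> s \<and> s \<le> t \<and> t \<le> b} (\<lambda>(t, s). V t s (g s))"
proof -
  let ?S = "{(t, s). a \<le> s \<and> s \<le> t \<and> t \<le> b}"
  obtain B where B: "\<And>t s x. a \<le> s \<Longrightarrow> s \<le> t \<Longrightarrow> t \<le> b \<Longrightarrow> norm (V t s x) \<le> B * norm x"
    using V_locally_bounded by metis
  have "continuous_on ?S (\<lambda>p. V (fst p) (snd p) x)" for x
  proof -
    have "continuous_on ?S (\<lambda>p. (case p of (t, s) \<Rightarrow> L t s x) - (case p of (t, s) \<Rightarrow> U t s x))"
      by (intro continuous_on_diff continuous_on_subset[OF L_continuous]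
          continuous_on_subset[OF continuous_U[of a b "\<lambda>_. x"]]) auto
    then show ?thesis
      by (rule continuous_on_eq) (auto simp: L_eq_U_plus_V)
  qed
  moreover have "continuous_on ?S (\<lambda>p. g (snd p))"
    by (rule continuous_on_compose2[OF g]) (auto intro: continuous_intros)
  ultimately have "continuous_on ?S (\<lambda>p. V (fst p) (snd p) (g (snd p)))"
    by (intro continuous_on_bounded_operators[where B = B and A = "\<lambda>p. V (fst p) (snd p)" and h = "\<lambda>p. g (snd p)"])
      (auto simp: V_diff intro: B)
  then show ?thesis by (simp add: case_prod_unfold)
qed

lemma continuous_U_integrand:
  assumes g: "continuous_on {a..b} g"
  shows "continuous_on {a..b} (\<lambda>s. U t s (g s))"
proof -
  have "continuous_on {a..b} (\<lambda>s. U a s (g s))"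
  proof (cases "a \<le> b")
    case True
    show ?thesis
      using continuous_on_compose2[OF continuous_U[OF g], of "{a..b}" "\<lambda>s. (a, s)"] True
      by (force intro: continuous_intros)
  qed simp
  then have "continuous_on {a..b} (\<lambda>s. U t a (U a s (g s)))"
    by (rule bounded_linear.continuous_on[OF bounded_linear_U])
  then show ?thesis by (simp add: U_comp)
qed

lemma continuous_V_integrand:
  assumes g: "continuous_on {a..b} g" and "b \<le> t"
  shows "continuous_on {a..b} (\<lambda>s. V t s (g s))"
proof -
  have "continuous_on {a..b} (\<lambda>s. V b s (g s))"
    using continuous_on_compose2[OF continuous_V[OF g], of "{a..b}" "\<lambda>s. (b, s)"]
    by (force intro: continuous_intros)
  then have "continuous_on {a..b} (\<lambda>s. V t b (V b s (g s)))"
    by (rule bounded_linear.continuous_on[OF bounded_linear_V])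
  then show ?thesis
    by (rule continuous_on_eq) (use assms in \<open>auto simp: V_comp\<close>)
qed

lemma continuous_V_integrand_atMost:
  assumes g: "continuous_on {..b} g" and "b \<le> t"
  shows "continuous_on {..b} (\<lambda>s. V t s (g s))"
  by (intro continuous_on_atMost_if_Icc continuous_V_integrand continuous_on_subset[OF g]) (use assms in auto)

lemma continuous_L_integrand:
  assumes g: "continuous_on {a..b} g" and "b \<le> t"
  shows "continuous_on {a..b} (\<lambda>s. L t s (g s))"
proof -
  have "continuous_on {a..b} (\<lambda>s. U t s (g s) + V t s (g s))"
    using assms by (intro continuous_on_add continuous_U_integrand continuous_V_integrand)
  then show ?thesis
    by (rule continuous_on_eq) (use assms in \<open>auto simp: L_eq_U_plus_V\<close>)
qed

text \<open>The factorization U t s = U t b (U b s) takes t out of the integrand, leaving it in an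
  operator and in the limit of integration. V has no backward evolution, so its integral is treated
  as a Volterra integral.\<close>

lemma continuous_U_integral:
  assumes g: "continuous_on {..b} g"
  shows "continuous_on {..b} (\<lambda>t. integral {t..b} (\<lambda>s. U t s (g s)))"
proof (rule continuous_on_atMost_if_Icc)
  fix a
  obtain B where B: "\<And>t s x. t \<in> {a..b} \<Longrightarrow> s \<in> {a..b} \<Longrightarrow> norm (U t s x) \<le> B * norm x"
    using U_locally_bounded by metis
  have int: "continuous_on {t..b} (\<lambda>s. U b s (g s))" for t
    by (rule continuous_U_integrand, rule continuous_on_subset[OF g]) auto
  have "continuous_on {a..b} (\<lambda>t. U t b (integral {t..b} (\<lambda>s. U b s (g s))))"
  proof (rule continuous_on_bounded_operators[where B = B and A = "\<lambda>t. U t b" and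
        h = "\<lambda>t. integral {t..b} (\<lambda>s. U b s (g s))"])
    show "continuous_on {a..b} (\<lambda>t. integral {t..b} (\<lambda>s. U b s (g s)))"
      by (intro indefinite_integral_continuous_1' integrable_continuous_real int)
  qed (auto simp: U_diff continuous_U_fst intro: B)
  then show "continuous_on {a..b} (\<lambda>t. integral {t..b} (\<lambda>s. U t s (g s)))"
    by (rule continuous_on_eq) (simp add: bounded_linear_integral_Icc[OF bounded_linear_U int] U_comp)
qed

lemma continuous_V_integral:
  assumes g: "continuous_on {a..b} g"
  shows "continuous_on {a..b} (\<lambda>t. integral {a..t} (\<lambda>s. V t s (g s)))"
  by (rule continuous_on_Volterra_integral[OF continuous_V[OF g]])

lemma U_integral: "continuous_on {a..b} g \<Longrightarrow>
    U r t (integral {a..b} (\<lambda>s. U t s (g s))) = integral {a..b} (\<lambda>s. U r s (g s))"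
  by (subst bounded_linear_integral_Icc[OF bounded_linear_U]) (auto simp: U_comp continuous_U_integrand)

lemma V_integral:
  assumes "continuous_on {a..t} g" "t \<le> r"
  shows "V r t (integral {a..t} (\<lambda>s. V t s (g s))) = integral {a..t} (\<lambda>s. V r s (g s))"
  by (subst bounded_linear_integral_Icc[OF bounded_linear_V])
    (use assms in \<open>auto simp: V_comp continuous_V_integrand intro!: integral_cong\<close>)

subsection \<open>Norms adapted to the splitting\<close>

lemma nU_alt: "nU t x = (SUP r\<in>{..t}. exp (\<rho> * (r - t)) * norm (U r t x))"
  by (simp add: nU_def N_norm_def U_def)

lemma nV_alt: "nV t x = (SUP r\<in>{t..}. exp (\<gamma> * (r - t)) * norm (V r t x))"
  by (simp add: nV_def S_norm_def V_def)

lemma U_le_nU: "r \<le> t \<Longrightarrow> exp (\<rho> * (r - t)) * norm (U r t x) \<le> nU t x"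
  unfolding nU_alt by (intro cSUP_upper bdd_aboveI2[where M = "M * norm x"] U_bound) auto

lemma V_le_nV: "t \<le> r \<Longrightarrow> exp (\<gamma> * (r - t)) * norm (V r t x) \<le> nV t x"
  unfolding nV_alt by (intro cSUP_upper bdd_aboveI2[where M = "M * norm x"] V_bound) auto

lemma norm_V_le: "t \<le> r \<Longrightarrow> norm (V r t x) \<le> exp (- \<gamma> * (r - t)) * nV t x"
  using V_le_nV[of t r x] by (simp add: exp_minus inverse_eq_divide pos_le_divide_eq mult.commute)

lemma nU_least: "(\<And>r. r \<le> t \<Longrightarrow> exp (\<rho> * (r - t)) * norm (U r t x) \<le> C) \<Longrightarrow> nU t x \<le> C"
  unfolding nU_alt by (intro cSUP_least) auto

lemma nV_least: "(\<And>r. t \<le> r \<Longrightarrow> exp (\<gamma> * (r - t)) * norm (V r t x) \<le> C) \<Longrightarrow> nV t x \<le> C"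
  unfolding nV_alt by (intro cSUP_least) auto

lemma norm_Q_le: "norm (Q t x) \<le> nU t x"
  using U_le_nU[of t t x] by (simp add: U_refl)

lemma norm_diff_Q_le: "norm (x - Q t x) \<le> nV t x"
  using V_le_nV[of t t x] by (simp add: V_refl)

lemma nU_nonneg: "0 \<le> nU t x" and nV_nonneg: "0 \<le> nV t x"
  using order_trans[OF norm_ge_zero norm_Q_le] order_trans[OF norm_ge_zero norm_diff_Q_le] by blast+

lemma norm_le_nU_nV: "norm x \<le> nU t x + nV t x"
  using norm_triangle_ineq[of "Q t x" "x - Q t x"] norm_Q_le[of t x] norm_diff_Q_le[of x t] by simp

lemma nU_le: "nU t x \<le> M * norm x" and nV_le: "nV t x \<le> M * norm x"
  by (auto intro!: nU_least nV_least U_bound V_bound)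

lemma nU_add: "nU t (x + y) \<le> nU t x + nU t y"
proof (rule nU_least)
  fix r assume r: "r \<le> t"
  have "exp (\<rho> * (r - t)) * norm (U r t (x + y))
      \<le> exp (\<rho> * (r - t)) * norm (U r t x) + exp (\<rho> * (r - t)) * norm (U r t y)"
    by (simp add: U_add norm_triangle_ineq flip: distrib_left)
  also have "\<dots> \<le> nU t x + nU t y" using r by (intro add_mono U_le_nU)
  finally show "exp (\<rho> * (r - t)) * norm (U r t (x + y)) \<le> nU t x + nU t y" .
qed

lemma nV_add: "nV t (x + y) \<le> nV t x + nV t y"
proof (rule nV_least)
  fix r assume r: "t \<le> r"
  have "exp (\<gamma> * (r - t)) * norm (V r t (x + y))
      \<le> exp (\<gamma> * (r - t)) * norm (V r t x) + exp (\<gamma> * (r - t)) * norm (V r t y)"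
    by (simp add: V_add norm_triangle_ineq flip: distrib_left)
  also have "\<dots> \<le> nV t x + nV t y" using r by (intro add_mono V_le_nV)
  finally show "exp (\<gamma> * (r - t)) * norm (V r t (x + y)) \<le> nV t x + nV t y" .
qed

lemma nU_cong: "Q t x = Q t y \<Longrightarrow> nU t x = nU t y"
  by (simp add: nU_def)

lemma nV_cong: "x - Q t x = y - Q t y \<Longrightarrow> nV t x = nV t y"
  by (simp add: nV_def)

lemma nU_minus: "nU t (x - y) = nU t (y - x)"
  using U_diff[of _ t x y] U_diff[of _ t y x] by (simp add: nU_alt norm_minus_commute)

lemma nV_minus: "nV t (x - y) = nV t (y - x)"
  using V_diff[of _ t x y] V_diff[of _ t y x] by (simp add: nV_alt norm_minus_commute)

lemma nU_0: "nU t 0 = 0" and nV_0: "nV t 0 = 0"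
  using nU_le[of t 0] nU_nonneg[of t 0] nV_le[of t 0] nV_nonneg[of t 0] by simp_all

text \<open>By the cocycle law the supremum at time t runs over a subset of the values in the
  supremum at s, up to the exponential factor. So the rate \<rho> holds with constant 1, which is
  the purpose of these norms; \<open>nV_V\<close> is the forward counterpart.\<close>

lemma nU_U:
  assumes "t \<le> s"
  shows "nU t (U t s x) \<le> exp (- \<rho> * (t - s)) * nU s x"
proof (rule nU_least)
  fix r assume "r \<le> t"
  have "exp (\<rho> * (r - t)) * norm (U r t (U t s x))
      = exp (- \<rho> * (t - s)) * (exp (\<rho> * (r - s)) * norm (U r s x))"
    by (simp add: U_comp exp_add[symmetric] algebra_simps flip: mult.assoc)
  also have "\<dots> \<le> exp (- \<rho> * (t - s)) * nU s x"
    using assms \<open>r \<le> t\<close> by (intro mult_left_mono U_le_nU) auto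
  finally show "exp (\<rho> * (r - t)) * norm (U r t (U t s x)) \<le> exp (- \<rho> * (t - s)) * nU s x" .
qed

lemma nV_V:
  assumes "s \<le> t"
  shows "nV t (V t s x) \<le> exp (- \<gamma> * (t - s)) * nV s x"
proof (rule nV_least)
  fix r assume "t \<le> r"
  have "exp (\<gamma> * (r - t)) * norm (V r t (V t s x))
      = exp (- \<gamma> * (t - s)) * (exp (\<gamma> * (r - s)) * norm (V r s x))"
    using assms \<open>t \<le> r\<close> by (simp add: V_comp exp_add[symmetric] algebra_simps flip: mult.assoc)
  also have "\<dots> \<le> exp (- \<gamma> * (t - s)) * nV s x"
    using assms \<open>t \<le> r\<close> by (intro mult_left_mono V_le_nV) auto
  finally show "exp (\<gamma> * (r - t)) * norm (V r t (V t s x)) \<le> exp (- \<gamma> * (t - s)) * nV s x" .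
qed

section \<open>Integral estimates in the adapted seminorms\<close>

lemma nU_integral_le:
  assumes "t \<le> b" and g: "continuous_on {t..b} g"
    and \<phi>: "\<And>s. s \<in> {t..b} \<Longrightarrow> exp (\<rho> * (s - t)) * nU s (g s) \<le> \<phi> s"
    and \<Psi>: "\<And>s. s \<in> {t..b} \<Longrightarrow> (\<Psi> has_real_derivative \<phi> s) (at s)"
  shows "nU t (integral {t..b} (\<lambda>s. U t s (g s))) \<le> \<Psi> b - \<Psi> t"
proof (rule nU_least)
  fix r assume r: "r \<le> t"
  let ?e = "exp (\<rho> * (r - t))"
  \<comment> \<open>Each r in the supremum is tested separately by moving U r t under the integral.
    The function \<open>\<lambda>s. nU s (g s)\<close> is never integrated itself; the majorant
    \<phi> with its primitive \<Psi> replaces it.\<close>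
  have "norm (integral {t..b} (\<lambda>s. ?e *\<^sub>R U r s (g s))) \<le> \<Psi> b - \<Psi> t"
  proof (rule norm_integral_le_primitive[OF assms(1) _ _ \<Psi>])
    show "continuous_on {t..b} (\<lambda>s. ?e *\<^sub>R U r s (g s))"
      by (intro continuous_intros continuous_U_integrand g)
    fix s assume s: "s \<in> {t..b}"
    have "norm (?e *\<^sub>R U r s (g s)) = exp (\<rho> * (s - t)) * (exp (\<rho> * (r - s)) * norm (U r s (g s)))"
      by (simp add: exp_add[symmetric] algebra_simps flip: mult.assoc)
    also have "\<dots> \<le> exp (\<rho> * (s - t)) * nU s (g s)"
      using r s by (intro mult_left_mono U_le_nU) auto
    also have "\<dots> \<le> \<phi> s" by (rule \<phi>[OF s])
    finally show "norm (?e *\<^sub>R U r s (g s)) \<le> \<phi> s" .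
  qed
  then show "?e * norm (U r t (integral {t..b} (\<lambda>s. U t s (g s)))) \<le> \<Psi> b - \<Psi> t"
    by (simp add: U_integral[OF g])
qed

lemma nV_integral_le:
  assumes "a \<le> t" and g: "continuous_on {a..t} g"
    and \<phi>: "\<And>s. s \<in> {a..t} \<Longrightarrow> exp (- \<gamma> * (t - s)) * nV s (g s) \<le> \<phi> s"
    and \<Psi>: "\<And>s. s \<in> {a..t} \<Longrightarrow> (\<Psi> has_real_derivative \<phi> s) (at s)"
  shows "nV t (integral {a..t} (\<lambda>s. V t s (g s))) \<le> \<Psi> t - \<Psi> a"
proof (rule nV_least)
  fix r assume r: "t \<le> r"
  let ?e = "exp (\<gamma> * (r - t))"
  have "norm (integral {a..t} (\<lambda>s. ?e *\<^sub>R V r s (g s))) \<le> \<Psi> t - \<Psi> a"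
  proof (rule norm_integral_le_primitive[OF assms(1) _ _ \<Psi>])
    show "continuous_on {a..t} (\<lambda>s. ?e *\<^sub>R V r s (g s))"
      by (intro continuous_intros continuous_V_integrand g r)
    fix s assume s: "s \<in> {a..t}"
    have "norm (?e *\<^sub>R V r s (g s)) = exp (- \<gamma> * (t - s)) * (exp (\<gamma> * (r - s)) * norm (V r s (g s)))"
      by (simp add: exp_add[symmetric] algebra_simps flip: mult.assoc)
    also have "\<dots> \<le> exp (- \<gamma> * (t - s)) * nV s (g s)"
      using r s by (intro mult_left_mono V_le_nV) auto
    also have "\<dots> \<le> \<phi> s" by (rule \<phi>[OF s])
    finally show "norm (?e *\<^sub>R V r s (g s)) \<le> \<phi> s" .
  qed
  then show "?e * norm (V r t (integral {a..t} (\<lambda>s. V t s (g s)))) \<le> \<Psi> t - \<Psi> a"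
    by (simp add: V_integral[OF g r])
qed

text \<open>Decay at rate \<gamma> against backward growth at rate \<sigma> leaves exp ((\<gamma> -
  \<sigma>) s), which is integrable at -infinity.\<close>

lemma norm_V_integrand_le:
  assumes "s \<le> t" "nV s (g s) \<le> C * exp (- \<sigma> * s)"
  shows "norm (V t s (g s)) \<le> C * exp (- \<gamma> * t) * exp ((\<gamma> - \<sigma>) * s)"
proof -
  have "norm (V t s (g s)) \<le> exp (- \<gamma> * (t - s)) * (C * exp (- \<sigma> * s))"
    by (rule order_trans[OF norm_V_le[OF assms(1)] mult_left_mono[OF assms(2)]]) simp
  also have "\<dots> = C * exp (- \<gamma> * t) * exp ((\<gamma> - \<sigma>) * s)"
    by (simp add: algebra_simps flip: exp_add)
  finally show ?thesis .
qed

lemma V_integrable_atMost: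
  assumes g: "continuous_on {..t} g" and bd: "\<And>s. s \<le> t \<Longrightarrow> nV s (g s) \<le> C * exp (- \<sigma> * s)"
    and "\<sigma> < \<gamma>" and "t \<le> r"
  shows "(\<lambda>s. V r s (g s)) integrable_on {..t}"
    and "((\<lambda>a. integral {a..t} (\<lambda>s. V r s (g s))) \<longlongrightarrow> integral {..t} (\<lambda>s. V r s (g s))) at_bot"
  using assms norm_V_integrand_le[of _ r g C \<sigma>]
  by (intro integral_atMost_limit[where c = "\<gamma> - \<sigma>" and C = "C * exp (- \<gamma> * r)"]
      continuous_V_integrand_atMost; force)+

lemma V_integral_atMost:
  assumes g: "continuous_on {..t} g" and bd: "\<And>s. s \<le> t \<Longrightarrow> nV s (g s) \<le> C * exp (- \<sigma> * s)"
    and "\<sigma> < \<gamma>" and "t \<le> r"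
  shows "V r t (integral {..t} (\<lambda>s. V t s (g s))) = integral {..t} (\<lambda>s. V r s (g s))"
proof -
  have "V r t (integral {..t} (\<lambda>s. V t s (g s))) = integral {..t} (\<lambda>s. V r t (V t s (g s)))"
    using V_integrable_atMost(1)[OF g bd \<open>\<sigma> < \<gamma>\<close> order_refl]
    by (rule integral_atMost_bounded_linear[OF bounded_linear_V])
  also have "\<dots> = integral {..t} (\<lambda>s. V r s (g s))"
    using \<open>t \<le> r\<close> by (intro integral_cong) (auto simp: V_comp)
  finally show ?thesis .
qed

lemma Q_V_integral_atMost:
  assumes g: "continuous_on {..t} g" and bd: "\<And>s. s \<le> t \<Longrightarrow> nV s (g s) \<le> C * exp (- \<sigma> * s)"
    and "\<sigma> < \<gamma>"
  shows "Q t (integral {..t} (\<lambda>s. V t s (g s))) = 0"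
proof -
  have "Q t (integral {..t} (\<lambda>s. V t s (g s))) = integral {..t} (\<lambda>s. Q t (V t s (g s)))"
    using V_integrable_atMost(1)[OF g bd \<open>\<sigma> < \<gamma>\<close> order_refl]
    by (rule integral_atMost_bounded_linear[OF blinfun.bounded_linear_right])
  also have "\<dots> = integral {..t} (\<lambda>s. 0)" by (intro integral_cong) (simp add: Q_V)
  finally show ?thesis by simp
qed

lemma V_integral_atMost_split:
  assumes g: "continuous_on {..t} g" and bd: "\<And>s. s \<le> t \<Longrightarrow> nV s (g s) \<le> C * exp (- \<sigma> * s)"
    and "\<sigma> < \<gamma>" and "a \<le> t"
  shows "integral {..t} (\<lambda>s. V t s (g s))
    = V t a (integral {..a} (\<lambda>s. V a s (g s))) + integral {a..t} (\<lambda>s. V t s (g s))"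
proof -
  have "integral {..t} (\<lambda>s. V t s (g s))
    = integral {..a} (\<lambda>s. V t s (g s)) + integral {a..t} (\<lambda>s. V t s (g s))"
  proof (rule integral_atMost_split)
    show "norm (V t s (g s)) \<le> C * exp (- \<gamma> * t) * exp ((\<gamma> - \<sigma>) * s)" if "s \<le> t" for s
      using norm_V_integrand_le[OF that, of g C \<sigma>] bd[OF that] by blast
  qed (use assms in \<open>auto intro: continuous_V_integrand_atMost\<close>)
  moreover have "continuous_on {..a} g" by (rule continuous_on_subset[OF g]) (use assms in auto)
  ultimately show ?thesis
    using assms by (subst V_integral_atMost[where C = C and \<sigma> = \<sigma>]) auto
qed

text \<open>On \<open>{a..b}\<close> the past up to a contributes one fixed vector transported by V
  t a; what remains is a Volterra integral over a bounded interval.\<close>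

lemma continuous_V_integral_atMost:
  assumes g: "continuous_on {..b} g" and bd: "\<And>s. s \<le> b \<Longrightarrow> nV s (g s) \<le> C * exp (- \<sigma> * s)"
    and "\<sigma> < \<gamma>"
  shows "continuous_on {..b} (\<lambda>t. integral {..t} (\<lambda>s. V t s (g s)))"
proof (rule continuous_on_atMost_if_Icc)
  fix a
  have gt: "continuous_on {..t} g" if "t \<le> b" for t
    by (rule continuous_on_subset[OF g]) (use that in auto)
  have "continuous_on {a..b} (\<lambda>t. V t a (integral {..a} (\<lambda>s. V a s (g s))) + integral {a..t} (\<lambda>s. V t s (g s)))"
  proof (intro continuous_on_add continuous_V_integral)
    show "continuous_on {a..b} (\<lambda>t. V t a x)" for x
      unfolding V_def by (rule continuous_on_subset[OF continuous_L_fst]) auto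
    show "continuous_on {a..b} g" by (rule continuous_on_subset[OF g]) auto
  qed
  then show "continuous_on {a..b} (\<lambda>t. integral {..t} (\<lambda>s. V t s (g s)))"
    by (rule continuous_on_eq, intro V_integral_atMost_split[symmetric, where C = C and \<sigma> = \<sigma>])
      (use gt bd \<open>\<sigma> < \<gamma>\<close> in auto)
qed

lemma nV_integral_atMost_le:
  assumes g: "continuous_on {..t} g" and bd: "\<And>s. s \<le> t \<Longrightarrow> nV s (g s) \<le> C * exp (- \<sigma> * s)"
    and "\<sigma> < \<gamma>"
    and \<phi>: "\<And>s. s \<le> t \<Longrightarrow> exp (- \<gamma> * (t - s)) * nV s (g s) \<le> \<phi> s"
    and \<Psi>: "\<And>s. s \<le> t \<Longrightarrow> (\<Psi> has_real_derivative \<phi> s) (at s)"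
    and pos: "\<And>s. s \<le> t \<Longrightarrow> 0 \<le> \<Psi> s"
  shows "nV t (integral {..t} (\<lambda>s. V t s (g s))) \<le> \<Psi> t"
proof (rule nV_least)
  fix r assume r: "t \<le> r"
  let ?e = "exp (\<gamma> * (r - t))"
  have "norm (integral {..t} (\<lambda>s. ?e *\<^sub>R V r s (g s))) \<le> \<Psi> t"
  proof (rule norm_integral_atMost_le_primitive[OF _ _ _ _ \<Psi> pos])
    show "continuous_on {..t} (\<lambda>s. ?e *\<^sub>R V r s (g s))"
      by (intro continuous_intros continuous_V_integrand_atMost g r)
    show "0 < \<gamma> - \<sigma>" using \<open>\<sigma> < \<gamma>\<close> by simp
    fix s assume s: "s \<le> t"
    have "norm (V r s (g s)) \<le> C * exp (- \<gamma> * r) * exp ((\<gamma> - \<sigma>) * s)"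
      using s r bd by (intro norm_V_integrand_le) auto
    then show "norm (?e *\<^sub>R V r s (g s)) \<le> (?e * (C * exp (- \<gamma> * r))) * exp ((\<gamma> - \<sigma>) * s)"
      by (simp add: mult.assoc)
    have "norm (?e *\<^sub>R V r s (g s)) = exp (- \<gamma> * (t - s)) * (exp (\<gamma> * (r - s)) * norm (V r s (g s)))"
      by (simp add: exp_add[symmetric] algebra_simps flip: mult.assoc)
    also have "\<dots> \<le> exp (- \<gamma> * (t - s)) * nV s (g s)"
      using r s by (intro mult_left_mono V_le_nV) auto
    also have "\<dots> \<le> \<phi> s" by (rule \<phi>[OF s])
    finally show "norm (?e *\<^sub>R V r s (g s)) \<le> \<phi> s" .
  qed auto
  then show "?e * norm (V r t (integral {..t} (\<lambda>s. V t s (g s)))) \<le> \<Psi> t"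
    by (simp add: V_integral_atMost[OF g bd \<open>\<sigma> < \<gamma>\<close> r])
qed

end

subsection \<open>The Lyapunov--Perron equation\<close>

lemma DERIV_exp_affine:
  fixes A c d :: real
  assumes "c \<noteq> 0"
  shows "((\<lambda>s. A / c * exp (c * s + d)) has_real_derivative A * exp (c * s + d)) (at s)"
  using assms by (auto intro!: derivative_eq_intros)

text \<open>The slope k is a parameter together with its equation: \<open>slope_exists\<close>
  depends on \<Gamma> and the constants alone, so k can be supplied when the locale is
  interpreted.\<close>

locale perturbed_split = exp_split L Q M \<gamma> \<rho> + admissible \<Gamma>
  for L :: "real \<Rightarrow> real \<Rightarrow> 'a::banach \<Rightarrow>\<^sub>L 'a" and Q M \<gamma> \<rho> \<Gamma> +
  fixes f :: "real \<Rightarrow> 'a \<Rightarrow> 'a" and L1 L2 \<sigma> k :: real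
  assumes f_cont: "continuous_on UNIV (\<lambda>(t, u). f t u)"
    and f_zero: "f t 0 = 0"
    and L1_pos: "0 < L1" and L2_pos: "0 < L2"
    and lip_N: "N_norm L Q \<rho> t (Q t (f t u - f t v)) \<le> L1 * Gamma_norm \<Gamma> L Q \<gamma> \<rho> t (u - v)"
    and lip_S: "S_norm L \<gamma> t ((id_blinfun - Q t) (f t u - f t v)) \<le> L2 * Gamma_norm \<Gamma> L Q \<gamma> \<rho> t (u - v)"
    and sigma: "\<sigma> \<in> {\<rho><..<\<gamma>}"
    and gap: "\<Gamma> (L1 / (\<sigma> - \<rho>), L2 / (\<gamma> - \<sigma>)) < 1"
    and k_pos: "0 < k" and k_less: "k < L2 / L1 * ((\<sigma> - \<rho>) / (\<gamma> - \<sigma>))"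
    and k_eq: "\<gamma> - \<rho> = L1 * \<Gamma> (1, k) + L2 * \<Gamma> (1 / k, 1)"
begin

definition nG :: "real \<Rightarrow> 'a \<Rightarrow> real" where "nG = Gamma_norm \<Gamma> L Q \<gamma> \<rho>"

lemma nG_alt: "nG t x = \<Gamma> (nU t x, nV t x)"
  by (simp add: nG_def Gamma_norm_def nU_def nV_def)

lemma sigma_less_gamma: "\<sigma> < \<gamma>"
  using sigma by auto

definition \<mu> :: real where "\<mu> = \<rho> + L1 * \<Gamma> (1, k)"

lemma rho_less_mu: "\<rho> < \<mu>"
  using L1_pos Gamma_pos[of 1 k] by (simp add: \<mu>_def)

lemma mu_less_sigma: "\<mu> < \<sigma>"
proof -
  have "L1 * \<Gamma> (1, k) \<le> L1 * \<Gamma> (1, L2 / L1 * ((\<sigma> - \<rho>) / (\<gamma> - \<sigma>)))"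
    using L1_pos k_pos k_less by (intro mult_left_mono Gamma_mono) auto
  also have "\<dots> < \<sigma> - \<rho>"
    by (rule gap_at_slope(2)[OF L1_pos L2_pos sigma gap refl])
  finally show ?thesis by (simp add: \<mu>_def)
qed

text \<open>Together with \<mu> - \<rho> = L1 \<Gamma> (1, k) this splits the slope equation into
  one equation per component: integrating a difference of size \<Gamma> (1, k) exp (- \<mu> (t -
  \<tau>)) against the kernels produces the coefficients 1 and k.\<close>

lemma gamma_minus_mu: "\<gamma> - \<mu> = L2 * \<Gamma> (1, k) / k"
  using k_eq Gamma_mult[of "1 / k" 1 k] k_pos by (simp add: \<mu>_def)

lemma nU_lip: "nU t (f t u - f t v) \<le> L1 * nG t (u - v)"
  using lip_N by (simp add: nU_def nG_def)

lemma nV_lip: "nV t (f t u - f t v) \<le> L2 * nG t (u - v)"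
  using lip_S by (simp add: nV_def nG_def blinfun.diff_left)

lemma nG_nonneg: "0 \<le> nG t x"
  by (simp add: nG_alt Gamma_nonneg)

lemma nG_0: "nG t 0 = 0"
  using Gamma_eq_0[of "(0, 0)"] by (simp add: nG_alt nU_0 nV_0 zero_prod_def)

lemma nG_add: "nG t (x + y) \<le> nG t x + nG t y"
proof -
  have "nG t (x + y) \<le> \<Gamma> (nU t x + nU t y, nV t x + nV t y)"
    unfolding nG_alt by (intro Gamma_mono nU_nonneg nV_nonneg nU_add nV_add)
  also have "\<dots> \<le> nG t x + nG t y" unfolding nG_alt by (rule Gamma_add_pair)
  finally show ?thesis .
qed

lemma nG_minus: "nG t (x - y) = nG t (y - x)"
  by (simp add: nG_alt nU_minus[of t x y] nV_minus[of t x y])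

lemma nG_triangle: "nG t (x - z) \<le> nG t (x - y) + nG t (y - z)"
  using nG_add[of t "x - y" "y - z"] by simp

lemma nG_diff: "nG t (x - y) \<le> nG t x + nG t y"
  using nG_triangle[of t x y 0] nG_minus[of t y 0] by simp

lemma nG_le: "nG t x \<le> M * \<Gamma> (1, 1) * norm x"
proof -
  have "nG t x \<le> \<Gamma> (M * norm x, M * norm x)"
    unfolding nG_alt by (intro Gamma_mono nU_nonneg nV_nonneg nU_le nV_le)
  also have "\<dots> = M * \<Gamma> (1, 1) * norm x"
    using Gamma_mult[of "M * norm x" 1 1] M_ge_1 by (simp add: mult_ac)
  finally show ?thesis .
qed

definition cG :: real where "cG = 1 / \<Gamma> (1, 0) + 1 / \<Gamma> (0, 1)"

lemma cG_nonneg: "0 \<le> cG"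
  by (simp add: cG_def Gamma_nonneg)

lemma norm_le_nG: "norm x \<le> cG * nG t x"
proof -
  have "nU t x \<le> nG t x / \<Gamma> (1, 0)" "nV t x \<le> nG t x / \<Gamma> (0, 1)"
    using le_Gamma_fst[OF nU_nonneg nV_nonneg, of t x t x] le_Gamma_snd[OF nU_nonneg nV_nonneg, of t x t x]
      Gamma_pos[of 1 0] Gamma_pos[of 0 1] by (simp_all add: nG_alt pos_le_divide_eq)
  then show ?thesis
    using norm_le_nU_nV[of x t] by (simp add: cG_def field_simps)
qed

definition q :: real where "q = \<Gamma> (L1 / (\<sigma> - \<rho>), L2 / (\<gamma> - \<sigma>))"

lemma q_bounds: "0 \<le> q" "q < 1"
  using gap by (auto simp: q_def Gamma_nonneg)

lemma continuous_f_comp: "continuous_on S z \<Longrightarrow> continuous_on S (\<lambda>s. f s (z s))"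
  using continuous_on_compose2[OF f_cont, of S "\<lambda>s. (s, z s)"]
  by (simp add: continuous_on_Pair)

text \<open>The forcing g stands for f along z. Keeping it as an argument makes the map linear in
  \<eta> and g, so a difference of two solutions is again of this form
  (\<open>LP_diff\<close>).\<close>

definition LP :: "real \<Rightarrow> 'a \<Rightarrow> (real \<Rightarrow> 'a) \<Rightarrow> real \<Rightarrow> 'a" where
  "LP \<tau> \<eta> g t = U t \<tau> \<eta> - integral {t..\<tau>} (\<lambda>s. U t s (g s)) + integral {..t} (\<lambda>s. V t s (g s))"

text \<open>The growth bound concerns \<open>nV\<close> alone because only the V-integral extends to
  -infinity.\<close>

definition forcing :: "real \<Rightarrow> (real \<Rightarrow> 'a) \<Rightarrow> bool" where
  "forcing \<tau> g \<longleftrightarrow> continuous_on {..\<tau>} g \<and> (\<exists>C. \<forall>s\<le>\<tau>. nV s (g s) \<le> C * exp (- \<sigma> * s))"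

lemma forcingE:
  assumes "forcing \<tau> g"
  obtains C where "continuous_on {..\<tau>} g" "\<And>s. s \<le> \<tau> \<Longrightarrow> nV s (g s) \<le> C * exp (- \<sigma> * s)"
  using assms unfolding forcing_def by blast

lemma forcing_mono: "forcing \<tau> g \<Longrightarrow> t \<le> \<tau> \<Longrightarrow> forcing t g"
  unfolding forcing_def by (auto intro: continuous_on_subset order_trans)

lemma forcing_integrable: "forcing t g \<Longrightarrow> (\<lambda>s. V t s (g s)) integrable_on {..t}"
  by (elim forcingE V_integrable_atMost(1)[OF _ _ sigma_less_gamma order_refl])

lemma Q_LP:
  assumes "forcing \<tau> g" "t \<le> \<tau>"
  shows "Q t (LP \<tau> \<eta> g t) = U t \<tau> \<eta> - integral {t..\<tau>} (\<lambda>s. U t s (g s))"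
proof -
  obtain C where g: "continuous_on {..t} g" and bd: "\<And>s. s \<le> t \<Longrightarrow> nV s (g s) \<le> C * exp (- \<sigma> * s)"
    using forcingE[OF forcing_mono[OF assms]] by metis
  have g': "continuous_on {t..\<tau>} g"
    using assms unfolding forcing_def by (auto intro: continuous_on_subset)
  have "Q t (integral {t..\<tau>} (\<lambda>s. U t s (g s))) = integral {t..\<tau>} (\<lambda>s. U t s (g s))"
    using U_integral[OF g', of t t] by (metis Q_U U_refl)
  then show ?thesis
    using Q_V_integral_atMost[OF g bd sigma_less_gamma]
    by (simp add: LP_def blinfun.add_right blinfun.diff_right Q_U)
qed

lemma LP_minus_Q:
  assumes "forcing \<tau> g" "t \<le> \<tau>"
  shows "LP \<tau> \<eta> g t - Q t (LP \<tau> \<eta> g t) = integral {..t} (\<lambda>s. V t s (g s))"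
  unfolding Q_LP[OF assms] by (simp add: LP_def)

lemma LP_diff:
  assumes "forcing \<tau> g" "forcing \<tau> g'" "t \<le> \<tau>"
  shows "LP \<tau> \<eta> g t - LP \<tau> \<eta>' g' t = LP \<tau> (\<eta> - \<eta>') (\<lambda>s. g s - g' s) t"
proof -
  have c: "continuous_on {t..\<tau>} g" "continuous_on {t..\<tau>} g'"
    using assms unfolding forcing_def by (auto intro: continuous_on_subset)
  have "integral {t..\<tau>} (\<lambda>s. U t s (g s - g' s))
    = integral {t..\<tau>} (\<lambda>s. U t s (g s)) - integral {t..\<tau>} (\<lambda>s. U t s (g' s))"
    unfolding U_diff by (intro integral_diff integrable_continuous_real continuous_U_integrand c)
  moreover have "integral {..t} (\<lambda>s. V t s (g s - g' s))
    = integral {..t} (\<lambda>s. V t s (g s)) - integral {..t} (\<lambda>s. V t s (g' s))"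
    unfolding V_diff by (intro integral_diff forcing_integrable forcing_mono[OF _ assms(3)] assms)
  ultimately show ?thesis by (simp add: LP_def U_diff)
qed

lemma continuous_LP:
  assumes "forcing \<tau> g"
  shows "continuous_on {..\<tau>} (LP \<tau> \<eta> g)"
  unfolding LP_def[abs_def]
  using assms
  by (elim forcingE)
    (intro continuous_on_add continuous_on_diff continuous_U_fst continuous_U_integral
      continuous_V_integral_atMost[OF _ _ sigma_less_gamma])

text \<open>\<alpha> is the coefficient of the principal part at rate \<mu>, \<beta> that of the
  error at rate \<sigma>. In the estimate of \<open>nU\<close> the negative term at rate \<rho>
  belonging to \<alpha> has to be kept: with the right \<alpha> it cancels the contribution of
  \<eta>.\<close>

lemma LP_bound:
  assumes g: "continuous_on {..\<tau>} g" and "0 \<le> \<alpha>" "0 \<le> \<beta>"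
    and gU: "\<And>s. s \<le> \<tau> \<Longrightarrow> nU s (g s) \<le> L1 * (\<alpha> * exp (- \<mu> * (s - \<tau>)) + \<beta> * exp (- \<sigma> * (s - \<tau>)))"
    and gV: "\<And>s. s \<le> \<tau> \<Longrightarrow> nV s (g s) \<le> L2 * (\<alpha> * exp (- \<mu> * (s - \<tau>)) + \<beta> * exp (- \<sigma> * (s - \<tau>)))"
  shows "forcing \<tau> g"
    and "t \<le> \<tau> \<Longrightarrow> nU t (LP \<tau> \<eta> g t) \<le> exp (- \<rho> * (t - \<tau>)) * nU \<tau> \<eta>
        + L1 * \<alpha> / (\<mu> - \<rho>) * (exp (- \<mu> * (t - \<tau>)) - exp (- \<rho> * (t - \<tau>)))
        + L1 * \<beta> / (\<sigma> - \<rho>) * exp (- \<sigma> * (t - \<tau>))"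
    and "t \<le> \<tau> \<Longrightarrow> nV t (LP \<tau> \<eta> g t)
        \<le> L2 * \<alpha> / (\<gamma> - \<mu>) * exp (- \<mu> * (t - \<tau>)) + L2 * \<beta> / (\<gamma> - \<sigma>) * exp (- \<sigma> * (t - \<tau>))"
proof -
  note rl = rho_less_mu and ls = mu_less_sigma and sg = sigma_less_gamma
  define C where "C = L2 * (\<alpha> + \<beta>) * exp (\<sigma> * \<tau>)"
  have bd: "nV s (g s) \<le> C * exp (- \<sigma> * s)" if "s \<le> \<tau>" for s
  proof -
    have "exp (- \<mu> * (s - \<tau>)) \<le> exp (- \<sigma> * (s - \<tau>))"
      using ls that by (simp add: mult_right_mono_neg)
    then have "\<alpha> * exp (- \<mu> * (s - \<tau>)) + \<beta> * exp (- \<sigma> * (s - \<tau>)) \<le> (\<alpha> + \<beta>) * exp (- \<sigma> * (s - \<tau>))"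
      using \<open>0 \<le> \<alpha>\<close> by (simp add: distrib_right mult_left_mono)
    then have "L2 * (\<alpha> * exp (- \<mu> * (s - \<tau>)) + \<beta> * exp (- \<sigma> * (s - \<tau>))) \<le> L2 * ((\<alpha> + \<beta>) * exp (- \<sigma> * (s - \<tau>)))"
      using L2_pos by simp
    also have "\<dots> = C * exp (- \<sigma> * s)"
      by (simp add: C_def algebra_simps flip: exp_add)
    finally show ?thesis using gV[OF that] by linarith
  qed
  with g show fo: "forcing \<tau> g" unfolding forcing_def by blast
  assume t: "t \<le> \<tau>"
  show "nU t (LP \<tau> \<eta> g t) \<le> exp (- \<rho> * (t - \<tau>)) * nU \<tau> \<eta>
        + L1 * \<alpha> / (\<mu> - \<rho>) * (exp (- \<mu> * (t - \<tau>)) - exp (- \<rho> * (t - \<tau>)))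
        + L1 * \<beta> / (\<sigma> - \<rho>) * exp (- \<sigma> * (t - \<tau>))"
  proof -
    let ?I = "integral {t..\<tau>} (\<lambda>s. U t s (g s))"
    define \<phi> where "\<phi> s = exp (\<rho> * (s - t)) * (L1 * (\<alpha> * exp (- \<mu> * (s - \<tau>)) + \<beta> * exp (- \<sigma> * (s - \<tau>))))" for s
    define \<Psi> where "\<Psi> s = L1 * \<alpha> / (\<rho> - \<mu>) * exp ((\<rho> - \<mu>) * s + (\<mu> * \<tau> - \<rho> * t))
      + L1 * \<beta> / (\<rho> - \<sigma>) * exp ((\<rho> - \<sigma>) * s + (\<sigma> * \<tau> - \<rho> * t))" for s
    have "nU t ?I \<le> \<Psi> \<tau> - \<Psi> t"
    proof (rule nU_integral_le[OF t])
      show "continuous_on {t..\<tau>} g" by (rule continuous_on_subset[OF g]) auto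
      show "exp (\<rho> * (s - t)) * nU s (g s) \<le> \<phi> s" if "s \<in> {t..\<tau>}" for s
        unfolding \<phi>_def using that by (intro mult_left_mono gU) auto
      have \<phi>_eq: "\<phi> s = L1 * \<alpha> * exp ((\<rho> - \<mu>) * s + (\<mu> * \<tau> - \<rho> * t))
          + L1 * \<beta> * exp ((\<rho> - \<sigma>) * s + (\<sigma> * \<tau> - \<rho> * t))" for s
        unfolding \<phi>_def by (simp add: algebra_simps flip: exp_add)
      show "(\<Psi> has_real_derivative \<phi> s) (at s)" for s
        unfolding \<Psi>_def \<phi>_eq using rl ls by (intro DERIV_add DERIV_exp_affine) auto
    qed
    also have "\<Psi> \<tau> - \<Psi> t = L1 * \<alpha> / (\<mu> - \<rho>) * (exp (- \<mu> * (t - \<tau>)) - exp (- \<rho> * (t - \<tau>)))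
        + L1 * \<beta> / (\<sigma> - \<rho>) * (exp (- \<sigma> * (t - \<tau>)) - exp (- \<rho> * (t - \<tau>)))"
    proof -
      have 2: "x / (\<rho> - l) = - (x / (l - \<rho>))" for x l :: real
        by (metis minus_diff_eq minus_divide_right)
      show ?thesis
        unfolding \<Psi>_def 2 by (simp add: algebra_simps)
    qed
    \<comment> \<open>Only the error term may be enlarged here; its negative part is
      discarded.\<close>
    also have "\<dots> \<le> L1 * \<alpha> / (\<mu> - \<rho>) * (exp (- \<mu> * (t - \<tau>)) - exp (- \<rho> * (t - \<tau>)))
        + L1 * \<beta> / (\<sigma> - \<rho>) * exp (- \<sigma> * (t - \<tau>))"
      using L1_pos \<open>0 \<le> \<beta>\<close> rl ls by (intro add_left_mono mult_left_mono) auto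
    finally have I: "nU t ?I \<le> \<dots>" .
    have QI: "Q t ?I = ?I"
      using U_integral[OF continuous_on_subset[OF g], of t \<tau> t t] by (metis Icc_subset_Iic_iff Q_U U_refl order_refl)
    have "nU t (LP \<tau> \<eta> g t) = nU t (U t \<tau> \<eta> - ?I)"
      by (rule nU_cong) (simp add: Q_LP[OF fo t] blinfun.diff_right Q_U QI)
    also have "\<dots> \<le> nU t (U t \<tau> \<eta>) + nU t ?I"
      using nU_add[of t "U t \<tau> \<eta>" "- ?I"] nU_minus[of t 0 ?I] by simp
    also have "nU t (U t \<tau> \<eta>) \<le> exp (- \<rho> * (t - \<tau>)) * nU \<tau> \<eta>" by (rule nU_U[OF t])
    finally show ?thesis using I by simp
  qed
  show "nV t (LP \<tau> \<eta> g t)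
        \<le> L2 * \<alpha> / (\<gamma> - \<mu>) * exp (- \<mu> * (t - \<tau>)) + L2 * \<beta> / (\<gamma> - \<sigma>) * exp (- \<sigma> * (t - \<tau>))"
  proof -
    let ?I = "integral {..t} (\<lambda>s. V t s (g s))"
    define \<phi> where "\<phi> s = exp (- \<gamma> * (t - s)) * (L2 * (\<alpha> * exp (- \<mu> * (s - \<tau>)) + \<beta> * exp (- \<sigma> * (s - \<tau>))))" for s
    define \<Psi> where "\<Psi> s = L2 * \<alpha> / (\<gamma> - \<mu>) * exp ((\<gamma> - \<mu>) * s + (\<mu> * \<tau> - \<gamma> * t))
      + L2 * \<beta> / (\<gamma> - \<sigma>) * exp ((\<gamma> - \<sigma>) * s + (\<sigma> * \<tau> - \<gamma> * t))" for s
    have gt: "continuous_on {..t} g" by (rule continuous_on_subset[OF g]) (use t in auto)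
    have "nV t ?I \<le> \<Psi> t"
    proof (rule nV_integral_atMost_le[OF gt _ sg])
      show "nV s (g s) \<le> C * exp (- \<sigma> * s)" if "s \<le> t" for s using that t bd by simp
      show "exp (- \<gamma> * (t - s)) * nV s (g s) \<le> \<phi> s" if "s \<le> t" for s
        unfolding \<phi>_def using that t by (intro mult_left_mono gV) auto
      have \<phi>_eq: "\<phi> s = L2 * \<alpha> * exp ((\<gamma> - \<mu>) * s + (\<mu> * \<tau> - \<gamma> * t))
          + L2 * \<beta> * exp ((\<gamma> - \<sigma>) * s + (\<sigma> * \<tau> - \<gamma> * t))" for s
        unfolding \<phi>_def by (simp add: algebra_simps flip: exp_add)
      show "(\<Psi> has_real_derivative \<phi> s) (at s)" for s
        unfolding \<Psi>_def \<phi>_eq using sg ls by (intro DERIV_add DERIV_exp_affine) auto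
      show "0 \<le> \<Psi> s" for s
        unfolding \<Psi>_def using assms(2,3) L2_pos sg ls by (intro add_nonneg_nonneg mult_nonneg_nonneg) auto
    qed
    moreover have "nV t (LP \<tau> \<eta> g t) = nV t ?I"
      by (rule nV_cong)
        (simp add: LP_minus_Q[OF fo t] Q_V_integral_atMost[OF gt bd[OF order_trans[OF _ t]] sg])
    moreover have "\<Psi> t = L2 * \<alpha> / (\<gamma> - \<mu>) * exp (- \<mu> * (t - \<tau>)) + L2 * \<beta> / (\<gamma> - \<sigma>) * exp (- \<sigma> * (t - \<tau>))"
      unfolding \<Psi>_def by (simp add: algebra_simps)
    ultimately show ?thesis by simp
  qed
qed

text \<open>The weighted space without extensionality: values beyond \<tau> are free, so global
  solutions qualify as they stand.\<close>

definition growth :: "real \<Rightarrow> (real \<Rightarrow> 'a) \<Rightarrow> bool" where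
  "growth \<tau> z \<longleftrightarrow> continuous_on {..\<tau>} z \<and> (\<exists>C\<ge>0. \<forall>t\<le>\<tau>. nG t (z t) \<le> C * exp (- \<sigma> * (t - \<tau>)))"

lemma growthE:
  assumes "growth \<tau> z"
  obtains C where "continuous_on {..\<tau>} z" "0 \<le> C" "\<And>t. t \<le> \<tau> \<Longrightarrow> nG t (z t) \<le> C * exp (- \<sigma> * (t - \<tau>))"
  using assms unfolding growth_def by blast

lemma growth_forcing:
  assumes "growth \<tau> z"
  shows "forcing \<tau> (\<lambda>s. f s (z s))"
proof -
  obtain C where C: "continuous_on {..\<tau>} z" "0 \<le> C" "\<And>t. t \<le> \<tau> \<Longrightarrow> nG t (z t) \<le> C * exp (- \<sigma> * (t - \<tau>))"
    using growthE[OF assms] by metis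
  show ?thesis
  proof (rule LP_bound(1)[of _ _ 0 C])
    show "nU s (f s (z s)) \<le> L1 * (0 * exp (- \<mu> * (s - \<tau>)) + C * exp (- \<sigma> * (s - \<tau>)))" if "s \<le> \<tau>" for s
      using order_trans[OF nU_lip[of s "z s" 0] mult_left_mono[OF _ less_imp_le[OF L1_pos]]] C(3)[OF that]
      by (simp add: f_zero)
    show "nV s (f s (z s)) \<le> L2 * (0 * exp (- \<mu> * (s - \<tau>)) + C * exp (- \<sigma> * (s - \<tau>)))" if "s \<le> \<tau>" for s
      using order_trans[OF nV_lip[of s "z s" 0] mult_left_mono[OF _ less_imp_le[OF L2_pos]]] C(3)[OF that]
      by (simp add: f_zero)
  qed (use C continuous_f_comp in auto)
qed

lemma growth_0: "growth \<tau> (\<lambda>_. 0)"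
  unfolding growth_def by (auto simp: nG_0 intro!: exI[of _ 0])

text \<open>One application of the equation reproduces the principal part, whose components are a
  and k a, while the error coefficient \<beta> turns into q \<beta>.\<close>

lemma LP_step:
  assumes z: "growth \<tau> z" "growth \<tau> z'" and \<beta>: "0 \<le> \<beta>" and a: "a = nU \<tau> (\<eta> - \<eta>')"
    and le: "\<And>s. s \<le> \<tau> \<Longrightarrow> nG s (z s - z' s) \<le> \<Gamma> (1, k) * a * exp (- \<mu> * (s - \<tau>)) + \<beta> * exp (- \<sigma> * (s - \<tau>))"
    and w: "w = LP \<tau> \<eta> (\<lambda>s. f s (z s)) t - LP \<tau> \<eta>' (\<lambda>s. f s (z' s)) t" and t: "t \<le> \<tau>"
  shows "nU t w \<le> a * exp (- \<mu> * (t - \<tau>)) + L1 / (\<sigma> - \<rho>) * \<beta> * exp (- \<sigma> * (t - \<tau>))"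
    and "nV t w \<le> k * a * exp (- \<mu> * (t - \<tau>)) + L2 / (\<gamma> - \<sigma>) * \<beta> * exp (- \<sigma> * (t - \<tau>))"
    and "nG t w \<le> \<Gamma> (1, k) * a * exp (- \<mu> * (t - \<tau>)) + q * \<beta> * exp (- \<sigma> * (t - \<tau>))"
proof -
  have a0: "0 \<le> a" by (simp add: a nU_nonneg)
  let ?g = "\<lambda>s. f s (z s) - f s (z' s)"
  have w': "w = LP \<tau> (\<eta> - \<eta>') ?g t"
    unfolding w by (rule LP_diff[OF z[THEN growth_forcing] t])
  have g: "continuous_on {..\<tau>} ?g"
    using z by (auto intro!: continuous_intros continuous_f_comp simp: growth_def)
  have gU: "nU s (?g s) \<le> L1 * (\<Gamma> (1, k) * a * exp (- \<mu> * (s - \<tau>)) + \<beta> * exp (- \<sigma> * (s - \<tau>)))" if "s \<le> \<tau>" for s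
    by (rule order_trans[OF nU_lip mult_left_mono[OF le[OF that]]]) (use L1_pos in simp)
  have gV: "nV s (?g s) \<le> L2 * (\<Gamma> (1, k) * a * exp (- \<mu> * (s - \<tau>)) + \<beta> * exp (- \<sigma> * (s - \<tau>)))" if "s \<le> \<tau>" for s
    by (rule order_trans[OF nV_lip mult_left_mono[OF le[OF that]]]) (use L2_pos in simp)
  have \<alpha>: "0 \<le> \<Gamma> (1, k) * a" using a0 by (simp add: Gamma_nonneg)
  have \<Gamma>pos: "0 < \<Gamma> (1, k)" by (rule Gamma_pos) simp
  \<comment> \<open>The two halves of the slope equation. The first makes the terms at rate \<rho>
    cancel; the second says that the stable component is k times the other one.\<close>
  have eq: "L1 * (\<Gamma> (1, k) * a) / (\<mu> - \<rho>) = a" "L2 * (\<Gamma> (1, k) * a) / (\<gamma> - \<mu>) = k * a"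
    using \<Gamma>pos L1_pos L2_pos k_pos by (simp_all add: gamma_minus_mu) (simp add: \<mu>_def)
  show U: "nU t w \<le> a * exp (- \<mu> * (t - \<tau>)) + L1 / (\<sigma> - \<rho>) * \<beta> * exp (- \<sigma> * (t - \<tau>))"
    using LP_bound(2)[OF g \<alpha> \<beta> gU gV t, of "\<eta> - \<eta>'"] unfolding eq w' a[symmetric]
    by (simp add: algebra_simps)
  show V: "nV t w \<le> k * a * exp (- \<mu> * (t - \<tau>)) + L2 / (\<gamma> - \<sigma>) * \<beta> * exp (- \<sigma> * (t - \<tau>))"
    using LP_bound(3)[OF g \<alpha> \<beta> gU gV t, of "\<eta> - \<eta>'"] unfolding eq w' a[symmetric]
    by (simp add: algebra_simps)
  let ?e = "exp (- \<mu> * (t - \<tau>))" and ?d = "exp (- \<sigma> * (t - \<tau>))"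
  have "nG t w \<le> \<Gamma> (a * ?e + L1 / (\<sigma> - \<rho>) * \<beta> * ?d, k * a * ?e + L2 / (\<gamma> - \<sigma>) * \<beta> * ?d)"
    unfolding nG_alt by (intro Gamma_mono nU_nonneg nV_nonneg U V)
  \<comment> \<open>The triangle inequality separates the two rates. Each pair is then a multiple of
    a fixed one, namely (1, k) and the pair in the gap condition.\<close>
  also have "\<dots> \<le> \<Gamma> ((a * ?e) * 1, (a * ?e) * k) + \<Gamma> ((\<beta> * ?d) * (L1 / (\<sigma> - \<rho>)), (\<beta> * ?d) * (L2 / (\<gamma> - \<sigma>)))"
    by (rule order_trans[OF _ Gamma_add_pair]) (simp add: mult_ac)
  also have "\<dots> = \<Gamma> (1, k) * a * ?e + q * \<beta> * ?d"
    using a0 \<beta> by (subst (1 2) Gamma_mult) (auto simp: q_def)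
  finally show "nG t w \<le> \<Gamma> (1, k) * a * ?e + q * \<beta> * ?d" .
qed

section \<open>Comparison, uniqueness and existence for the Lyapunov-Perron equation\<close>

definition LP_solution :: "real \<Rightarrow> 'a \<Rightarrow> (real \<Rightarrow> 'a) \<Rightarrow> bool" where
  "LP_solution \<tau> \<eta> z \<longleftrightarrow> growth \<tau> z \<and> (\<forall>t\<le>\<tau>. z t = LP \<tau> \<eta> (\<lambda>s. f s (z s)) t)"

text \<open>The functions \<open>exp (- \<mu> (t - \<tau>))\<close> and \<open>k exp (- \<mu> (t - \<tau>))\<close> solve the scalar equations
  that bound the two parts of a difference of solutions; iterating \<open>LP_step\<close> removes the error term,
  which shrinks by the factor \<open>q < 1\<close> in each step.\<close>

lemma LP_solution_compare:
  assumes z: "LP_solution \<tau> \<eta> z" "LP_solution \<tau> \<eta>' z'" and t: "t \<le> \<tau>"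
  shows "nU t (z t - z' t) \<le> nU \<tau> (\<eta> - \<eta>') * exp (- \<mu> * (t - \<tau>))"
    and "nV t (z t - z' t) \<le> k * nU \<tau> (\<eta> - \<eta>') * exp (- \<mu> * (t - \<tau>))"
proof -
  define a where "a = nU \<tau> (\<eta> - \<eta>')"
  have a0: "0 \<le> a" by (simp add: a_def nU_nonneg)
  have gr: "growth \<tau> z" "growth \<tau> z'" using z by (auto simp: LP_solution_def)
  obtain C where C: "0 \<le> C" "\<And>t. t \<le> \<tau> \<Longrightarrow> nG t (z t) \<le> C * exp (- \<sigma> * (t - \<tau>))"
    using growthE[OF gr(1)] by metis
  obtain C' where C': "0 \<le> C'" "\<And>t. t \<le> \<tau> \<Longrightarrow> nG t (z' t) \<le> C' * exp (- \<sigma> * (t - \<tau>))"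
    using growthE[OF gr(2)] by metis
  have eq: "z t - z' t = LP \<tau> \<eta> (\<lambda>s. f s (z s)) t - LP \<tau> \<eta>' (\<lambda>s. f s (z' s)) t" if "t \<le> \<tau>" for t
    using z that by (simp add: LP_solution_def)
  have it: "nG t (z t - z' t) \<le> \<Gamma> (1, k) * a * exp (- \<mu> * (t - \<tau>)) + (q ^ n * (C + C')) * exp (- \<sigma> * (t - \<tau>))"
    if "t \<le> \<tau>" for t n
    using that
  proof (induction n arbitrary: t)
    case 0
    have "nG t (z t - z' t) \<le> (C + C') * exp (- \<sigma> * (t - \<tau>))"
      using nG_diff[of t "z t" "z' t"] C(2)[OF 0] C'(2)[OF 0] by (simp add: distrib_right)
    moreover have "0 \<le> \<Gamma> (1, k) * a * exp (- \<mu> * (t - \<tau>))" using a0 by (simp add: Gamma_nonneg)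
    ultimately show ?case by simp
  next
    case (Suc n)
    show ?case
      using LP_step(3)[OF gr _ a_def Suc.IH eq[OF Suc.prems] Suc.prems] C C' q_bounds
      by (simp add: mult.assoc)
  qed
  have "nG t (z t - z' t) \<le> \<Gamma> (1, k) * a * exp (- \<mu> * (t - \<tau>)) + 0 * exp (- \<sigma> * (t - \<tau>))" if "t \<le> \<tau>" for t
  proof (rule tendsto_lowerbound)
    have "(\<lambda>n. \<Gamma> (1, k) * a * exp (- \<mu> * (t - \<tau>)) + (q ^ n * (C + C')) * exp (- \<sigma> * (t - \<tau>)))
        \<longlonglongrightarrow> \<Gamma> (1, k) * a * exp (- \<mu> * (t - \<tau>)) + (0 * (C + C')) * exp (- \<sigma> * (t - \<tau>))"
      by (intro tendsto_intros LIMSEQ_power_zero) (use q_bounds in simp)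
    then show "(\<lambda>n. \<Gamma> (1, k) * a * exp (- \<mu> * (t - \<tau>)) + (q ^ n * (C + C')) * exp (- \<sigma> * (t - \<tau>)))
        \<longlonglongrightarrow> \<Gamma> (1, k) * a * exp (- \<mu> * (t - \<tau>)) + 0 * exp (- \<sigma> * (t - \<tau>))" by simp
  qed (use it that in auto)
  from LP_step(1,2)[OF gr _ a_def this eq[OF t] t]
  show "nU t (z t - z' t) \<le> nU \<tau> (\<eta> - \<eta>') * exp (- \<mu> * (t - \<tau>))"
    "nV t (z t - z' t) \<le> k * nU \<tau> (\<eta> - \<eta>') * exp (- \<mu> * (t - \<tau>))"
    by (simp_all add: a_def)
qed

lemma LP_solution_unique:
  assumes "LP_solution \<tau> \<eta> z" "LP_solution \<tau> \<eta>' z'" "Q \<tau> \<eta> = Q \<tau> \<eta>'" "t \<le> \<tau>"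
  shows "z t = z' t"
proof -
  have "nU \<tau> (\<eta> - \<eta>') = 0"
    using nU_cong[of \<tau> "\<eta> - \<eta>'" 0] assms(3) by (simp add: blinfun.diff_right nU_0)
  then have "norm (z t - z' t) \<le> 0 + 0"
    using LP_solution_compare[OF assms(1,2,4)] norm_le_nU_nV[of "z t - z' t" t]
    by (metis add_mono add.right_neutral mult_zero_left mult_zero_right order_trans)
  then show ?thesis by simp
qed

text \<open>Since f t 0 = 0, the zero function solves the equation with \<eta> = 0.
  \<open>LP_step\<close> against it gives a growth bound, whose part at rate \<mu> is absorbed into
  rate \<sigma>.\<close>

lemma growth_LP:
  assumes "growth \<tau> z"
  shows "growth \<tau> (LP \<tau> \<eta> (\<lambda>s. f s (z s)))"
proof -
  obtain C where C: "0 \<le> C" "\<And>t. t \<le> \<tau> \<Longrightarrow> nG t (z t) \<le> C * exp (- \<sigma> * (t - \<tau>))"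
    using growthE[OF assms] by metis
  define D where "D = \<Gamma> (1, k) * nU \<tau> (\<eta> - 0) + q * C"
  have "nG t (LP \<tau> \<eta> (\<lambda>s. f s (z s)) t) \<le> D * exp (- \<sigma> * (t - \<tau>))" if t: "t \<le> \<tau>" for t
  proof -
    have LP0: "LP \<tau> 0 (\<lambda>s. f s 0) t = 0"
      by (simp add: LP_def U_0 V_0 f_zero)
    have "nG s (z s - 0) \<le> \<Gamma> (1, k) * nU \<tau> (\<eta> - 0) * exp (- \<mu> * (s - \<tau>)) + C * exp (- \<sigma> * (s - \<tau>))" if "s \<le> \<tau>" for s
      using C(2)[OF that] mult_nonneg_nonneg[OF mult_nonneg_nonneg[OF Gamma_nonneg[of "(1, k)"] nU_nonneg[of \<tau> \<eta>]] exp_ge_zero[of "- \<mu> * (s - \<tau>)"]]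
      by simp
    from LP_step(3)[OF assms growth_0 C(1) refl this refl t]
    have "nG t (LP \<tau> \<eta> (\<lambda>s. f s (z s)) t)
      \<le> \<Gamma> (1, k) * nU \<tau> (\<eta> - 0) * exp (- \<mu> * (t - \<tau>)) + q * C * exp (- \<sigma> * (t - \<tau>))"
      by (simp add: LP0)
    also have "exp (- \<mu> * (t - \<tau>)) \<le> exp (- \<sigma> * (t - \<tau>))"
      using mu_less_sigma t by (simp add: mult_right_mono_neg)
    finally show ?thesis
      by (simp add: D_def distrib_right mult_left_mono Gamma_nonneg nU_nonneg)
  qed
  moreover have "0 \<le> D" using C q_bounds by (simp add: D_def Gamma_nonneg nU_nonneg)
  ultimately show ?thesis
    unfolding growth_def using continuous_LP[OF growth_forcing[OF assms]] by blast
qed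

lemma LP_contraction:
  assumes "growth \<tau> z" "growth \<tau> z'" "0 \<le> \<beta>"
    and "\<And>s. s \<le> \<tau> \<Longrightarrow> nG s (z s - z' s) \<le> \<beta> * exp (- \<sigma> * (s - \<tau>))" and "t \<le> \<tau>"
  shows "nG t (LP \<tau> \<eta> (\<lambda>s. f s (z s)) t - LP \<tau> \<eta> (\<lambda>s. f s (z' s)) t) \<le> q * \<beta> * exp (- \<sigma> * (t - \<tau>))"
  using LP_step(3)[OF assms(1-3) refl _ refl assms(5), of \<eta> \<eta>] assms(4) by (simp add: nU_0)

text \<open>Picard iteration with limits taken pointwise in t. Completeness of the original norm
  suffices, because the adapted norms are equivalent to it uniformly in t; local uniformity of the
  convergence gives continuity of the limit.\<close>

lemma LP_solution_exists: "\<exists>z. LP_solution \<tau> \<eta> z"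
proof -
  define zz where "zz = rec_nat (\<lambda>_. 0) (\<lambda>_ z. LP \<tau> \<eta> (\<lambda>s. f s (z s)))"
  have zz_Suc: "zz (Suc n) = LP \<tau> \<eta> (\<lambda>s. f s (zz n s))" and zz_0: "zz 0 = (\<lambda>_. 0)" for n
    by (simp_all add: zz_def)
  have gr: "growth \<tau> (zz n)" for n
    by (induction n) (simp_all add: zz_0 zz_Suc growth_0 growth_LP del: zz_def)
  obtain D where D: "0 \<le> D" "\<And>t. t \<le> \<tau> \<Longrightarrow> nG t (zz 1 t) \<le> D * exp (- \<sigma> * (t - \<tau>))"
    using growthE[OF gr[of 1]] by metis
  have d: "nG t (zz (Suc n) t - zz n t) \<le> (q ^ n * D) * exp (- \<sigma> * (t - \<tau>))" if "t \<le> \<tau>" for n t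
    using that
  proof (induction n arbitrary: t)
    case 0
    then show ?case using D(2)[of t] by (simp add: zz_0)
  next
    case (Suc n)
    then show ?case
      using LP_contraction[OF gr gr _ Suc.IH Suc.prems, of \<eta>] D q_bounds
      unfolding zz_Suc[symmetric] by (simp add: mult.assoc)
  qed
  have "\<exists>l. \<forall>n. norm (l - zz n t) \<le> cG * D * exp (- \<sigma> * (t - \<tau>)) / (1 - q) * q ^ n" if t: "t \<le> \<tau>" for t
  proof (rule geometric_limit[OF q_bounds])
    show "norm (zz (Suc n) t - zz n t) \<le> cG * D * exp (- \<sigma> * (t - \<tau>)) * q ^ n" for n
      using order_trans[OF norm_le_nG mult_left_mono[OF d[OF t] cG_nonneg]] by (simp add: mult_ac)
  qed blast
  then obtain z where z: "\<And>t n. t \<le> \<tau> \<Longrightarrow> norm (z t - zz n t) \<le> cG * D * exp (- \<sigma> * (t - \<tau>)) / (1 - q) * q ^ n"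
    by metis
  \<comment> \<open>The detour through the original norm costs the factor \<open>cG\<close> on the
    way there and M \<Gamma> (1, 1) on the way back.\<close>
  define E where "E = M * \<Gamma> (1, 1) * (cG * D / (1 - q))"
  have E: "0 \<le> E" using M_ge_1 cG_nonneg D q_bounds by (simp add: E_def Gamma_nonneg)
  have zE: "nG t (z t - zz n t) \<le> (E * q ^ n) * exp (- \<sigma> * (t - \<tau>))" if "t \<le> \<tau>" for t n
  proof -
    have "nG t (z t - zz n t) \<le> M * \<Gamma> (1, 1) * (cG * D * exp (- \<sigma> * (t - \<tau>)) / (1 - q) * q ^ n)"
      using M_ge_1 by (intro order_trans[OF nG_le] mult_left_mono z that) (simp add: Gamma_nonneg)
    then show ?thesis by (simp add: E_def mult_ac)
  qed
  have lim0: "(\<lambda>n. C * q ^ n) \<longlonglongrightarrow> 0" for C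
    using tendsto_mult_right_zero[OF LIMSEQ_power_zero[of q]] q_bounds by simp
  have "continuous_on {..\<tau>} z"
  proof (rule continuous_on_atMost_if_Icc)
    fix a
    show "continuous_on {a..\<tau>} z"
    proof (rule uniform_limit_theorem)
      show "\<forall>\<^sub>F n in sequentially. continuous_on {a..\<tau>} (zz n)"
        using gr unfolding growth_def
        by (auto intro!: always_eventually continuous_on_subset[of "{..\<tau>}" "zz _" "{a..\<tau>}"])
      define B where "B = cG * D * exp (\<bar>\<sigma>\<bar> * \<bar>\<tau> - a\<bar>) / (1 - q)"
      show "uniform_limit {a..\<tau>} zz z sequentially"
      proof (rule uniform_limitI)
        fix e :: real assume "e > 0"
        have "\<forall>\<^sub>F n in sequentially. B * q ^ n < e"
          using lim0 \<open>e > 0\<close> by (rule order_tendstoD)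
        then show "\<forall>\<^sub>F n in sequentially. \<forall>t\<in>{a..\<tau>}. dist (zz n t) (z t) < e"
        proof eventually_elim
          case (elim n)
          show ?case
          proof
            fix t assume t: "t \<in> {a..\<tau>}"
            have "- \<sigma> * (t - \<tau>) \<le> \<bar>\<sigma>\<bar> * \<bar>t - \<tau>\<bar>" by (metis abs_ge_minus_self abs_mult mult_minus_left)
            also have "\<dots> \<le> \<bar>\<sigma>\<bar> * \<bar>\<tau> - a\<bar>" using t by (intro mult_left_mono) auto
            finally have "cG * D * exp (- \<sigma> * (t - \<tau>)) / (1 - q) * q ^ n \<le> B * q ^ n"
              unfolding B_def using cG_nonneg D q_bounds
              by (intro mult_right_mono divide_right_mono mult_left_mono) auto
            then show "dist (zz n t) (z t) < e"
              using z[of t n] t elim by (simp add: dist_norm norm_minus_commute)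
          qed
        qed
      qed
    qed simp
  qed
  moreover have "nG t (z t) \<le> E * exp (- \<sigma> * (t - \<tau>))" if "t \<le> \<tau>" for t
    using zE[OF that, of 0] by (simp add: zz_0)
  ultimately have gz: "growth \<tau> z" using E unfolding growth_def by blast
  have "z t = LP \<tau> \<eta> (\<lambda>s. f s (z s)) t" if t: "t \<le> \<tau>" for t
  proof -
    let ?P = "LP \<tau> \<eta> (\<lambda>s. f s (z s)) t"
    \<comment> \<open>Both the image of z and z itself lie within the error of order q ^ n of the
      iterate with index \<open>Suc n\<close>.\<close>
    have "nG t (?P - z t) \<le> 2 * E * exp (- \<sigma> * (t - \<tau>)) * q ^ n" for n
    proof -
      have "nG t (?P - zz (Suc n) t) \<le> q * (E * q ^ n) * exp (- \<sigma> * (t - \<tau>))"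
        unfolding zz_Suc by (rule LP_contraction[OF gz gr _ zE t]) (use E q_bounds in auto)
      moreover have "nG t (zz (Suc n) t - z t) \<le> q * (E * q ^ n) * exp (- \<sigma> * (t - \<tau>))"
        using zE[OF t, of "Suc n"] by (simp add: nG_minus[of t "z t"] mult_ac)
      moreover have "q * (E * q ^ n) * exp (- \<sigma> * (t - \<tau>)) \<le> E * q ^ n * exp (- \<sigma> * (t - \<tau>))"
        using q_bounds E by (intro mult_right_mono mult_left_le_one_le) auto
      moreover have "2 * E * exp (- \<sigma> * (t - \<tau>)) * q ^ n = 2 * (E * q ^ n * exp (- \<sigma> * (t - \<tau>)))" by simp
      ultimately show ?thesis using nG_triangle[of t ?P "z t" "zz (Suc n) t"] by linarith
    qed
    then have "nG t (?P - z t) \<le> 0"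
      by (intro tendsto_lowerbound[OF lim0[of "2 * E * exp (- \<sigma> * (t - \<tau>))"]]) auto
    then have "norm (?P - z t) \<le> 0"
      using order_trans[OF norm_le_nG mult_nonneg_nonpos[OF cG_nonneg]] by blast
    then show ?thesis by simp
  qed
  with gz show ?thesis unfolding LP_solution_def by blast
qed

end

subsection \<open>Solutions of the perturbed problem\<close>

lemma continuous_on_Icc_bounded:
  fixes z :: "real \<Rightarrow> 'b::real_normed_vector"
  assumes "continuous_on {a..b} z"
  obtains m where "\<And>t. t \<in> {a..b} \<Longrightarrow> norm (z t) \<le> m"
proof -
  have "bounded (z ` {a..b})"
    by (intro compact_imp_bounded compact_continuous_image assms) simp
  then obtain m where "\<forall>y\<in>z ` {a..b}. norm y \<le> m" by (auto simp: bounded_iff)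
  then show thesis using that[of m] by auto
qed

locale perturbed_process = perturbed_split L Q M \<gamma> \<rho> \<Gamma> f L1 L2 \<sigma> k
  for L :: "real \<Rightarrow> real \<Rightarrow> 'a::banach \<Rightarrow>\<^sub>L 'a" and Q M \<gamma> \<rho> \<Gamma> f L1 L2 \<sigma> k +
  fixes T :: "real \<Rightarrow> real \<Rightarrow> 'a \<Rightarrow> 'a"
  assumes proc: "evolution_process T"
    and vcf: "\<tau> \<le> t \<Longrightarrow> T t \<tau> \<eta> = L t \<tau> \<eta> + integral {\<tau>..t} (\<lambda>s. L t s (f s (T s \<tau> \<eta>)))"
begin

lemma T_refl: "T t t x = x"
  and T_comp: "\<tau> \<le> s \<Longrightarrow> s \<le> t \<Longrightarrow> T t s (T s \<tau> x) = T t \<tau> x"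
  and T_continuous: "continuous_on {\<tau>..} (\<lambda>t. T t \<tau> \<eta>)"
  using proc unfolding evolution_process_def by blast+

lemma L_locally_bounded:
  obtains B where "0 \<le> B" "\<And>t s x. a \<le> s \<Longrightarrow> s \<le> t \<Longrightarrow> t \<le> b \<Longrightarrow> norm (L t s x) \<le> B * norm x"
proof -
  obtain B where B: "0 \<le> B" "\<And>t s x. t \<in> {a..b} \<Longrightarrow> s \<in> {a..b} \<Longrightarrow> norm (U t s x) \<le> B * norm x"
    using U_locally_bounded by metis
  obtain B' where B': "0 \<le> B'" "\<And>t s x. a \<le> s \<Longrightarrow> s \<le> t \<Longrightarrow> t \<le> b \<Longrightarrow> norm (V t s x) \<le> B' * norm x"
    using V_locally_bounded by metis
  have "norm (L t s x) \<le> (B + B') * norm x" if "a \<le> s" "s \<le> t" "t \<le> b" for t s x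
    using norm_triangle_ineq[of "U t s x" "V t s x"] B(2)[of t s x] B'(2)[of s t x] that
    by (simp add: L_eq_U_plus_V distrib_right)
  then show thesis using that[of "B + B'"] B(1) B'(1) by simp
qed

text \<open>A Lipschitz constant of f in the original norm, uniform in time: a bound in the
  \<Gamma>-norm, multiplied by the constants of the norm equivalence.\<close>

definition Kf :: real where "Kf = cG * ((\<Gamma> (1, 0) * L1 + \<Gamma> (0, 1) * L2) * (M * \<Gamma> (1, 1)))"

lemma Kf_nonneg: "0 \<le> Kf"
  using cG_nonneg L1_pos L2_pos M_ge_1 by (simp add: Kf_def Gamma_nonneg)

lemma f_lipschitz: "norm (f t u - f t v) \<le> Kf * norm (u - v)"
proof -
  let ?d = "nG t (u - v)"
  have "nG t (f t u - f t v) \<le> \<Gamma> (L1 * ?d, L2 * ?d)"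
    unfolding nG_alt[of t "f t u - f t v"] by (intro Gamma_mono nU_nonneg nV_nonneg nU_lip nV_lip)
  also have "\<dots> \<le> (\<Gamma> (1, 0) * L1 + \<Gamma> (0, 1) * L2) * ?d"
    using Gamma_le_axes[of "L1 * ?d" "L2 * ?d"] L1_pos L2_pos nG_nonneg by (simp add: algebra_simps)
  also have "\<dots> \<le> (\<Gamma> (1, 0) * L1 + \<Gamma> (0, 1) * L2) * (M * \<Gamma> (1, 1) * norm (u - v))"
    using L1_pos L2_pos by (intro mult_left_mono nG_le) (simp add: Gamma_nonneg)
  finally show ?thesis
    using order_trans[OF norm_le_nG mult_left_mono[OF _ cG_nonneg]] unfolding Kf_def
    by (simp add: mult.assoc)
qed

text \<open>With the weight \<open>exp (2 C (t - a))\<close>, where \<open>C\<close> exceeds the Lipschitz constant of the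
  integrand, each application of the integral equation halves the bound on the difference.\<close>

lemma mild_solution_unique:
  assumes z: "continuous_on {a..b} z" "\<And>t. t \<in> {a..b} \<Longrightarrow> z t = L t a x + integral {a..t} (\<lambda>s. L t s (f s (z s)))"
    and z': "continuous_on {a..b} z'" "\<And>t. t \<in> {a..b} \<Longrightarrow> z' t = L t a x + integral {a..t} (\<lambda>s. L t s (f s (z' s)))"
    and t: "t \<in> {a..b}"
  shows "z t = z' t"
proof -
  obtain B where B: "0 \<le> B" "\<And>t s x. a \<le> s \<Longrightarrow> s \<le> t \<Longrightarrow> t \<le> b \<Longrightarrow> norm (L t s x) \<le> B * norm x"
    using L_locally_bounded by metis
  define C where "C = B * Kf + 1"
  have C: "0 < C" "B * Kf \<le> C" using B Kf_nonneg by (auto simp: C_def add_nonneg_pos)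
  obtain m where m: "\<And>t. t \<in> {a..b} \<Longrightarrow> norm (z t - z' t) \<le> m"
    using continuous_on_Icc_bounded[OF continuous_on_diff[OF z(1) z'(1)]] by auto
  have m0: "0 \<le> m" using order_trans[OF norm_ge_zero m[OF t]] .
  have it: "norm (z t - z' t) \<le> m * (1 / 2) ^ n * exp (2 * C * (t - a))" if "t \<in> {a..b}" for n t
    using that
  proof (induction n arbitrary: t)
    case 0
    have "m * 1 \<le> m * exp (2 * C * (t - a))"
      using 0 C m0 by (intro mult_left_mono) auto
    then show ?case using m[OF 0] by simp
  next
    case (Suc n)
    let ?m = "m * (1 / 2) ^ n"
    let ?g = "\<lambda>s. f s (z s) - f s (z' s)"
    have c: "continuous_on {a..t} z" "continuous_on {a..t} z'"
      using z(1) z'(1) Suc.prems by (auto intro: continuous_on_subset)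
    have "z t - z' t = integral {a..t} (\<lambda>s. L t s (f s (z s))) - integral {a..t} (\<lambda>s. L t s (f s (z' s)))"
      using z(2)[OF Suc.prems] z'(2)[OF Suc.prems] by simp
    also have "\<dots> = integral {a..t} (\<lambda>s. L t s (?g s))"
      unfolding blinfun.diff_right
      by (intro integral_diff[symmetric] integrable_continuous_real continuous_L_integrand continuous_f_comp c) auto
    also have "norm \<dots> \<le> ?m / 2 * exp (2 * C * (t - a)) - ?m / 2 * exp (2 * C * (a - a))"
    proof (rule norm_integral_le_primitive[where \<phi> = "\<lambda>s. C * (?m * exp (2 * C * (s - a)))"])
      show "continuous_on {a..t} (\<lambda>s. L t s (?g s))"
        by (intro continuous_L_integrand continuous_on_diff continuous_f_comp c) simp
      show "norm (L t s (?g s)) \<le> C * (?m * exp (2 * C * (s - a)))" if s: "s \<in> {a..t}" for s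
      proof -
        have "norm (L t s (?g s)) \<le> B * norm (?g s)" using s Suc.prems by (intro B) auto
        also have "\<dots> \<le> B * (Kf * norm (z s - z' s))"
          using B by (intro mult_left_mono f_lipschitz)
        also have "\<dots> = B * Kf * norm (z s - z' s)" by simp
        also have "\<dots> \<le> C * (?m * exp (2 * C * (s - a)))"
          using s Suc.prems C by (intro mult_mono Suc.IH) auto
        finally show ?thesis .
      qed
      show "((\<lambda>s. ?m / 2 * exp (2 * C * (s - a))) has_real_derivative C * (?m * exp (2 * C * (s - a)))) (at s)" for s
        by (auto intro!: derivative_eq_intros)
    qed (use Suc.prems in auto)
    also have "\<dots> \<le> m * (1 / 2) ^ Suc n * exp (2 * C * (t - a))" using m0 by simp
    finally show ?case .
  qed
  have "norm (z t - z' t) \<le> m * 0 * exp (2 * C * (t - a))"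
  proof (rule tendsto_lowerbound)
    show "(\<lambda>n. m * (1 / 2) ^ n * exp (2 * C * (t - a))) \<longlonglongrightarrow> m * 0 * exp (2 * C * (t - a))"
      by (intro tendsto_intros LIMSEQ_power_zero) simp
  qed (use it t in auto)
  then show ?thesis by simp
qed

text \<open>T is known only through its integral equation; uniqueness for that equation is what
  identifies any other solution of it with an orbit of T.\<close>

lemma mild_solution_T:
  assumes "a \<le> b" "continuous_on {a..b} z"
    and "\<And>t. t \<in> {a..b} \<Longrightarrow> z t = L t a (z a) + integral {a..t} (\<lambda>s. L t s (f s (z s)))"
  shows "T b a (z a) = z b"
proof (rule mild_solution_unique[OF _ _ assms(2,3)])
  show "continuous_on {a..b} (\<lambda>t. T t a (z a))" by (rule continuous_on_subset[OF T_continuous]) auto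
  show "T t a (z a) = L t a (z a) + integral {a..t} (\<lambda>s. L t s (f s (T s a (z a))))" if "t \<in> {a..b}" for t
    using that by (intro vcf) simp
qed (use assms(1) in auto)

lemma mild_solution_if_T:
  assumes "a \<le> t" "\<And>r. r \<in> {a..t} \<Longrightarrow> T r a (z a) = z r"
  shows "z t = L t a (z a) + integral {a..t} (\<lambda>s. L t s (f s (z s)))"
proof -
  have "z t = L t a (z a) + integral {a..t} (\<lambda>s. L t s (f s (T s a (z a))))"
    using vcf[OF assms(1), of "z a"] assms by simp
  also have "integral {a..t} (\<lambda>s. L t s (f s (T s a (z a)))) = integral {a..t} (\<lambda>s. L t s (f s (z s)))"
    by (intro integral_cong) (simp add: assms)
  finally show ?thesis .
qed

text \<open>Apply L t a to the equation at time a and subtract from the equation at t: the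
  U-integrals differ by one over \<open>{a..t}\<close>, and so do the V-integrals. Together these
  two give the integral with kernel L.\<close>

lemma LP_solution_mild:
  assumes z: "LP_solution \<tau> \<eta> z" and "a \<le> t" "t \<le> \<tau>"
  shows "z t = L t a (z a) + integral {a..t} (\<lambda>s. L t s (f s (z s)))"
proof -
  let ?g = "\<lambda>s. f s (z s)"
  have fo: "forcing \<tau> ?g" using z by (simp add: LP_solution_def growth_forcing)
  have g: "continuous_on {..\<tau>} ?g" using fo by (simp add: forcing_def)
  have gi: "continuous_on {x..y} ?g" if "y \<le> \<tau>" for x y
    by (rule continuous_on_subset[OF g]) (use that in auto)
  obtain C where bd: "\<And>s. s \<le> t \<Longrightarrow> nV s (?g s) \<le> C * exp (- \<sigma> * s)"
    using forcingE[OF forcing_mono[OF fo \<open>t \<le> \<tau>\<close>]] by metis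
  have ga: "continuous_on {..a} ?g" "continuous_on {..t} ?g"
    by (rule continuous_on_subset[OF g]; use assms in auto)+
  have zt: "z s = U s \<tau> \<eta> - integral {s..\<tau>} (\<lambda>r. U s r (?g r)) + integral {..s} (\<lambda>r. V s r (?g r))"
    if "s \<le> \<tau>" for s
    using z that by (simp add: LP_solution_def LP_def[abs_def])
  \<comment> \<open>The stable history is annihilated by \<open>Q a\<close>, so on it L t a agrees
    with V t a.\<close>
  have "L t a (integral {..a} (\<lambda>s. V a s (?g s))) = V t a (integral {..a} (\<lambda>s. V a s (?g s)))"
    using Q_V_integral_atMost[OF ga(1) bd sigma_less_gamma] assms by (simp add: V_def)
  moreover have "L t a (integral {a..\<tau>} (\<lambda>s. U a s (?g s))) = integral {a..\<tau>} (\<lambda>s. U t s (?g s))"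
    using bounded_linear_integral_Icc[OF blinfun.bounded_linear_right[of "L t a"] continuous_U_integrand[OF gi[of \<tau>]]]
    using \<open>a \<le> t\<close> by (simp add: L_U)
  ultimately have La: "L t a (z a) = U t \<tau> \<eta> - integral {a..\<tau>} (\<lambda>s. U t s (?g s)) + V t a (integral {..a} (\<lambda>s. V a s (?g s)))"
    using assms by (simp add: zt[of a] blinfun.add_right blinfun.diff_right L_U)
  have "integral {a..\<tau>} (\<lambda>s. U t s (?g s)) = integral {a..t} (\<lambda>s. U t s (?g s)) + integral {t..\<tau>} (\<lambda>s. U t s (?g s))"
    by (rule integral_split_real) (use assms in \<open>auto intro: continuous_U_integrand gi\<close>)
  moreover have "integral {..t} (\<lambda>s. V t s (?g s))
      = V t a (integral {..a} (\<lambda>s. V a s (?g s))) + integral {a..t} (\<lambda>s. V t s (?g s))"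
    by (rule V_integral_atMost_split[OF ga(2) bd sigma_less_gamma \<open>a \<le> t\<close>])
  moreover have "integral {a..t} (\<lambda>s. L t s (?g s)) = integral {a..t} (\<lambda>s. U t s (?g s)) + integral {a..t} (\<lambda>s. V t s (?g s))"
  proof -
    have "integral {a..t} (\<lambda>s. L t s (?g s)) = integral {a..t} (\<lambda>s. U t s (?g s) + V t s (?g s))"
      by (intro integral_cong) (simp add: L_eq_U_plus_V)
    also have "\<dots> = integral {a..t} (\<lambda>s. U t s (?g s)) + integral {a..t} (\<lambda>s. V t s (?g s))"
      by (intro integral_add integrable_continuous_real continuous_U_integrand continuous_V_integrand gi)
        (use assms in auto)
    finally show ?thesis .
  qed
  ultimately show ?thesis using zt[OF \<open>t \<le> \<tau>\<close>] La by simp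
qed

lemma LP_solution_T:
  assumes "LP_solution \<tau> \<eta> z" "a \<le> t" "t \<le> \<tau>"
  shows "T t a (z a) = z t"
proof (rule mild_solution_T[OF assms(2)])
  show "continuous_on {a..t} z"
    using assms by (auto simp: LP_solution_def growth_def intro: continuous_on_subset)
qed (use assms in \<open>auto intro: LP_solution_mild\<close>)

lemma global_solution_T: "global_solution T z \<Longrightarrow> s \<le> t \<Longrightarrow> T t s (z s) = z t"
  by (simp add: global_solution_def solution_on_def)

text \<open>The definition of a solution does not mention continuity; it holds because on each
  half-line \<open>{a..}\<close> the solution is an orbit of T.\<close>

lemma global_solution_continuous:
  assumes "global_solution T z"
  shows "continuous_on S z"
proof -
  have "continuous_on {a..} z" for a
    using T_continuous[of a "z a"] by (rule continuous_on_eq) (use global_solution_T[OF assms] in auto)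
  then show ?thesis
    using continuous_on_UNIV_if_atLeast continuous_on_subset by blast
qed

text \<open>The manifold is defined with weight exp (\<sigma> r), the function space with exp
  (\<sigma> (r - t)). Shifting the base point c changes the weight by a constant factor; the cases
  are c = 0 and c = t.\<close>

lemma bounded_iff_growth:
  assumes "continuous_on {..t} z"
  shows "bdd_above ((\<lambda>r. exp (\<sigma> * r) * nG r (z r)) ` {..t}) \<longleftrightarrow> growth t z"
    and "bdd_above ((\<lambda>r. exp (\<sigma> * (r - t)) * nG r (z r)) ` {..t}) \<longleftrightarrow> growth t z"
proof -
  have iff: "bdd_above ((\<lambda>r. exp (\<sigma> * (r - c)) * nG r (z r)) ` {..t}) \<longleftrightarrow> growth t z" for c
  proof
    assume "bdd_above ((\<lambda>r. exp (\<sigma> * (r - c)) * nG r (z r)) ` {..t})"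
    then obtain C where C: "\<And>r. r \<le> t \<Longrightarrow> exp (\<sigma> * (r - c)) * nG r (z r) \<le> C"
      by (auto simp: bdd_above_def)
    have "0 \<le> C" by (rule order_trans[OF _ C[of t]]) (auto simp: nG_nonneg)
    moreover have "nG r (z r) \<le> C * exp (\<sigma> * (c - t)) * exp (- \<sigma> * (r - t))" if "r \<le> t" for r
    proof -
      have "nG r (z r) = exp (\<sigma> * (c - t)) * exp (- \<sigma> * (r - t)) * (exp (\<sigma> * (r - c)) * nG r (z r))"
        by (simp add: algebra_simps flip: exp_add mult.assoc)
      also have "\<dots> \<le> exp (\<sigma> * (c - t)) * exp (- \<sigma> * (r - t)) * C"
        by (intro mult_left_mono C that) auto
      finally show ?thesis by (simp add: mult_ac)
    qed
    ultimately show "growth t z"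
      unfolding growth_def using assms by (auto intro!: exI[of _ "C * exp (\<sigma> * (c - t))"])
  next
    assume "growth t z"
    then obtain C where C: "0 \<le> C" "\<And>r. r \<le> t \<Longrightarrow> nG r (z r) \<le> C * exp (- \<sigma> * (r - t))"
      using growthE by metis
    show "bdd_above ((\<lambda>r. exp (\<sigma> * (r - c)) * nG r (z r)) ` {..t})"
    proof (rule bdd_aboveI2)
      fix r assume r: "r \<in> {..t}"
      have "exp (\<sigma> * (r - c)) * nG r (z r) \<le> exp (\<sigma> * (r - c)) * (C * exp (- \<sigma> * (r - t)))"
        using r by (intro mult_left_mono C) auto
      also have "\<dots> = C * exp (\<sigma> * (t - c))" by (simp add: algebra_simps flip: exp_add)
      finally show "exp (\<sigma> * (r - c)) * nG r (z r) \<le> C * exp (\<sigma> * (t - c))" .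
    qed
  qed
  from iff[of 0] iff[of t]
  show "bdd_above ((\<lambda>r. exp (\<sigma> * r) * nG r (z r)) ` {..t}) \<longleftrightarrow> growth t z"
    "bdd_above ((\<lambda>r. exp (\<sigma> * (r - t)) * nG r (z r)) ` {..t}) \<longleftrightarrow> growth t z" by simp_all
qed

text \<open>The Q-component is read off by pulling the integral equation back from \<tau> with U.
  For the stable component the initial time a tends to -infinity: V t a (z a) vanishes, as its decay
  at rate \<gamma> beats the growth of z at rate \<sigma>.\<close>

lemma global_solution_LP:
  assumes z: "global_solution T z" and gr: "growth \<tau> z"
  shows "LP_solution \<tau> (z \<tau>) z"
  unfolding LP_solution_def
proof (intro conjI gr allI impI)
  fix t assume t: "t \<le> \<tau>"
  let ?g = "\<lambda>s. f s (z s)"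
  have gi: "continuous_on S ?g" for S by (intro continuous_f_comp global_solution_continuous[OF z])
  have mild: "z t = L t a (z a) + integral {a..t} (\<lambda>s. L t s (?g s))" if "a \<le> t" for a t
    using that by (intro mild_solution_if_T) (auto simp: global_solution_T[OF z])
  have Qpart: "Q t (z t) = U t \<tau> (z \<tau>) - integral {t..\<tau>} (\<lambda>s. U t s (?g s))"
  proof -
    have "integral {t..\<tau>} (\<lambda>s. U t \<tau> (L \<tau> s (?g s))) = integral {t..\<tau>} (\<lambda>s. U t s (?g s))"
      by (intro integral_cong) (simp add: U_L)
    then have "U t \<tau> (z \<tau>) = U t t (z t) + integral {t..\<tau>} (\<lambda>s. U t s (?g s))"
      unfolding mild[OF t] U_add U_L[OF t]
      by (simp add: bounded_linear_integral_Icc[OF bounded_linear_U continuous_L_integrand[OF gi]])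
    then show ?thesis by (simp add: U_refl)
  qed
  have Vpart: "z t - Q t (z t) = integral {..t} (\<lambda>s. V t s (?g s))"
  proof -
    obtain C where bd: "\<And>s. s \<le> t \<Longrightarrow> nV s (?g s) \<le> C * exp (- \<sigma> * s)"
      using forcingE[OF forcing_mono[OF growth_forcing[OF gr] t]] by metis
    have V: "V t a (z a) = z t - Q t (z t) - integral {a..t} (\<lambda>s. V t s (?g s))" if "a \<le> t" for a
    proof -
      have "integral {a..t} (\<lambda>s. V t t (L t s (?g s))) = integral {a..t} (\<lambda>s. V t s (?g s))"
        by (intro integral_cong) (simp add: V_L)
      then have "V t t (z t) = V t a (z a) + integral {a..t} (\<lambda>s. V t s (?g s))"
        unfolding mild[OF that] V_add V_L[OF that order_refl]
        by (simp add: bounded_linear_integral_Icc[OF bounded_linear_V continuous_L_integrand[OF gi]])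
      then show ?thesis by (simp add: V_refl)
    qed
    have "((\<lambda>a. V t a (z a)) \<longlongrightarrow> z t - Q t (z t) - integral {..t} (\<lambda>s. V t s (?g s))) at_bot"
    proof (rule Lim_transform_eventually)
      show "((\<lambda>a. z t - Q t (z t) - integral {a..t} (\<lambda>s. V t s (?g s)))
          \<longlongrightarrow> z t - Q t (z t) - integral {..t} (\<lambda>s. V t s (?g s))) at_bot"
        by (intro tendsto_intros V_integrable_atMost(2)[OF gi bd sigma_less_gamma order_refl])
      show "\<forall>\<^sub>F a in at_bot. z t - Q t (z t) - integral {a..t} (\<lambda>s. V t s (?g s)) = V t a (z a)"
        using V by (auto simp: eventually_at_bot_linorder intro!: exI[of _ t])
    qed
    moreover have "((\<lambda>a. V t a (z a)) \<longlongrightarrow> 0) at_bot"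
    proof -
      obtain D where D: "0 \<le> D" "\<And>r. r \<le> \<tau> \<Longrightarrow> nG r (z r) \<le> D * exp (- \<sigma> * (r - \<tau>))"
        using growthE[OF gr] by metis
      define E where "E = 1 / \<Gamma> (0, 1) * D * exp (\<sigma> * \<tau> - \<gamma> * t)"
      have le: "norm (V t a (z a)) \<le> E * exp ((\<gamma> - \<sigma>) * a)" if "a \<le> t" for a
      proof -
        have "nV a (z a) \<le> 1 / \<Gamma> (0, 1) * nG a (z a)"
          using le_Gamma_snd[OF nU_nonneg nV_nonneg, of a "z a" a "z a"] Gamma_pos[of 0 1]
          by (simp add: nG_alt pos_le_divide_eq)
        also have "\<dots> \<le> 1 / \<Gamma> (0, 1) * (D * exp (- \<sigma> * (a - \<tau>)))"
          using that t by (intro mult_left_mono D) (auto simp: Gamma_nonneg)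
        finally have "norm (V t a (z a)) \<le> exp (- \<gamma> * (t - a)) * (1 / \<Gamma> (0, 1) * (D * exp (- \<sigma> * (a - \<tau>))))"
          using norm_V_le[OF that, of "z a"] by (meson mult_left_mono exp_ge_zero order_trans)
        also have "\<dots> = E * exp ((\<gamma> - \<sigma>) * a)"
          by (simp add: E_def algebra_simps flip: exp_add)
        finally show ?thesis .
      qed
      have "((\<lambda>a. E * exp ((\<gamma> - \<sigma>) * a)) \<longlongrightarrow> 0) at_bot"
        using sigma_less_gamma
        by (intro tendsto_mult_right_zero filterlim_compose[OF exp_at_bot]
            filterlim_tendsto_pos_mult_at_bot[OF tendsto_const]) (auto simp: filterlim_ident)
      moreover have "\<forall>\<^sub>F a in at_bot. norm (V t a (z a)) \<le> E * exp ((\<gamma> - \<sigma>) * a)"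
        unfolding eventually_at_bot_linorder using le by blast
      ultimately show ?thesis by (rule Lim_null_comparison[rotated])
    qed
    ultimately have "z t - Q t (z t) - integral {..t} (\<lambda>s. V t s (?g s)) = 0"
      by (rule tendsto_unique[rotated]) simp
    then show ?thesis by simp
  qed
  show "z t = LP \<tau> (z \<tau>) ?g t"
    unfolding LP_def using Qpart Vpart by (metis diff_add_cancel add.commute)
qed

section \<open>The manifold as a set of values of global solutions\<close>

definition Man :: "real \<Rightarrow> 'a set" where
  "Man t = {\<eta>. \<exists>z. global_solution T z \<and> z t = \<eta> \<and>
     bdd_above ((\<lambda>r. exp (\<sigma> * r) * nG r (z r)) ` {..t})}"

lemma Man_iff: "\<eta> \<in> Man t \<longleftrightarrow> (\<exists>z. global_solution T z \<and> z t = \<eta> \<and> growth t z)"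
  unfolding Man_def by (auto simp: bounded_iff_growth(1) global_solution_continuous)

text \<open>Between s and t continuity on a compact interval gives a bound, so the growth condition
  does not depend on the time at which it is imposed. Invariance of the manifold rests on
  this.\<close>

lemma growth_change:
  assumes "continuous_on UNIV z" "growth s z"
  shows "growth t z"
proof -
  let ?h = "\<lambda>r. exp (\<sigma> * r) * nG r (z r)"
  have c: "continuous_on S z" for S using assms(1) by (rule continuous_on_subset) simp
  obtain m where m: "\<And>r. r \<in> {s..t} \<Longrightarrow> norm (z r) \<le> m"
    using continuous_on_Icc_bounded[OF c] by auto
  have "bdd_above (?h ` {s..t})"
  proof (rule bdd_aboveI2)
    fix r assume r: "r \<in> {s..t}"
    have "\<sigma> * r \<le> \<bar>\<sigma>\<bar> * \<bar>r\<bar>" by (metis abs_ge_self abs_mult)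
    also have "\<dots> \<le> \<bar>\<sigma>\<bar> * (\<bar>s\<bar> + \<bar>t\<bar>)" using r by (intro mult_left_mono) auto
    finally have "exp (\<sigma> * r) \<le> exp (\<bar>\<sigma>\<bar> * (\<bar>s\<bar> + \<bar>t\<bar>))" by simp
    moreover have "nG r (z r) \<le> M * \<Gamma> (1, 1) * m"
      using M_ge_1 by (intro order_trans[OF nG_le] mult_left_mono m r) (simp add: Gamma_nonneg)
    ultimately show "?h r \<le> exp (\<bar>\<sigma>\<bar> * (\<bar>s\<bar> + \<bar>t\<bar>)) * (M * \<Gamma> (1, 1) * m)"
      by (intro mult_mono) (auto simp: nG_nonneg)
  qed
  moreover have "bdd_above (?h ` {..s})"
    using assms(2) by (simp only: bounded_iff_growth(1)[OF c])
  ultimately have "bdd_above (?h ` ({..s} \<union> {s..t}))" by (simp add: image_Un)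
  then have "bdd_above (?h ` {..t})" by (rule bdd_above_mono) auto
  then show ?thesis by (simp only: bounded_iff_growth(1)[OF c])
qed

lemma growth_cong:
  assumes "\<And>t. t \<le> \<tau> \<Longrightarrow> z t = z' t" "growth \<tau> z"
  shows "growth \<tau> z'"
proof -
  have "continuous_on {..\<tau>} z'"
    using assms by (auto simp: growth_def intro: continuous_on_eq[of _ z])
  then show ?thesis using assms by (simp add: growth_def)
qed

lemma Man_along_solution:
  assumes "global_solution T z" "growth s z"
  shows "z t \<in> Man t"
  using assms growth_change[OF global_solution_continuous] unfolding Man_iff by blast

lemma T_image_Man:
  assumes "\<tau> \<le> t"
  shows "T t \<tau> ` Man \<tau> = Man t"
proof
  show "T t \<tau> ` Man \<tau> \<subseteq> Man t"
    using Man_along_solution global_solution_T[OF _ assms] by (auto simp: Man_iff[of _ \<tau>])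
  show "Man t \<subseteq> T t \<tau> ` Man \<tau>"
  proof
    fix x assume "x \<in> Man t"
    then obtain z where z: "global_solution T z" "z t = x" "growth t z" by (auto simp: Man_iff)
    then show "x \<in> T t \<tau> ` Man \<tau>"
      using Man_along_solution[OF z(1,3), of \<tau>] global_solution_T[OF z(1) assms] by (metis image_eqI)
  qed
qed

lemma LP_solution_extends:
  assumes z: "LP_solution \<tau> \<eta> z"
  obtains z' where "global_solution T z'" "growth \<tau> z'" "\<And>t. t \<le> \<tau> \<Longrightarrow> z' t = z t"
proof
  define z' where "z' t = (if t \<le> \<tau> then z t else T t \<tau> (z \<tau>))" for t
  have z'_T: "z' t = T t \<tau> (z \<tau>)" if "\<tau> \<le> t" for t
    using that by (cases "t = \<tau>") (auto simp: z'_def T_refl)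
  show "global_solution T z'"
    unfolding global_solution_def solution_on_def
  proof (intro ballI impI)
    fix s t :: real assume "s \<le> t"
    then consider "t \<le> \<tau>" | "s \<le> \<tau>" "\<tau> \<le> t" | "\<tau> \<le> s" by linarith
    then show "T t s (z' s) = z' t"
    proof cases
      case 1
      then show ?thesis using LP_solution_T[OF z \<open>s \<le> t\<close>] \<open>s \<le> t\<close> by (simp add: z'_def)
    next
      case 2
      then show ?thesis
        using T_comp[OF 2, of "z s"] LP_solution_T[OF z 2(1) order_refl] by (simp add: z'_T) (simp add: z'_def)
    next
      case 3
      then show ?thesis using T_comp[OF 3 \<open>s \<le> t\<close>] \<open>s \<le> t\<close> by (simp add: z'_T)
    qed
  qed
  show "growth \<tau> z'"
    by (rule growth_cong[of _ z]) (use z in \<open>auto simp: LP_solution_def z'_def\<close>)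
  show "z' t = z t" if "t \<le> \<tau>" for t using that by (simp add: z'_def)
qed

subsection \<open>The function whose graph is the manifold\<close>

lemma is_z_iff: "is_z \<Gamma> L Q \<gamma> \<rho> \<sigma> f \<tau> \<eta> z \<longleftrightarrow> z \<in> extensional {..\<tau>} \<and> LP_solution \<tau> \<eta> z"
proof -
  have "z \<in> E_space \<Gamma> L Q \<gamma> \<rho> \<sigma> \<tau> \<longleftrightarrow> z \<in> extensional {..\<tau>} \<and> growth \<tau> z"
    using bounded_iff_growth(2)[of \<tau> z] unfolding E_space_def nG_def[symmetric]
    by (auto simp: growth_def)
  then show ?thesis
    unfolding is_z_def LP_solution_def LP_def U_def V_def by blast
qed

text \<open>A solution is fixed by the equation only up to \<tau>. Restricting it makes it
  extensional without affecting the integrals, which see only times up to \<tau>.\<close>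

lemma is_z_exists_unique: "\<exists>!z. is_z \<Gamma> L Q \<gamma> \<rho> \<sigma> f \<tau> \<eta> z"
proof -
  obtain z where z: "LP_solution \<tau> \<eta> z" using LP_solution_exists by blast
  let ?z = "restrict z {..\<tau>}"
  have "growth \<tau> ?z"
    by (rule growth_cong[of _ z]) (use z in \<open>auto simp: LP_solution_def\<close>)
  moreover have "LP \<tau> \<eta> (\<lambda>s. f s (?z s)) t = LP \<tau> \<eta> (\<lambda>s. f s (z s)) t" if "t \<le> \<tau>" for t
  proof -
    have "integral {t..\<tau>} (\<lambda>s. U t s (f s (?z s))) = integral {t..\<tau>} (\<lambda>s. U t s (f s (z s)))"
      "integral {..t} (\<lambda>s. V t s (f s (?z s))) = integral {..t} (\<lambda>s. V t s (f s (z s)))"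
      using that by (auto intro!: integral_cong)
    then show ?thesis by (simp add: LP_def)
  qed
  ultimately have "LP_solution \<tau> \<eta> ?z" using z by (simp add: LP_solution_def)
  then have isz: "is_z \<Gamma> L Q \<gamma> \<rho> \<sigma> f \<tau> \<eta> ?z" by (simp add: is_z_iff)
  show ?thesis
  proof (rule ex1I, rule isz)
    fix y assume y: "is_z \<Gamma> L Q \<gamma> \<rho> \<sigma> f \<tau> \<eta> y"
    show "y = ?z"
      by (rule extensionalityI[of _ "{..\<tau>}"])
        (use y z in \<open>auto simp: is_z_iff intro: LP_solution_unique\<close>)
  qed
qed

definition zf :: "real \<Rightarrow> 'a \<Rightarrow> real \<Rightarrow> 'a" where "zf = z_fun \<Gamma> L Q \<gamma> \<rho> \<sigma> f"
definition Sg :: "real \<Rightarrow> 'a \<Rightarrow> 'a" where "Sg = Sigma_fun \<Gamma> L Q \<gamma> \<rho> \<sigma> f"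

lemma zf_solution: "LP_solution \<tau> \<eta> (zf \<tau> \<eta>)"
  using theI'[OF is_z_exists_unique, of \<tau> \<eta>] unfolding zf_def z_fun_def is_z_iff by blast

lemma Q_zf: "Q \<tau> (zf \<tau> \<eta> \<tau>) = Q \<tau> \<eta>"
proof -
  have "zf \<tau> \<eta> \<tau> = LP \<tau> \<eta> (\<lambda>s. f s (zf \<tau> \<eta> s)) \<tau>"
    using zf_solution by (simp add: LP_solution_def)
  then show ?thesis
    using Q_LP[OF growth_forcing order_refl, of \<tau> "zf \<tau> \<eta>" \<eta>] zf_solution[of \<tau> \<eta>]
    by (simp add: LP_solution_def U_refl)
qed

lemma Sg_eq: "Sg \<tau> \<eta> = zf \<tau> \<eta> \<tau> - Q \<tau> (zf \<tau> \<eta> \<tau>)"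
  by (simp add: Sg_def Sigma_fun_def zf_def blinfun.diff_left)

lemma zf_eq: "zf \<tau> \<eta> \<tau> = Q \<tau> \<eta> + Sg \<tau> \<eta>"
  by (simp add: Sg_eq Q_zf)

text \<open>Stated with \<open>has_integral\<close>, since \<open>integral\<close> has a default
  value for a divergent integral and an equation with it would not assert convergence.\<close>

lemma Sg_has_integral: "((\<lambda>s. L \<tau> s ((id_blinfun - Q s) (f s (zf \<tau> \<eta> s)))) has_integral Sg \<tau> \<eta>) {..\<tau>}"
proof -
  have fo: "forcing \<tau> (\<lambda>s. f s (zf \<tau> \<eta> s))"
    using zf_solution by (simp add: LP_solution_def growth_forcing)
  have "Sg \<tau> \<eta> = LP \<tau> \<eta> (\<lambda>s. f s (zf \<tau> \<eta> s)) \<tau> - Q \<tau> (LP \<tau> \<eta> (\<lambda>s. f s (zf \<tau> \<eta> s)) \<tau>)"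
    using zf_solution[of \<tau> \<eta>] by (simp add: Sg_eq LP_solution_def)
  also have "\<dots> = integral {..\<tau>} (\<lambda>s. V \<tau> s (f s (zf \<tau> \<eta> s)))" by (rule LP_minus_Q[OF fo order_refl])
  finally show ?thesis
    using integrable_integral[OF forcing_integrable[OF fo]] by (simp add: V_def blinfun.diff_left)
qed

lemma zf_cong: "Q \<tau> \<eta> = Q \<tau> \<eta>' \<Longrightarrow> t \<le> \<tau> \<Longrightarrow> zf \<tau> \<eta> t = zf \<tau> \<eta>' t"
  by (rule LP_solution_unique[OF zf_solution zf_solution])

lemma Sg_cong: "Q \<tau> \<eta> = Q \<tau> \<eta>' \<Longrightarrow> Sg \<tau> \<eta> = Sg \<tau> \<eta>'"
  by (simp add: Sg_eq zf_cong[of \<tau> \<eta> \<eta>'])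

lemma Q_Sg: "Q \<tau> (Sg \<tau> \<eta>) = 0"
  by (simp add: Sg_eq blinfun.diff_right Q_idem)

lemma Sg_0: "Sg \<tau> 0 = 0"
proof -
  have "LP_solution \<tau> 0 (\<lambda>_. 0)"
    by (simp add: LP_solution_def growth_0 LP_def U_0 V_0 f_zero)
  from LP_solution_unique[OF zf_solution this refl order_refl] show ?thesis by (simp add: Sg_eq)
qed

lemma Sg_lipschitz: "nV \<tau> (Sg \<tau> \<eta> - Sg \<tau> \<eta>') \<le> k * nU \<tau> (\<eta> - \<eta>')"
proof -
  have "nV \<tau> (Sg \<tau> \<eta> - Sg \<tau> \<eta>') = nV \<tau> (zf \<tau> \<eta> \<tau> - zf \<tau> \<eta>' \<tau>)"
    by (rule nV_cong) (simp add: zf_eq blinfun.diff_right blinfun.add_right Q_Sg Q_idem)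
  also have "\<dots> \<le> k * nU \<tau> (\<eta> - \<eta>')"
    using LP_solution_compare(2)[OF zf_solution zf_solution order_refl, of \<tau> \<eta> \<eta>'] by simp
  finally show ?thesis .
qed

lemma graph_in_Man: "Q t \<eta> + Sg t \<eta> \<in> Man t"
proof -
  obtain z where z: "global_solution T z" "growth t z" "\<And>s. s \<le> t \<Longrightarrow> z s = zf t \<eta> s"
    using LP_solution_extends[OF zf_solution] by metis
  then show ?thesis using zf_eq[of t \<eta>] unfolding Man_iff by (metis order_refl)
qed

lemma Man_solution_eq_zf:
  assumes "global_solution T z" "growth \<tau> z" "t \<le> \<tau>"
  shows "z t = zf \<tau> (z \<tau>) t"
  by (rule LP_solution_unique[OF global_solution_LP[OF assms(1,2)] zf_solution refl assms(3)])

lemma Man_graph: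
  assumes "\<eta> \<in> Man t"
  shows "\<eta> = Q t \<eta> + Sg t \<eta>"
  using assms Man_solution_eq_zf[of _ t t] zf_eq[of t \<eta>] by (auto simp: Man_iff)

lemma Man_eq: "Man t = {Q t \<eta> + Sg t (Q t \<eta>) | \<eta>. True}" "Man t = range (\<lambda>\<eta>. Q t \<eta> + Sg t \<eta>)"
proof -
  have 1: "Sg t (Q t \<eta>) = Sg t \<eta>" for \<eta> by (rule Sg_cong) (simp add: Q_idem)
  show 2: "Man t = range (\<lambda>\<eta>. Q t \<eta> + Sg t \<eta>)" using Man_graph graph_in_Man by blast
  show "Man t = {Q t \<eta> + Sg t (Q t \<eta>) | \<eta>. True}" unfolding 2 1 by auto
qed

end

context perturbed_process
begin

subsection \<open>Backward growth on the manifold\<close>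

text \<open>Membership of z t in the manifold for each t provides a solution of controlled growth
  through z t, possibly a different one for each t. It does not directly bound z itself.\<close>

lemma Man_solution_exists_unique:
  assumes "\<eta> \<in> Man \<tau>"
  shows "\<exists>!z. global_solution T z \<and> z \<tau> = \<eta> \<and> (\<forall>t. z t \<in> Man t)"
    and "global_solution T z \<and> z \<tau> = \<eta> \<and> (\<forall>t. z t \<in> Man t) \<Longrightarrow> t \<le> \<tau> \<Longrightarrow> z t = zf \<tau> \<eta> t"
proof -
  have zf_before: "z t = zf \<tau> \<eta> t"
    if z: "global_solution T z \<and> z \<tau> = \<eta> \<and> (\<forall>t. z t \<in> Man t)" and "t \<le> \<tau>" for z t
  proof -
    \<comment> \<open>From time t on, y is the T-orbit of z t and so coincides with z; in particular
      it passes through \<eta> at time \<tau>, where the Lyapunov-Perron equation determines its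
      whole past.\<close>
    obtain y where y: "global_solution T y" "y t = z t" "growth t y"
      using z by (metis Man_iff)
    have "y \<tau> = \<eta>"
      using z y global_solution_T[OF y(1) \<open>t \<le> \<tau>\<close>] global_solution_T[of z t \<tau>] \<open>t \<le> \<tau>\<close> by metis
    moreover have "growth \<tau> y"
      by (rule growth_change[OF global_solution_continuous[OF y(1)] y(3)])
    ultimately show ?thesis using Man_solution_eq_zf[OF y(1) _ \<open>t \<le> \<tau>\<close>] y(2) by metis
  qed
  then show "global_solution T z \<and> z \<tau> = \<eta> \<and> (\<forall>t. z t \<in> Man t) \<Longrightarrow> t \<le> \<tau> \<Longrightarrow> z t = zf \<tau> \<eta> t" .
  obtain z where z: "global_solution T z" "z \<tau> = \<eta>" "growth \<tau> z"
    using assms by (auto simp: Man_iff)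
  show "\<exists>!z. global_solution T z \<and> z \<tau> = \<eta> \<and> (\<forall>t. z t \<in> Man t)"
  proof (rule ex1I)
    show z': "global_solution T z \<and> z \<tau> = \<eta> \<and> (\<forall>t. z t \<in> Man t)"
      using z Man_along_solution[OF z(1,3)] by blast
    fix y assume y: "global_solution T y \<and> y \<tau> = \<eta> \<and> (\<forall>t. y t \<in> Man t)"
    show "y = z"
    proof
      fix t
      show "y t = z t"
      proof (cases "t \<le> \<tau>")
        case True
        then show ?thesis using zf_before[OF y] zf_before[OF z'] by simp
      next
        case False
        then show ?thesis using global_solution_T[of y \<tau> t] global_solution_T[of z \<tau> t] y z by simp
      qed
    qed
  qed
qed

text \<open>Comparison with the zero solution bounds the two components by multiples of 1 and k. The
  factor 1 / \<Gamma> (1, 0) arises from estimating \<open>nU\<close> by the full norm.\<close>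

lemma zf_backward_bound:
  assumes "\<eta> \<in> Man \<tau>" "t \<le> \<tau>"
  shows "nG t (zf \<tau> \<eta> t) \<le> \<Gamma> (1, k) / \<Gamma> (1, 0) * exp (- \<mu> * (t - \<tau>)) * nG \<tau> \<eta>"
proof -
  have "LP_solution \<tau> 0 (\<lambda>_. 0)"
    by (simp add: LP_solution_def growth_0 LP_def U_0 V_0 f_zero)
  note cmp = LP_solution_compare[OF zf_solution this assms(2), of \<eta>]
  let ?a = "nU \<tau> \<eta> * exp (- \<mu> * (t - \<tau>))"
  have a: "0 \<le> ?a" by (simp add: nU_nonneg)
  have "nG t (zf \<tau> \<eta> t) \<le> \<Gamma> (?a * 1, ?a * k)"
    unfolding nG_alt using cmp by (intro Gamma_mono nU_nonneg nV_nonneg) (auto simp: mult_ac)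
  also have "\<dots> = \<Gamma> (1, k) * exp (- \<mu> * (t - \<tau>)) * nU \<tau> \<eta>"
    using Gamma_mult[OF a, of 1 k] by simp
  also have "\<dots> \<le> \<Gamma> (1, k) * exp (- \<mu> * (t - \<tau>)) * (nG \<tau> \<eta> / \<Gamma> (1, 0))"
  proof (rule mult_left_mono)
    show "nU \<tau> \<eta> \<le> nG \<tau> \<eta> / \<Gamma> (1, 0)"
      using le_Gamma_fst[OF nU_nonneg nV_nonneg, of \<tau> \<eta> \<tau> \<eta>] Gamma_pos[of 1 0]
      by (simp add: nG_alt pos_le_divide_eq)
  qed (simp add: Gamma_nonneg)
  finally show ?thesis by (simp add: mult_ac)
qed

subsection \<open>Attraction\<close>

text \<open>The distance to the graph point with the same Q-component; the difference is purely
  stable, so \<open>nV\<close> is its full size.\<close>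

definition dev :: "real \<Rightarrow> 'a \<Rightarrow> real" where "dev t x = nV t (x - (Q t x + Sg t x))"

text \<open>In \<open>dev_step\<close> below, \<open>GG h * dev \<tau> \<eta>\<close> bounds the difference in the norm \<open>nG\<close> on an interval of
  length \<open>h\<close>, and \<open>exp (- \<gamma> * h) + h * RR h = 1 - \<omega> * h + o(h)\<close> is the resulting factor.\<close>

definition EE :: "real \<Rightarrow> real" where "EE h = exp ((\<bar>\<gamma>\<bar> + \<bar>\<rho>\<bar>) * h)"
definition DD :: "real \<Rightarrow> real" where
  "DD h = \<Gamma> (1, 0) * EE h * L1 + \<Gamma> (0, 1) * (EE h * (k * (EE h * L1)) + EE h * L2)"
definition GG :: "real \<Rightarrow> real" where "GG h = \<Gamma> (0, 1) * EE h / (1 - h * DD h)"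
definition RR :: "real \<Rightarrow> real" where
  "RR h = exp (- \<gamma> * h) * (k * (EE h * L1 * GG h)) + EE h * L2 * GG h"
definition \<omega> :: real where "\<omega> = \<gamma> - (k * L1 + L2) * \<Gamma> (0, 1)"

text \<open>On a short interval \<open>[\<tau>, \<tau> + h]\<close> compare \<open>T s \<tau> \<eta>\<close> with the solution on the manifold that has the
  same \<open>Q\<close>-component at the right endpoint. The \<open>Q\<close>-component of the difference is then \<open>O(h)\<close>, so
  that to first order only the stable component enters the Lipschitz estimates.\<close>

lemma dev_step:
  assumes h: "0 \<le> h" "h * DD h < 1"
  shows "dev (\<tau> + h) (T (\<tau> + h) \<tau> \<eta>) \<le> (exp (- \<gamma> * h) + h * RR h) * dev \<tau> \<eta>"
proof -
  define b where "b = \<tau> + h"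
  define u where "u s = T s \<tau> \<eta>" for s
  define z where "z = zf b (u b)"
  define w where "w s = u s - z s" for s
  define g where "g s = f s (u s) - f s (z s)" for s
  define \<beta> where "\<beta> = dev \<tau> \<eta>"
  have z_sol: "LP_solution b (u b) z" by (simp add: z_def zf_solution)
  have \<tau>b: "\<tau> \<le> b" using h by (simp add: b_def)
  have cu: "continuous_on {\<tau>..b} u"
    unfolding u_def by (rule continuous_on_subset[OF T_continuous]) auto
  have cz: "continuous_on {\<tau>..b} z"
    using z_sol by (auto simp: LP_solution_def growth_def intro: continuous_on_subset)
  have cg: "continuous_on S g" if "S \<subseteq> {\<tau>..b}" for S
    unfolding g_def
    by (intro continuous_on_diff continuous_f_comp continuous_on_subset[OF cu that] continuous_on_subset[OF cz that])
  have Tu: "T r a (u a) = u r" if "\<tau> \<le> a" "a \<le> r" for a r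
    using that by (simp add: u_def T_comp)
  have Tz: "T r a (z a) = z r" if "a \<le> r" "r \<le> b" for a r
    by (rule LP_solution_T[OF z_sol that])
  have mild: "w s = L s a (w a) + integral {a..s} (\<lambda>r. L s r (g r))" if "\<tau> \<le> a" "a \<le> s" "s \<le> b" for a s
  proof -
    have sub: "{a..s} \<subseteq> {\<tau>..b}" using that by auto
    have "u s = L s a (u a) + integral {a..s} (\<lambda>r. L s r (f r (u r)))"
      by (rule mild_solution_if_T) (use that Tu in auto)
    moreover have "z s = L s a (z a) + integral {a..s} (\<lambda>r. L s r (f r (z r)))"
      by (rule mild_solution_if_T) (use that Tz in auto)
    moreover have "integral {a..s} (\<lambda>r. L s r (g r))
        = integral {a..s} (\<lambda>r. L s r (f r (u r))) - integral {a..s} (\<lambda>r. L s r (f r (z r)))"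
      unfolding g_def blinfun.diff_right
      by (intro integral_diff integrable_continuous_real continuous_L_integrand continuous_f_comp
          continuous_on_subset[OF cu sub] continuous_on_subset[OF cz sub]) auto
    ultimately show ?thesis by (simp add: w_def blinfun.diff_right)
  qed
  \<comment> \<open>Both components of w are estimated by this supremum times h, so that m gets
    bounded in terms of itself.\<close>
  define m where "m = (SUP s\<in>{\<tau>..b}. nG s (w s))"
  have m_bdd: "bdd_above ((\<lambda>s. nG s (w s)) ` {\<tau>..b})"
  proof -
    obtain c where c: "\<And>s. s \<in> {\<tau>..b} \<Longrightarrow> norm (w s) \<le> c"
      unfolding w_def using continuous_on_Icc_bounded[OF continuous_on_diff[OF cu cz]] by metis
    show ?thesis
      by (rule bdd_aboveI2, rule order_trans[OF nG_le mult_left_mono[OF c]])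
        (use M_ge_1 in \<open>auto simp: Gamma_nonneg\<close>)
  qed
  have m: "nG s (w s) \<le> m" if "s \<in> {\<tau>..b}" for s
    unfolding m_def by (rule cSUP_upper[OF that m_bdd])
  have m0: "0 \<le> m" by (rule order_trans[OF nG_nonneg m[of \<tau>]]) (use \<tau>b in auto)
  have E1: "1 \<le> EE h" using h by (simp add: EE_def)
  have eg: "exp (- \<gamma> * x) \<le> EE h" and er: "exp (\<rho> * x) \<le> EE h" if "0 \<le> x" "x \<le> h" for x
  proof -
    have le: "c * x \<le> (\<bar>\<gamma>\<bar> + \<bar>\<rho>\<bar>) * h" if "\<bar>c\<bar> \<le> \<bar>\<gamma>\<bar> + \<bar>\<rho>\<bar>" for c
    proof -
      have "c * x \<le> \<bar>c\<bar> * x" using \<open>0 \<le> x\<close> by (intro mult_right_mono) auto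
      also have "\<dots> \<le> (\<bar>\<gamma>\<bar> + \<bar>\<rho>\<bar>) * h" using that \<open>0 \<le> x\<close> \<open>x \<le> h\<close> by (intro mult_mono) auto
      finally show ?thesis .
    qed
    show "exp (- \<gamma> * x) \<le> EE h" "exp (\<rho> * x) \<le> EE h" using le[of "- \<gamma>"] le[of \<rho>] by (auto simp: EE_def)
  qed
  define A where "A = EE h * L1 * m * h"
  have A0: "0 \<le> A" using E1 L1_pos m0 h by (simp add: A_def)
  have wU: "nU s (w s) \<le> A" if s: "s \<in> {\<tau>..b}" for s
  proof -
    have sub: "{s..b} \<subseteq> {\<tau>..b}" using s by auto
    let ?I = "integral {s..b} (\<lambda>r. U s r (g r))"
    \<comment> \<open>The choice of z: pulled back from b, the Q-component of w has no boundary term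
      and is an integral over length at most h.\<close>
    have "Q b (w b) = 0" by (simp add: w_def z_def blinfun.diff_right Q_zf)
    then have "U s b (w b) = 0" by (metis U_Q U_0)
    moreover have "U s b (w b) = U s s (w s) + ?I"
    proof -
      have "integral {s..b} (\<lambda>r. U s b (L b r (g r))) = ?I"
        by (intro integral_cong) (simp add: U_L)
      moreover have "w b = L b s (w s) + integral {s..b} (\<lambda>r. L b r (g r))"
        using s by (intro mild) auto
      ultimately show ?thesis
        using s by (simp add: U_add U_L bounded_linear_integral_Icc[OF bounded_linear_U continuous_L_integrand[OF cg[OF sub]]])
    qed
    ultimately have "Q s (w s) = 0 - ?I"
      by (simp add: U_refl eq_neg_iff_add_eq_0)
    then have "Q s (w s) = Q s (0 - ?I)" by (metis Q_idem)
    then have "nU s (w s) = nU s (0 - ?I)" by (rule nU_cong)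
    also have "\<dots> = nU s ?I" using nU_minus[of s 0 ?I] by simp
    also have "\<dots> \<le> EE h * (L1 * m) * b - EE h * (L1 * m) * s"
    proof (rule nU_integral_le[OF _ cg[OF sub]])
      show "exp (\<rho> * (r - s)) * nU r (g r) \<le> EE h * (L1 * m)" if r: "r \<in> {s..b}" for r
      proof (rule mult_mono)
        show "nU r (g r) \<le> L1 * m"
          unfolding g_def using r s L1_pos
          by (intro order_trans[OF nU_lip] mult_left_mono m[of r, unfolded w_def]) auto
      qed (use r s er[of "r - s"] in \<open>auto simp: b_def nU_nonneg EE_def\<close>)
    qed (use s in \<open>auto intro!: derivative_eq_intros\<close>)
    also have "\<dots> = EE h * (L1 * m) * (b - s)" by (simp add: algebra_simps)
    also have "\<dots> \<le> EE h * (L1 * m) * h"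
      using s E1 L1_pos m0 by (intro mult_left_mono) (auto simp: b_def)
    finally show ?thesis by (simp add: A_def mult_ac)
  qed
  have wV: "nV s (w s) \<le> exp (- \<gamma> * (s - \<tau>)) * nV \<tau> (w \<tau>) + EE h * L2 * m * h" if s: "s \<in> {\<tau>..b}" for s
  proof -
    have sub: "{\<tau>..s} \<subseteq> {\<tau>..b}" using s by auto
    let ?I = "integral {\<tau>..s} (\<lambda>r. V s r (g r))"
    have "V s s (w s) = V s \<tau> (w \<tau>) + ?I"
    proof -
      have "w s = L s \<tau> (w \<tau>) + integral {\<tau>..s} (\<lambda>r. L s r (g r))"
        using s by (intro mild) auto
      then have "V s s (w s) = V s s (L s \<tau> (w \<tau>) + integral {\<tau>..s} (\<lambda>r. L s r (g r)))"
        by (rule arg_cong)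
      also have "\<dots> = V s s (L s \<tau> (w \<tau>)) + integral {\<tau>..s} (\<lambda>r. V s s (L s r (g r)))"
        unfolding V_add bounded_linear_integral_Icc[OF bounded_linear_V continuous_L_integrand[OF cg[OF sub] order_refl]] ..
      also have "V s s (L s \<tau> (w \<tau>)) = V s \<tau> (w \<tau>)" by (rule V_L) (use s in auto)
      also have "integral {\<tau>..s} (\<lambda>r. V s s (L s r (g r))) = ?I"
        by (intro integral_cong) (simp add: V_L)
      finally show ?thesis .
    qed
    moreover have "nV s (w s) = nV s (V s s (w s))"
      by (rule nV_cong) (simp add: V_refl blinfun.diff_right Q_idem)
    ultimately have "nV s (w s) \<le> nV s (V s \<tau> (w \<tau>)) + nV s ?I"
      using nV_add[of s "V s \<tau> (w \<tau>)" ?I] by simp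
    moreover have "nV s (V s \<tau> (w \<tau>)) \<le> exp (- \<gamma> * (s - \<tau>)) * nV \<tau> (w \<tau>)"
      by (rule nV_V) (use s in auto)
    moreover have "nV s ?I \<le> EE h * (L2 * m) * s - EE h * (L2 * m) * \<tau>"
    proof (rule nV_integral_le[OF _ cg[OF sub]])
      show "exp (- \<gamma> * (s - r)) * nV r (g r) \<le> EE h * (L2 * m)" if r: "r \<in> {\<tau>..s}" for r
      proof (rule mult_mono)
        show "nV r (g r) \<le> L2 * m"
          unfolding g_def using r s L2_pos
          by (intro order_trans[OF nV_lip] mult_left_mono m[of r, unfolded w_def]) auto
        show "exp (- \<gamma> * (s - r)) \<le> EE h" using r s by (intro eg) (auto simp: b_def)
      qed (auto simp: nV_nonneg EE_def)
    qed (use s in \<open>auto intro!: derivative_eq_intros\<close>)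
    moreover have "EE h * (L2 * m) * s - EE h * (L2 * m) * \<tau> = EE h * (L2 * m) * (s - \<tau>)" by (simp add: algebra_simps)
    moreover have "EE h * (L2 * m) * (s - \<tau>) \<le> EE h * (L2 * m) * h"
      using s E1 L2_pos m0 by (intro mult_left_mono) (auto simp: b_def)
    ultimately show ?thesis by (simp add: mult.assoc)
  qed
  \<comment> \<open>At \<tau> the points \<eta> and z \<tau> have different Q-components, at
    distance at most A. The graph varies by at most k A between them, which is added to the
    deviation of \<eta>.\<close>
  have start: "nV \<tau> (w \<tau>) \<le> \<beta> + k * A"
  proof -
    have "z \<tau> \<in> Man \<tau>"
    proof -
      obtain z' where z': "global_solution T z'" "growth b z'" "\<And>t. t \<le> b \<Longrightarrow> z' t = z t"
        using LP_solution_extends[OF z_sol] by metis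
      then show ?thesis using Man_along_solution[OF z'(1,2), of \<tau>] \<tau>b by simp
    qed
    then have z\<tau>: "z \<tau> = Q \<tau> (z \<tau>) + Sg \<tau> (z \<tau>)" by (rule Man_graph)
    have "w \<tau> - Q \<tau> (w \<tau>) = (\<eta> - (Q \<tau> \<eta> + Sg \<tau> \<eta>)) + (Sg \<tau> \<eta> - Sg \<tau> (z \<tau>))" (is "_ = ?X + ?Y")
    proof -
      have "z \<tau> - Q \<tau> (z \<tau>) = Sg \<tau> (z \<tau>)" using z\<tau> by (metis add_diff_cancel_left')
      then show ?thesis by (simp add: w_def u_def T_refl blinfun.diff_right algebra_simps)
    qed
    then have "nV \<tau> (w \<tau>) = nV \<tau> (?X + ?Y)"
      by (intro nV_cong) (simp add: blinfun.diff_right blinfun.add_right Q_Sg Q_idem)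
    also have "\<dots> \<le> nV \<tau> ?X + nV \<tau> ?Y" by (rule nV_add)
    also have "\<dots> \<le> \<beta> + k * nU \<tau> (\<eta> - z \<tau>)"
      unfolding \<beta>_def dev_def by (intro add_left_mono Sg_lipschitz)
    also have "nU \<tau> (\<eta> - z \<tau>) \<le> A" using wU[of \<tau>] \<tau>b by (simp add: w_def u_def T_refl)
    finally show ?thesis using k_pos by simp
  qed
  have \<beta>0: "0 \<le> \<beta>" by (simp add: \<beta>_def dev_def nV_nonneg)
  have wV': "nV s (w s) \<le> EE h * (\<beta> + k * A) + EE h * L2 * m * h" if s: "s \<in> {\<tau>..b}" for s
  proof -
    have "exp (- \<gamma> * (s - \<tau>)) * nV \<tau> (w \<tau>) \<le> EE h * (\<beta> + k * A)"
      using s start by (intro mult_mono eg) (auto simp: b_def nV_nonneg EE_def)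
    then show ?thesis using wV[OF s] by simp
  qed
  \<comment> \<open>The self-estimate; the last term can be absorbed since h * \<open>DD\<close> h <
    1.\<close>
  have "m \<le> \<Gamma> (0, 1) * EE h * \<beta> + m * (h * DD h)"
    unfolding m_def
  proof (rule cSUP_least)
    fix s assume s: "s \<in> {\<tau>..b}"
    have "nG s (w s) \<le> \<Gamma> (A, EE h * (\<beta> + k * A) + EE h * L2 * m * h)"
      unfolding nG_alt by (intro Gamma_mono nU_nonneg nV_nonneg wU wV' s)
    also have "\<dots> \<le> A * \<Gamma> (1, 0) + (EE h * (\<beta> + k * A) + EE h * L2 * m * h) * \<Gamma> (0, 1)"
      using A0 \<beta>0 k_pos L2_pos m0 h E1 by (intro Gamma_le_axes) auto
    also have "\<dots> = \<Gamma> (0, 1) * EE h * \<beta> + m * (h * DD h)"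
      by (simp add: A_def DD_def algebra_simps)
    finally show "nG s (w s) \<le> \<Gamma> (0, 1) * EE h * \<beta> + (SUP s\<in>{\<tau>..b}. nG s (w s)) * (h * DD h)"
      by (simp add: m_def)
  qed (use \<tau>b in auto)
  then have "m * (1 - h * DD h) \<le> \<Gamma> (0, 1) * EE h * \<beta>" by (simp add: algebra_simps)
  then have mG: "m \<le> GG h * \<beta>" using h by (simp add: GG_def pos_le_divide_eq)
  have "k * A \<le> k * (EE h * L1 * (GG h * \<beta>) * h)"
    unfolding A_def using k_pos E1 L1_pos h by (intro mult_left_mono mult_right_mono mG) auto
  with start have start': "nV \<tau> (w \<tau>) \<le> \<beta> + k * (EE h * L1 * (GG h * \<beta>) * h)" by linarith
  \<comment> \<open>At the right endpoint z b is the graph point with the Q-component of u b, so w b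
    is exactly the deviation.\<close>
  have "dev b (u b) = nV b (w b)"
    by (simp add: dev_def w_def z_def zf_eq)
  also have "\<dots> \<le> exp (- \<gamma> * h) * nV \<tau> (w \<tau>) + EE h * L2 * m * h"
    using wV[of b] \<tau>b by (simp add: b_def)
  also have "\<dots> \<le> exp (- \<gamma> * h) * (\<beta> + k * (EE h * L1 * (GG h * \<beta>) * h)) + EE h * L2 * (GG h * \<beta>) * h"
    using E1 L2_pos h by (intro add_mono mult_left_mono mult_right_mono start' mG) auto
  also have "\<dots> = (exp (- \<gamma> * h) + h * RR h) * \<beta>"
    by (simp add: RR_def algebra_simps)
  finally show ?thesis by (simp add: b_def u_def \<beta>_def)
qed

lemma dev_nonneg: "0 \<le> dev t x"
  by (simp add: dev_def nV_nonneg)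

lemma RR_nonneg:
  assumes "0 \<le> h" "h * DD h < 1"
  shows "0 \<le> RR h"
  using assms k_pos L1_pos L2_pos
  by (auto simp: RR_def GG_def EE_def Gamma_nonneg intro!: add_nonneg_nonneg mult_nonneg_nonneg divide_nonneg_nonneg)

lemma dev_iterate:
  assumes h: "0 \<le> h" "h * DD h < 1"
  shows "dev (\<tau> + real n * h) (T (\<tau> + real n * h) \<tau> \<eta>) \<le> (exp (- \<gamma> * h) + h * RR h) ^ n * dev \<tau> \<eta>"
proof (induction n)
  case 0
  show ?case by (simp add: T_refl)
next
  case (Suc n)
  let ?s = "\<tau> + real n * h"
  have s: "\<tau> + real (Suc n) * h = ?s + h" by (simp add: algebra_simps)
  have "T (?s + h) \<tau> \<eta> = T (?s + h) ?s (T ?s \<tau> \<eta>)" using h by (simp add: T_comp)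
  then have "dev (?s + h) (T (?s + h) \<tau> \<eta>) \<le> (exp (- \<gamma> * h) + h * RR h) * dev ?s (T ?s \<tau> \<eta>)"
    using dev_step[OF h, of ?s "T ?s \<tau> \<eta>"] by simp
  also have "\<dots> \<le> (exp (- \<gamma> * h) + h * RR h) * ((exp (- \<gamma> * h) + h * RR h) ^ n * dev \<tau> \<eta>)"
    using h RR_nonneg[OF h] by (intro mult_left_mono Suc.IH) auto
  finally show ?case unfolding s by (simp add: mult.assoc)
qed

lemma isCont_step_factor: "isCont DD 0" "isCont RR 0"
  unfolding RR_def[abs_def] GG_def[abs_def] DD_def[abs_def] EE_def[abs_def]
  by (intro continuous_intros; simp)+

lemma dev_decay:
  assumes "\<tau> \<le> t"
  shows "dev t (T t \<tau> \<eta>) \<le> dev \<tau> \<eta> * exp (- \<omega> * (t - \<tau>))"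
proof (cases "t = \<tau>")
  case False
  define x where "x = t - \<tau>"
  have x: "0 < x" using assms False by (simp add: x_def)
  \<comment> \<open>Division by zero gives h 0 = 0, so \<open>h_pos\<close> holds for every n; the
    steps below with n in a denominator use n > 0.\<close>
  define h where "h n = x / real n" for n
  have h_lim: "h \<longlonglongrightarrow> 0" unfolding h_def by (rule lim_const_over_n)
  have h_pos: "0 \<le> h n" for n using x by (simp add: h_def)
  have "(\<lambda>n. h n * DD (h n)) \<longlonglongrightarrow> 0 * DD 0"
    by (intro tendsto_mult h_lim isCont_tendsto_compose[OF isCont_step_factor(1)])
  then have small: "\<forall>\<^sub>F n in sequentially. h n * DD (h n) < 1"
    by (rule order_tendstoD) simp
  have RR0: "RR 0 = (k * L1 + L2) * \<Gamma> (0, 1)"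
    by (simp add: RR_def GG_def EE_def algebra_simps)
  have lim: "(\<lambda>n. x * ((exp (- \<gamma> * h n) - 1) / h n + RR (h n))) \<longlonglongrightarrow> x * (- \<gamma> + RR 0)"
  proof (intro tendsto_mult tendsto_add tendsto_const isCont_tendsto_compose[OF isCont_step_factor(2)] h_lim)
    have "((\<lambda>h. exp (- \<gamma> * h)) has_real_derivative - \<gamma>) (at 0)"
      by (auto intro!: derivative_eq_intros)
    then have "((\<lambda>h. (exp (- \<gamma> * h) - 1) / h) \<longlongrightarrow> - \<gamma>) (at 0)"
      by (simp add: DERIV_def)
    moreover have "filterlim h (at 0) sequentially"
      unfolding filterlim_at using h_lim x by (auto simp: h_def eventually_sequentially intro!: exI[of _ 1])
    ultimately show "(\<lambda>n. (exp (- \<gamma> * h n) - 1) / h n) \<longlonglongrightarrow> - \<gamma>" by (rule filterlim_compose)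
  qed
  have "dev t (T t \<tau> \<eta>) \<le> exp (x * (- \<gamma> + RR 0)) * dev \<tau> \<eta>"
  proof (rule tendsto_lowerbound)
    show "(\<lambda>n. exp (x * ((exp (- \<gamma> * h n) - 1) / h n + RR (h n))) * dev \<tau> \<eta>) \<longlonglongrightarrow> exp (x * (- \<gamma> + RR 0)) * dev \<tau> \<eta>"
      by (intro tendsto_mult tendsto_exp lim tendsto_const)
    show "\<forall>\<^sub>F n in sequentially. dev t (T t \<tau> \<eta>) \<le> exp (x * ((exp (- \<gamma> * h n) - 1) / h n + RR (h n))) * dev \<tau> \<eta>"
      using small eventually_gt_at_top[of 0]
    proof eventually_elim
      case (elim n)
      have t: "t = \<tau> + real n * h n" using elim by (simp add: h_def x_def)
      let ?F = "exp (- \<gamma> * h n) + h n * RR (h n)"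
      have "0 \<le> ?F" using h_pos RR_nonneg[OF h_pos elim(1)] by simp
      \<comment> \<open>By 1 + x \<le> exp x the n-th power is at most exp (n (F - 1)). Only the
        limit of n (F - 1) is then needed, and it is a derivative at 0.\<close>
      have "?F \<le> exp (?F - 1)" using exp_ge_add_one_self[of "?F - 1"] by simp
      then have "?F ^ n \<le> exp (?F - 1) ^ n" using \<open>0 \<le> ?F\<close> by (rule power_mono)
      also have "\<dots> = exp (real n * (?F - 1))" by (simp add: exp_of_nat_mult)
      also have "real n * (?F - 1) = x * ((exp (- \<gamma> * h n) - 1) / h n + RR (h n))"
        using elim x by (simp add: h_def field_simps)
      finally have "?F ^ n * dev \<tau> \<eta> \<le> exp (x * ((exp (- \<gamma> * h n) - 1) / h n + RR (h n))) * dev \<tau> \<eta>"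
        by (rule mult_right_mono[OF _ dev_nonneg])
      then show ?case using dev_iterate[OF h_pos elim(1), of \<tau> n \<eta>] unfolding t[symmetric] by linarith
    qed
  qed simp
  then show ?thesis by (simp add: RR0 \<omega>_def x_def algebra_simps)
qed (simp add: T_refl)

text \<open>The slope equation times k reads (\<gamma> - \<rho>) k = (k L1 + L2) \<Gamma> (1, k),
  which converts the step rate into the stated formula. In the same way \<rho> < \<omega> amounts to
  k \<Gamma> (0, 1) < \<Gamma> (1, k).\<close>

lemma omega_alt: "\<omega> = \<gamma> - (\<gamma> - \<rho>) * L2 * \<Gamma> (0, 1) / (\<gamma> - \<rho> - L1 * \<Gamma> (1, k))"
  and omega_bounds: "\<omega> \<in> {\<rho><..<\<gamma>}"
proof -
  have g1: "0 < \<Gamma> (1, k)" and g0: "0 < \<Gamma> (0, 1)" by (rule Gamma_pos; simp)+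
  have den: "\<gamma> - \<rho> - L1 * \<Gamma> (1, k) = L2 * \<Gamma> (1, k) / k"
    using gamma_minus_mu by (simp add: \<mu>_def)
  have prod: "(\<gamma> - \<rho>) * k = (k * L1 + L2) * \<Gamma> (1, k)"
    using den k_pos by (simp add: field_simps)
  have "(\<gamma> - \<rho>) * L2 * \<Gamma> (0, 1) / (\<gamma> - \<rho> - L1 * \<Gamma> (1, k)) = ((\<gamma> - \<rho>) * k) * \<Gamma> (0, 1) / \<Gamma> (1, k)"
    unfolding den using L2_pos k_pos g1 by (simp add: field_simps)
  also have "\<dots> = (k * L1 + L2) * \<Gamma> (0, 1)"
    unfolding prod using g1 by simp
  finally show "\<omega> = \<gamma> - (\<gamma> - \<rho>) * L2 * \<Gamma> (0, 1) / (\<gamma> - \<rho> - L1 * \<Gamma> (1, k))"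
    by (simp add: \<omega>_def)
  have "\<Gamma> (0, k) < \<Gamma> (1, k)"
    by (rule Gamma_slope_strict[OF L1_pos L2_pos sigma gap k_pos k_less k_eq])
  then have "k * \<Gamma> (0, 1) < \<Gamma> (1, k)" using Gamma_snd[of k] k_pos by simp
  then have "(\<gamma> - \<rho>) * (k * \<Gamma> (0, 1)) < (\<gamma> - \<rho>) * \<Gamma> (1, k)"
    using rho_less_gamma by simp
  moreover have "(k * L1 + L2) * \<Gamma> (0, 1) * \<Gamma> (1, k) = (\<gamma> - \<rho>) * (k * \<Gamma> (0, 1))"
    using arg_cong[OF prod, of "\<lambda>x. x * \<Gamma> (0, 1)", symmetric] by (simp only: mult_ac)
  ultimately have "(k * L1 + L2) * \<Gamma> (0, 1) * \<Gamma> (1, k) < (\<gamma> - \<rho>) * \<Gamma> (1, k)" by linarith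
  then have "(k * L1 + L2) * \<Gamma> (0, 1) < \<gamma> - \<rho>" using g1 by simp
  moreover have "0 < (k * L1 + L2) * \<Gamma> (0, 1)" using k_pos L1_pos L2_pos g0 by (simp add: add_pos_pos)
  ultimately show "\<omega> \<in> {\<rho><..<\<gamma>}" by (simp add: \<omega>_def)
qed

lemma semidist_Man:
  assumes "bounded G"
  shows "\<exists>C>0. \<forall>t \<tau>. \<tau> \<le> t \<longrightarrow>
    semidist (T t \<tau> ` G) (Man t) \<le> ennreal (C * exp (- \<omega> * (t - \<tau>)))"
proof -
  obtain R where R: "0 < R" "\<And>x. x \<in> G \<Longrightarrow> norm x \<le> R"
    using assms bounded_pos by blast
  \<comment> \<open>A bound for the deviation of all points of norm at most R, uniform in time:
    compare with 0, where the graph passes through the origin, and use slope k and the bound M for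
    both seminorms.\<close>
  define C where "C = M * (1 + k) * R"
  have C: "0 < C" using R M_ge_1 k_pos by (simp add: C_def)
  have devC: "dev \<tau> x \<le> C" if "x \<in> G" for \<tau> x
  proof -
    have "dev \<tau> x = nV \<tau> ((x - Q \<tau> x) + (Sg \<tau> 0 - Sg \<tau> x))" by (simp add: dev_def Sg_0 algebra_simps)
    also have "\<dots> \<le> nV \<tau> (x - Q \<tau> x) + nV \<tau> (Sg \<tau> 0 - Sg \<tau> x)" by (rule nV_add)
    also have "nV \<tau> (x - Q \<tau> x) = nV \<tau> x" by (rule nV_cong) (simp add: blinfun.diff_right Q_idem)
    also have "nV \<tau> (Sg \<tau> 0 - Sg \<tau> x) \<le> k * nU \<tau> x"
      using Sg_lipschitz[of \<tau> 0 x] nU_minus[of \<tau> 0 x] by simp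
    also have "nV \<tau> x + k * nU \<tau> x \<le> M * norm x + k * (M * norm x)"
      using k_pos by (intro add_mono mult_left_mono nU_le nV_le) auto
    also have "\<dots> = M * (1 + k) * norm x" by (simp add: algebra_simps)
    also have "\<dots> \<le> C" unfolding C_def using M_ge_1 k_pos R(2)[OF that] by (intro mult_left_mono) auto
    finally show ?thesis by simp
  qed
  have "semidist (T t \<tau> ` G) (Man t) \<le> ennreal (C * exp (- \<omega> * (t - \<tau>)))" if "\<tau> \<le> t" for t \<tau>
    unfolding semidist_def
  proof (rule SUP_least)
    fix y assume "y \<in> T t \<tau> ` G"
    then obtain x where x: "x \<in> G" "y = T t \<tau> x" by blast
    let ?p = "Q t y + Sg t y"
    have "norm (y - ?p) \<le> dev t y"
      using norm_diff_Q_le[of "y - ?p" t]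
      by (simp add: dev_def blinfun.diff_right blinfun.add_right Q_Sg Q_idem)
    also have "\<dots> \<le> dev \<tau> x * exp (- \<omega> * (t - \<tau>))" unfolding x(2) by (rule dev_decay[OF that])
    also have "\<dots> \<le> C * exp (- \<omega> * (t - \<tau>))" by (intro mult_right_mono devC x) simp
    finally have "ennreal (norm (y - ?p)) \<le> ennreal (C * exp (- \<omega> * (t - \<tau>)))" by (rule ennreal_leI)
    then show "(INF b\<in>Man t. ennreal (norm (y - b))) \<le> ennreal (C * exp (- \<omega> * (t - \<tau>)))"
      by (rule INF_lower2[OF graph_in_Man])
  qed
  with C show ?thesis by blast
qed

lemma exp_dominated_Man: "exp_dominated T Man \<omega>"
  unfolding exp_dominated_def
proof (intro allI impI)
  fix G :: "'a set" assume "bounded G"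
  then obtain C where "0 < C" "\<And>t \<tau>. \<tau> \<le> t \<Longrightarrow>
      semidist (T t \<tau> ` G) (Man t) \<le> ennreal (C * exp (- \<omega> * (t - \<tau>)))"
    using semidist_Man by meson
  then show "\<exists>t0\<ge>0. \<exists>K>0. \<forall>t \<tau>. t0 \<le> t - \<tau> \<longrightarrow>
      semidist (T t \<tau> ` G) (Man t) \<le> ennreal (K * exp (- \<omega> * (t - \<tau>)))"
    by (intro exI[of _ 0]) (auto intro!: exI[of _ C])
qed

text \<open>The Lipschitz constant in the original norm acquires the factor M from
  \<open>nU_le\<close>; on the stable side the norm is below \<open>nV\<close>.\<close>

lemma lipschitz_graph_Man: "lipschitz_graph (Q t) (Man t)"
  unfolding lipschitz_graph_def
proof (intro exI conjI)
  show "Sg t ` range (blinfun_apply (Q t)) \<subseteq> range (blinfun_apply (id_blinfun - Q t))"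
  proof
    fix y assume "y \<in> Sg t ` range (blinfun_apply (Q t))"
    then have "y = (id_blinfun - Q t) y" by (auto simp: blinfun.diff_left Q_Sg)
    then show "y \<in> range (blinfun_apply (id_blinfun - Q t))" by (rule range_eqI)
  qed
  show "(k * M)-lipschitz_on (range (blinfun_apply (Q t))) (Sg t)"
  proof (rule lipschitz_onI)
    fix x y
    have "norm (Sg t x - Sg t y) \<le> nV t (Sg t x - Sg t y)"
      using norm_diff_Q_le[of "Sg t x - Sg t y" t] by (simp add: blinfun.diff_right Q_Sg)
    also have "\<dots> \<le> k * nU t (x - y)" by (rule Sg_lipschitz)
    also have "\<dots> \<le> k * (M * norm (x - y))" using k_pos by (intro mult_left_mono nU_le) auto
    finally show "dist (Sg t x) (Sg t y) \<le> k * M * dist x y" by (simp add: dist_norm)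
  qed (use k_pos M_ge_1 in simp)
  show "Man t = (\<lambda>x. x + Sg t x) ` range (blinfun_apply (Q t))"
    unfolding Man_eq(1) by auto
qed

lemma invariant_manifold_Man: "invariant_manifold Q T Man"
  unfolding invariant_manifold_def using T_image_Man exp_dominated_Man lipschitz_graph_Man by blast

lemma S_norm_eq_nV: "Q t x = 0 \<Longrightarrow> S_norm L \<gamma> t x = nV t x"
  by (simp add: nV_def)

lemma S_norm_dev: "S_norm L \<gamma> t (x - (Q t x + Sg t x)) = dev t x"
  unfolding dev_def by (rule S_norm_eq_nV) (simp add: blinfun.diff_right blinfun.add_right Q_Sg Q_idem)

lemma S_norm_Sg: "S_norm L \<gamma> \<tau> (Sg \<tau> \<eta> - Sg \<tau> \<eta>') \<le> k * N_norm L Q \<rho> \<tau> (Q \<tau> (\<eta> - \<eta>'))"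
  using Sg_lipschitz[of \<tau> \<eta> \<eta>'] by (simp add: S_norm_eq_nV blinfun.diff_right[of _ "Sg _ _"] Q_Sg flip: nU_def)

end

theorem theorem3p1:
  fixes L :: "real \<Rightarrow> real \<Rightarrow> 'a::banach \<Rightarrow>\<^sub>L 'a"
    and Q :: "real \<Rightarrow> 'a \<Rightarrow>\<^sub>L 'a"
    and f :: "real \<Rightarrow> 'a \<Rightarrow> 'a"
    and T :: "real \<Rightarrow> real \<Rightarrow> 'a \<Rightarrow> 'a"
    and \<Gamma> :: "real \<times> real \<Rightarrow> real"
    and M \<gamma> \<rho> \<sigma> L1 L2 :: real
  assumes lin: "linear_process L"
    and split: "exponential_splitting L Q M \<gamma> \<rho>"
    and adm: "admissible_norm \<Gamma>"
    and f_cont: "continuous_on UNIV (\<lambda>(t, u). f t u)"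
    and f_zero: "\<And>t. f t 0 = 0"
    and L1_pos: "0 < L1" and L2_pos: "0 < L2"
    and lip_N: "\<And>t u v. N_norm L Q \<rho> t (Q t (f t u - f t v)) \<le> L1 * Gamma_norm \<Gamma> L Q \<gamma> \<rho> t (u - v)"
    and lip_S: "\<And>t u v. S_norm L \<gamma> t ((id_blinfun - Q t) (f t u - f t v)) \<le> L2 * Gamma_norm \<Gamma> L Q \<gamma> \<rho> t (u - v)"
    and proc: "evolution_process T"
    and vcf: "\<And>t \<tau> \<eta>. \<tau> \<le> t \<Longrightarrow>
        T t \<tau> \<eta> = L t \<tau> \<eta> + integral {\<tau>..t} (\<lambda>s. L t s (f s (T s \<tau> \<eta>)))"
    and sigma: "\<sigma> \<in> {\<rho><..<\<gamma>}"
    and gap: "\<Gamma> (L1 / (\<sigma> - \<rho>), L2 / (\<gamma> - \<sigma>)) < 1"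
  shows "let nN = N_norm L Q \<rho>;
             nS = S_norm L \<gamma>;
             nG = Gamma_norm \<Gamma> L Q \<gamma> \<rho>;
             \<M> = (\<lambda>t. {\<eta>. \<exists>z. global_solution T z \<and> z t = \<eta> \<and>
                          bdd_above ((\<lambda>r. exp (\<sigma> * r) * nG r (z r)) ` {..t})});
             \<Sigma> = Sigma_fun \<Gamma> L Q \<gamma> \<rho> \<sigma> f;
             P = (\<lambda>t \<eta>. Q t \<eta> + \<Sigma> t \<eta>);
             \<kappa> = (\<lambda>s. L2 / L1 * ((s - \<rho>) / (\<gamma> - s)))
         in invariant_manifold Q T \<M> \<and>
            (\<forall>\<tau> \<eta>. \<exists>!z. is_z \<Gamma> L Q \<gamma> \<rho> \<sigma> f \<tau> \<eta> z) \<and>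
            (\<forall>\<tau> \<eta>. ((\<lambda>s. L \<tau> s ((id_blinfun - Q s) (f s (z_fun \<Gamma> L Q \<gamma> \<rho> \<sigma> f \<tau> \<eta> s))))
                      has_integral \<Sigma> \<tau> \<eta>) {..\<tau>}) \<and>
            (\<exists>\<kappa>\<^sub>\<Sigma>. let \<omega> = \<gamma> - (\<gamma> - \<rho>) * L2 * \<Gamma> (0, 1) / (\<gamma> - \<rho> - L1 * \<Gamma> (1, \<kappa>\<^sub>\<Sigma>)) in
              \<comment> \<open>(I)\<close>
              (\<forall>t. \<M> t = {Q t \<eta> + \<Sigma> t (Q t \<eta>) | \<eta>. True} \<and> \<M> t = range (P t)) \<and>
              (\<forall>\<tau> \<eta>. \<Sigma> \<tau> \<eta> = \<Sigma> \<tau> (Q \<tau> \<eta>) \<and> \<Sigma> \<tau> \<eta> = (id_blinfun - Q \<tau>) (\<Sigma> \<tau> \<eta>)) \<and>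
              (\<forall>\<tau>. \<Sigma> \<tau> 0 = 0) \<and>
              (\<forall>\<tau> \<eta> \<eta>'. nS \<tau> (\<Sigma> \<tau> \<eta> - \<Sigma> \<tau> \<eta>') \<le> \<kappa>\<^sub>\<Sigma> * nN \<tau> (Q \<tau> (\<eta> - \<eta>'))) \<and>
              0 < \<kappa>\<^sub>\<Sigma> \<and> \<kappa>\<^sub>\<Sigma> < \<kappa> \<sigma> \<and>
              \<gamma> - \<rho> = L1 * \<Gamma> (1, \<kappa>\<^sub>\<Sigma>) + L2 * \<Gamma> (1 / \<kappa>\<^sub>\<Sigma>, 1) \<and>
              \<comment> \<open>the value of \<open>\<kappa>\<^sub>\<Sigma>\<close> is determined by \<open>\<gamma>, \<rho>, L1, L2, \<Gamma>\<close>: it is the same for every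
                  \<open>s\<close> satisfying the gap condition\<close>
              (\<forall>s\<in>{\<rho><..<\<gamma>}. \<Gamma> (L1 / (s - \<rho>), L2 / (\<gamma> - s)) < 1 \<longrightarrow>
                 (\<forall>k. 0 < k \<and> k < \<kappa> s \<and> \<gamma> - \<rho> = L1 * \<Gamma> (1, k) + L2 * \<Gamma> (1 / k, 1)
                      \<longleftrightarrow> k = \<kappa>\<^sub>\<Sigma>)) \<and>
              \<comment> \<open>(II)\<close>
              (\<forall>\<tau>. \<forall>\<eta>\<in>\<M> \<tau>.
                 (\<exists>!z. global_solution T z \<and> z \<tau> = \<eta> \<and> (\<forall>t. z t \<in> \<M> t)) \<and>
                 (\<forall>z. global_solution T z \<and> z \<tau> = \<eta> \<and> (\<forall>t. z t \<in> \<M> t) \<longrightarrow>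
                    (\<forall>t\<le>\<tau>. nG t (z t) \<le>
                       \<Gamma> (1, \<kappa>\<^sub>\<Sigma>) / \<Gamma> (1, 0) * exp (- (\<rho> + L1 * \<Gamma> (1, \<kappa>\<^sub>\<Sigma>)) * (t - \<tau>)) * nG \<tau> \<eta>))) \<and>
              \<comment> \<open>(III)\<close>
              \<omega> \<in> {\<rho><..<\<gamma>} \<and>
              (\<forall>t \<tau> \<eta>. \<tau> \<le> t \<longrightarrow>
                 nS t (T t \<tau> \<eta> - P t (T t \<tau> \<eta>)) \<le> nS \<tau> (\<eta> - P \<tau> \<eta>) * exp (- \<omega> * (t - \<tau>))) \<and>
              \<comment> \<open>(IV)\<close>
              (\<forall>G. bounded G \<longrightarrow>
                 (\<exists>C>0. \<forall>t \<tau>. \<tau> \<le> t \<longrightarrow>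
                    semidist (T t \<tau> ` G) (\<M> t) \<le> ennreal (C * exp (- \<omega> * (t - \<tau>))))) \<and>
              (\<omega> > 0 \<longrightarrow> inertial_manifold Q T \<M>))"
proof -
  interpret \<Gamma>: admissible \<Gamma> by unfold_locales (rule adm)
  obtain k where k: "0 < k" "k < L2 / L1 * ((\<sigma> - \<rho>) / (\<gamma> - \<sigma>))"
    "\<gamma> - \<rho> = L1 * \<Gamma> (1, k) + L2 * \<Gamma> (1 / k, 1)"
    using \<Gamma>.slope_exists[OF L1_pos L2_pos sigma gap] by metis
  interpret perturbed_process L Q M \<gamma> \<rho> \<Gamma> f L1 L2 \<sigma> k T
    by unfold_locales (fact lin split f_cont f_zero L1_pos L2_pos lip_N lip_S sigma gap k proc vcf)+
  have k_unique: "0 < k' \<and> k' < L2 / L1 * ((s - \<rho>) / (\<gamma> - s)) \<and> \<gamma> - \<rho> = L1 * \<Gamma> (1, k') + L2 * \<Gamma> (1 / k', 1) \<longleftrightarrow> k' = k"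
    if s: "s \<in> {\<rho><..<\<gamma>}" "\<Gamma> (L1 / (s - \<rho>), L2 / (\<gamma> - s)) < 1" for s k'
  proof -
    have "k' = k" if "0 < k'" "k' < L2 / L1 * ((s - \<rho>) / (\<gamma> - s))" "\<gamma> - \<rho> = L1 * \<Gamma> (1, k') + L2 * \<Gamma> (1 / k', 1)" for k'
      by (rule \<Gamma>.slope_unique[OF L1_pos L2_pos s sigma gap that k])
    \<comment> \<open>For the direction from right to left, \<open>slope_exists\<close> at s yields
      some root below the bound for s; uniqueness across exponents identifies it with k, so k itself
      satisfies that bound.\<close>
    then show ?thesis using \<Gamma>.slope_exists[OF L1_pos L2_pos s] by metis
  qed
  have growth_back: "nG t (z t) \<le> \<Gamma> (1, k) / \<Gamma> (1, 0) * exp (- (\<rho> + L1 * \<Gamma> (1, k)) * (t - \<tau>)) * nG \<tau> \<eta>"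
    if "\<eta> \<in> Man \<tau>" "global_solution T z \<and> z \<tau> = \<eta> \<and> (\<forall>t. z t \<in> Man t)" "t \<le> \<tau>" for z t \<tau> \<eta>
    using zf_backward_bound[OF that(1,3)] Man_solution_exists_unique(2)[OF that(1-3)] by (simp add: \<mu>_def)
  have inertial: "inertial_manifold Q T Man" if "\<omega> > 0"
    unfolding inertial_manifold_def using that invariant_manifold_Man exp_dominated_Man by blast
  show ?thesis
    unfolding Let_def nG_def[symmetric] Sg_def[symmetric] zf_def[symmetric] Man_def[symmetric] S_norm_dev
  proof (intro conjI exI[of _ k], unfold omega_alt[symmetric])
    show "\<forall>t. Man t = {Q t \<eta> + Sg t (Q t \<eta>) |\<eta>. True} \<and> Man t = range (\<lambda>\<eta>. Q t \<eta> + Sg t \<eta>)"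
      using Man_eq by blast
    show "\<forall>\<tau> \<eta>. Sg \<tau> \<eta> = Sg \<tau> (Q \<tau> \<eta>) \<and> Sg \<tau> \<eta> = (id_blinfun - Q \<tau>) (Sg \<tau> \<eta>)"
      using Sg_cong[of _ _ "Q _ _"] by (simp add: Q_idem blinfun.diff_left Q_Sg)
    show "\<forall>\<tau>. \<forall>\<eta>\<in>Man \<tau>. (\<exists>!z. global_solution T z \<and> z \<tau> = \<eta> \<and> (\<forall>t. z t \<in> Man t)) \<and>
        (\<forall>z. global_solution T z \<and> z \<tau> = \<eta> \<and> (\<forall>t. z t \<in> Man t) \<longrightarrow>
          (\<forall>t\<le>\<tau>. nG t (z t) \<le> \<Gamma> (1, k) / \<Gamma> (1, 0) * exp (- (\<rho> + L1 * \<Gamma> (1, k)) * (t - \<tau>)) * nG \<tau> \<eta>))"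
      using Man_solution_exists_unique(1) growth_back by blast
    show "\<forall>t \<tau> \<eta>. \<tau> \<le> t \<longrightarrow> dev t (T t \<tau> \<eta>) \<le> dev \<tau> \<eta> * exp (- \<omega> * (t - \<tau>))"
      using dev_decay by blast
    show "\<forall>s\<in>{\<rho><..<\<gamma>}. \<Gamma> (L1 / (s - \<rho>), L2 / (\<gamma> - s)) < 1 \<longrightarrow>
        (\<forall>k'. 0 < k' \<and> k' < L2 / L1 * ((s - \<rho>) / (\<gamma> - s)) \<and> \<gamma> - \<rho> = L1 * \<Gamma> (1, k') + L2 * \<Gamma> (1 / k', 1) \<longleftrightarrow> k' = k)"
      using k_unique by blast
  qed ((intro allI impI)?,
      (fact invariant_manifold_Man is_z_exists_unique Sg_has_integral Sg_0 S_norm_Sg k omega_bounds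
        | (rule semidist_Man inertial, assumption)))+
qed

end
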